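(* ${\mathrm{LNDT}}$ and $2$-${\mathrm{LK}}$ are polynomially equivalent, and tree-like ${\mathrm{LNDT}}$ and tree-like $2$-${\mathrm{LK}}$ are polynomially equivalent. That is (for each of the dag-like and tree-like versions): (i) there is a polynomial-time procedure which, given a proof in ${\mathrm{LNDT}}$ of a sequent $A_0,\dots,A_{m-1}\to B_0,\dots,B_{n-1}$ of DT formulas, outputs a $2$-${\mathrm{LK}}$ proof of ${\mathrm{Cls}}(A_0),\dots,{\mathrm{Cls}}(A_{m-1})\to{\mathrm{Tms}}(B_0),\dots,{\mathrm{Tms}}(B_{n-1})$; and (ii) there is a polynomial-time procedure which, given a $2$-${\mathrm{LK}}$ proof of a sequent $\bigvee\vec a_0,\dots,\bigvee\vec a_{m-1}\to\bigwedge\vec b_0,\dots,\bigwedge\vec b_{n-1}$ with the $\vec a_i,\vec b_j$ nonempty sequences of literals, outputs an ${\mathrm{LNDT}}$ proof of ${\mathrm{Disj}}(\vec a_0),\dots,{\mathrm{Disj}}(\vec a_{m-1})\to{\mathrm{Conj}}(\vec b_0),\dots,{\mathrm{Conj}}(\vec b_{n-1})$; in the tree-like version both input and output proofs are tree-like.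
   Context: A literal is a propositional variable $x$ or its negation $\overline x$. DT formulas: literals, and $(ApB)$ for DT formulas $A,B$ and literal $p$ ("if $p$ is false then $A$, else $B$"). NDT formulas: same clauses plus $(A\lor B)$ for NDT formulas $A,B$. Formula size = number of atomic occurrences; proof size = sum of sizes of formulas. Sequents $\Gamma\to\Delta$ have multisets of formulas on each side. ${\mathrm{LNDT}}$: lines are sequents of NDT formulas; initial sequents $p\to p$, $p,\overline p\to$, $\to p,\overline p$; rules contraction, weakening, cut, dec-l (from $A,\Gamma\to\Delta,p$ and $p,B,\Gamma\to\Delta$ infer $ApB,\Gamma\to\Delta$), dec-r (from $\Gamma\to\Delta,A,p$ and $p,\Gamma\to\Delta,B$ infer $\Gamma\to\Delta,ApB$), $\lor$-l (from $A,\Gamma\to\Delta$ and $B,\Gamma\to\Delta$ infer $A\lor B,\Gamma\to\Delta$), $\lor$-r (from $\Gamma\to\Delta,A,B$ infer $\Gamma\to\Delta,A\lor B$). Proofs are dag-like unless specified tree-like. ${\mathrm{LK}}$ is the usual sequent calculus for Boolean formulas built from literals with binary $\land,\lor$ (same initial sequents, contraction, weakening, cut, and the standard left/right $\land,\lor$ rules). A clause is a disjunction of literals, a term a conjunction of literals; $\bigvee\vec p$ / $\bigwedge\vec p$ denote any disjunction / conjunction of the literals of $\vec p$ in order with arbitrary nesting. A Boolean formula is depth two if it is a clause, a term, a conjunction of clauses, or a disjunction of terms; $2$-${\mathrm{LK}}$ is ${\mathrm{LK}}$ with all formulas in proofs depth two. ${\mathrm{Conj}}(p):=p$, ${\mathrm{Conj}}(p,\vec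 p):=(p\,p\,{\mathrm{Conj}}(\vec p))$; ${\mathrm{Disj}}(p):=p$, ${\mathrm{Disj}}(p,\vec p):=({\mathrm{Disj}}(\vec p)\,p\,p)$. For a DT formula $A$: ${\mathrm{Tms}}(p)={\mathrm{Cls}}(p)=\{p\}$; ${\mathrm{Tms}}(BpC)=\{\overline p\land D:D\in{\mathrm{Tms}}(B)\}\cup\{p\land D:D\in{\mathrm{Tms}}(C)\}$; ${\mathrm{Cls}}(BpC)=\{p\lor D:D\in{\mathrm{Cls}}(B)\}\cup\{\overline p\lor D:D\in{\mathrm{Cls}}(C)\}$ (associated right to left); in sequents these multisets are used as cedents. *)

theory Defs
  imports "HOL-Library.Multiset" "HOL-Computational_Algebra.Polynomial"
begin

section \<open>Formulas\<close>

datatype lit = Pos nat | Neg nat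

primrec neg :: "lit \<Rightarrow> lit" where
  "neg (Pos x) = Neg x"
| "neg (Neg x) = Pos x"

text \<open>\<open>DDec A p B\<close> and \<open>NDec A p B\<close> stand for \<open>(ApB)\<close>: if \<open>p\<close> is false then \<open>A\<close>, else \<open>B\<close>.\<close>

datatype dt = DLit lit | DDec dt lit dt

datatype ndt = NLit lit | NDec ndt lit ndt | NOr ndt ndt

primrec ndt_of :: "dt \<Rightarrow> ndt" where
  "ndt_of (DLit p) = NLit p"
| "ndt_of (DDec A p B) = NDec (ndt_of A) p (ndt_of B)"

datatype bform = BLit lit | BAnd bform bform | BOr bform bform

primrec ndt_size :: "ndt \<Rightarrow> nat" where
  "ndt_size (NLit p) = 1"
| "ndt_size (NDec A p B) = ndt_size A + 1 + ndt_size B"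
| "ndt_size (NOr A B) = ndt_size A + ndt_size B"

primrec bform_size :: "bform \<Rightarrow> nat" where
  "bform_size (BLit p) = 1"
| "bform_size (BAnd A B) = bform_size A + bform_size B"
| "bform_size (BOr A B) = bform_size A + bform_size B"

text \<open>\<open>nested_or As F\<close>: \<open>F\<close> is a disjunction of the formulas \<open>As\<close>, in this order, with some
  nesting of the binary connective; likewise \<open>nested_and\<close>.\<close>

inductive nested_or :: "bform list \<Rightarrow> bform \<Rightarrow> bool" where
  "nested_or [A] A"
| "nested_or As F \<Longrightarrow> nested_or Bs G \<Longrightarrow> nested_or (As @ Bs) (BOr F G)"

inductive nested_and :: "bform list \<Rightarrow> bform \<Rightarrow> bool" where
  "nested_and [A] A"
| "nested_and As F \<Longrightarrow> nested_and Bs G \<Longrightarrow> nested_and (As @ Bs) (BAnd F G)"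

definition big_or :: "lit list \<Rightarrow> bform \<Rightarrow> bool" where
  "big_or ps F \<longleftrightarrow> nested_or (map BLit ps) F"

definition big_and :: "lit list \<Rightarrow> bform \<Rightarrow> bool" where
  "big_and ps F \<longleftrightarrow> nested_and (map BLit ps) F"

definition clause :: "bform \<Rightarrow> bool" where
  "clause F \<longleftrightarrow> (\<exists>ps. big_or ps F)"

definition dnf_term :: "bform \<Rightarrow> bool" where
  "dnf_term F \<longleftrightarrow> (\<exists>ps. big_and ps F)"

definition depth_two :: "bform \<Rightarrow> bool" where
  "depth_two F \<longleftrightarrow> clause F \<or> dnf_term F
     \<or> (\<exists>Cs. (\<forall>C\<in>set Cs. clause C) \<and> nested_and Cs F)
     \<or> (\<exists>Ts. (\<forall>T\<in>set Ts. dnf_term T) \<and> nested_or Ts F)"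

text \<open>\<open>Conj\<close> and \<open>Disj\<close> are only meant for nonempty sequences.\<close>

fun Conj :: "lit list \<Rightarrow> dt" where
  "Conj [p] = DLit p"
| "Conj (p # q # ps) = DDec (DLit p) p (Conj (q # ps))"

fun Disj :: "lit list \<Rightarrow> dt" where
  "Disj [p] = DLit p"
| "Disj (p # q # ps) = DDec (Disj (q # ps)) p (DLit p)"

primrec Tms :: "dt \<Rightarrow> bform multiset" where
  "Tms (DLit p) = {#BLit p#}"
| "Tms (DDec B p C) =
     {#BAnd (BLit (neg p)) D. D \<in># Tms B#} + {#BAnd (BLit p) D. D \<in># Tms C#}"

primrec Cls :: "dt \<Rightarrow> bform multiset" where
  "Cls (DLit p) = {#BLit p#}"
| "Cls (DDec B p C) =
     {#BOr (BLit p) D. D \<in># Cls B#} + {#BOr (BLit (neg p)) D. D \<in># Cls C#}"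


section \<open>Sequent calculi\<close>

type_synonym 'f sequent = "'f multiset \<times> 'f multiset"

datatype rule = Init_id | Init_l | Init_r | Contr_l | Contr_r | Weak_l | Weak_r | Cut
  | Dec_l | Dec_r | And_l | And_r | Or_l | Or_r

text \<open>\<open>lndt r A Ss S\<close>: the rule \<open>r\<close> infers \<open>S\<close> from the list of premises \<open>Ss\<close>, where \<open>A\<close> is the
  cut formula if \<open>r\<close> is a cut, the literal displayed first if \<open>r\<close> is an initial sequent, and the
  principal formula otherwise. The same convention is used for \<open>lk\<close>.\<close>

inductive lndt :: "rule \<Rightarrow> ndt \<Rightarrow> ndt sequent list \<Rightarrow> ndt sequent \<Rightarrow> bool" where
  "lndt Init_id (NLit p) [] ({#NLit p#}, {#NLit p#})"
| "lndt Init_l (NLit p) [] ({#NLit p, NLit (neg p)#}, {#})"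
| "lndt Init_r (NLit p) [] ({#}, {#NLit p, NLit (neg p)#})"
| "lndt Contr_l A [({#A, A#} + \<Gamma>, \<Delta>)] ({#A#} + \<Gamma>, \<Delta>)"
| "lndt Contr_r A [(\<Gamma>, \<Delta> + {#A, A#})] (\<Gamma>, \<Delta> + {#A#})"
| "lndt Weak_l A [(\<Gamma>, \<Delta>)] ({#A#} + \<Gamma>, \<Delta>)"
| "lndt Weak_r A [(\<Gamma>, \<Delta>)] (\<Gamma>, \<Delta> + {#A#})"
| "lndt Cut A [(\<Gamma>, \<Delta> + {#A#}), ({#A#} + \<Gamma>, \<Delta>)] (\<Gamma>, \<Delta>)"
| "lndt Dec_l (NDec A p B) [({#A#} + \<Gamma>, \<Delta> + {#NLit p#}), ({#NLit p, B#} + \<Gamma>, \<Delta>)]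
     ({#NDec A p B#} + \<Gamma>, \<Delta>)"
| "lndt Dec_r (NDec A p B) [(\<Gamma>, \<Delta> + {#A, NLit p#}), ({#NLit p#} + \<Gamma>, \<Delta> + {#B#})]
     (\<Gamma>, \<Delta> + {#NDec A p B#})"
| "lndt Or_l (NOr A B) [({#A#} + \<Gamma>, \<Delta>), ({#B#} + \<Gamma>, \<Delta>)] ({#NOr A B#} + \<Gamma>, \<Delta>)"
| "lndt Or_r (NOr A B) [(\<Gamma>, \<Delta> + {#A, B#})] (\<Gamma>, \<Delta> + {#NOr A B#})"

inductive lk :: "rule \<Rightarrow> bform \<Rightarrow> bform sequent list \<Rightarrow> bform sequent \<Rightarrow> bool" where
  "lk Init_id (BLit p) [] ({#BLit p#}, {#BLit p#})"
| "lk Init_l (BLit p) [] ({#BLit p, BLit (neg p)#}, {#})"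
| "lk Init_r (BLit p) [] ({#}, {#BLit p, BLit (neg p)#})"
| "lk Contr_l A [({#A, A#} + \<Gamma>, \<Delta>)] ({#A#} + \<Gamma>, \<Delta>)"
| "lk Contr_r A [(\<Gamma>, \<Delta> + {#A, A#})] (\<Gamma>, \<Delta> + {#A#})"
| "lk Weak_l A [(\<Gamma>, \<Delta>)] ({#A#} + \<Gamma>, \<Delta>)"
| "lk Weak_r A [(\<Gamma>, \<Delta>)] (\<Gamma>, \<Delta> + {#A#})"
| "lk Cut A [(\<Gamma>, \<Delta> + {#A#}), ({#A#} + \<Gamma>, \<Delta>)] (\<Gamma>, \<Delta>)"
| "lk And_l (BAnd A B) [({#A, B#} + \<Gamma>, \<Delta>)] ({#BAnd A B#} + \<Gamma>, \<Delta>)"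
| "lk And_r (BAnd A B) [(\<Gamma>, \<Delta> + {#A#}), (\<Gamma>, \<Delta> + {#B#})] (\<Gamma>, \<Delta> + {#BAnd A B#})"
| "lk Or_l (BOr A B) [({#A#} + \<Gamma>, \<Delta>), ({#B#} + \<Gamma>, \<Delta>)] ({#BOr A B#} + \<Gamma>, \<Delta>)"
| "lk Or_r (BOr A B) [(\<Gamma>, \<Delta> + {#A, B#})] (\<Gamma>, \<Delta> + {#BOr A B#})"

definition two_lk :: "rule \<Rightarrow> bform \<Rightarrow> bform sequent list \<Rightarrow> bform sequent \<Rightarrow> bool" where
  "two_lk r A Ss S \<longleftrightarrow> lk r A Ss S
     \<and> (\<forall>(\<Gamma>, \<Delta>) \<in> set (S # Ss). \<forall>F \<in># \<Gamma> + \<Delta>. depth_two F)"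


section \<open>Proofs\<close>

text \<open>A line consists of a sequent and the rule and formula (as above) of the inference deriving
  it. Cedents are written down as lists, so that proofs are concrete data a procedure can read and
  write, but inferences only see the underlying multisets.\<close>

type_synonym 'f line = "rule \<times> 'f \<times> 'f list \<times> 'f list"

fun seq_of :: "'f line \<Rightarrow> 'f sequent" where
  "seq_of (r, A, \<Gamma>, \<Delta>) = (mset \<Gamma>, mset \<Delta>)"

text \<open>\<open>prem i\<close> lists the indices of the lines used as premises of line \<open>i\<close>.\<close>

definition justifies ::
  "(rule \<Rightarrow> 'f \<Rightarrow> 'f sequent list \<Rightarrow> 'f sequent \<Rightarrow> bool) \<Rightarrow> (nat \<Rightarrow> nat list) \<Rightarrow> 'f line list \<Rightarrow> bool"
where
  "justifies infer prem \<pi> \<longleftrightarrow> (\<forall>i < length \<pi>.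
     (\<forall>j \<in> set (prem i). j < i) \<and>
     infer (fst (\<pi> ! i)) (fst (snd (\<pi> ! i))) (map (\<lambda>j. seq_of (\<pi> ! j)) (prem i)) (seq_of (\<pi> ! i)))"

datatype shape = Dag_like | Tree_like

text \<open>A tree-like proof is one whose lines can be arranged as a tree rooted at the last line: every
  other line is used exactly once as a premise.\<close>

definition proof_of ::
  "(rule \<Rightarrow> 'f \<Rightarrow> 'f sequent list \<Rightarrow> 'f sequent \<Rightarrow> bool) \<Rightarrow> shape \<Rightarrow> 'f line list \<Rightarrow> 'f sequent \<Rightarrow> bool"
where
  "proof_of infer sh \<pi> S \<longleftrightarrow> \<pi> \<noteq> [] \<and> seq_of (last \<pi>) = S \<and>
     (\<exists>prem. justifies infer prem \<pi> \<and>
        (sh = Tree_like \<longrightarrow>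
           mset (concat (map prem [0..<length \<pi>])) = mset [0..<length \<pi> - 1]))"

definition proof_size :: "('f \<Rightarrow> nat) \<Rightarrow> 'f line list \<Rightarrow> nat" where
  "proof_size fsize \<pi> = (\<Sum>(r, A, \<Gamma>, \<Delta>) \<leftarrow> \<pi>. sum_list (map fsize (\<Gamma> @ \<Delta>)))"


section \<open>Polynomial-time procedures\<close>

text \<open>Procedures are while-programs (without named variables) on binary trees. An atom is a symbol
  of an infinite alphabet: a program can only copy atoms and compare them for equality. The running
  time charges every evaluation step with the size of the tree it is applied to, so it covers an
  implementation that copies all trees, and in particular it bounds the size of every value computed.
  Counting an atom as one unit agrees with measuring formulas by their number of atomic occurrences;
  on a Turing machine each unit costs at most a polynomial in the length of the names of the atoms.
  \<open>Atom 0\<close> serves as the empty list and as the truth value false.\<close>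

datatype val = Atom nat | Pair val val

primrec vsize :: "val \<Rightarrow> nat" where
  "vsize (Atom n) = 1"
| "vsize (Pair a b) = 1 + vsize a + vsize b"

datatype prog = PConst val | PId | PFst | PSnd | PEq
  | PCons prog prog | PSeq prog prog | PIf prog prog prog | PWhile prog prog

primrec vfst :: "val \<Rightarrow> val" where
  "vfst (Atom n) = Atom 0"
| "vfst (Pair a b) = a"

primrec vsnd :: "val \<Rightarrow> val" where
  "vsnd (Atom n) = Atom 0"
| "vsnd (Pair a b) = b"

primrec veq :: "val \<Rightarrow> val" where
  "veq (Atom n) = Atom 0"
| "veq (Pair a b) = (if a = b then Atom 1 else Atom 0)"

text \<open>\<open>run P x y t\<close>: on input \<open>x\<close> the program \<open>P\<close> halts with output \<open>y\<close> after time \<open>t\<close>.\<close>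

inductive run :: "prog \<Rightarrow> val \<Rightarrow> val \<Rightarrow> nat \<Rightarrow> bool" where
  run_Const: "run (PConst v) x v (vsize x + vsize v)"
| run_Id: "run PId x x (vsize x)"
| run_Fst: "run PFst x (vfst x) (vsize x)"
| run_Snd: "run PSnd x (vsnd x) (vsize x)"
| run_Eq: "run PEq x (veq x) (vsize x)"
| run_Cons: "run P x y s \<Longrightarrow> run Q x z t \<Longrightarrow> run (PCons P Q) x (Pair y z) (vsize x + s + t)"
| run_Seq: "run P x y s \<Longrightarrow> run Q y z t \<Longrightarrow> run (PSeq P Q) x z (vsize x + s + t)"
| run_If_true: "run C x c s \<Longrightarrow> c \<noteq> Atom 0 \<Longrightarrow> run P x y t \<Longrightarrow> run (PIf C P Q) x y (vsize x + s + t)"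
| run_If_false: "run C x (Atom 0) s \<Longrightarrow> run Q x y t \<Longrightarrow> run (PIf C P Q) x y (vsize x + s + t)"
| run_While_true: "run C x c s \<Longrightarrow> c \<noteq> Atom 0 \<Longrightarrow> run P x y t \<Longrightarrow> run (PWhile C P) y z u \<Longrightarrow>
    run (PWhile C P) x z (vsize x + s + t + u)"
| run_While_false: "run C x (Atom 0) s \<Longrightarrow> run (PWhile C P) x x (vsize x + s)"

inductive_cases run_ConstE: "run (PConst v) x y t"
inductive_cases run_IdE: "run PId x y t"
inductive_cases run_FstE: "run PFst x y t"
inductive_cases run_SndE: "run PSnd x y t"
inductive_cases run_EqE: "run PEq x y t"
inductive_cases run_ConsE: "run (PCons P Q) x y t"
inductive_cases run_SeqE: "run (PSeq P Q) x y t"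
inductive_cases run_IfE: "run (PIf C P Q) x y t"
inductive_cases run_WhileE: "run (PWhile C P) x y t"

lemma run_deterministic: "run P x y t \<Longrightarrow> run P x y' t' \<Longrightarrow> y' = y \<and> t' = t"
proof (induction P x y t arbitrary: y' t' rule: run.induct)
  case (run_Cons P x a s Q b u)
  from \<open>run (PCons P Q) x y' t'\<close> obtain a' s' b' u'
    where "run P x a' s'" "run Q x b' u'" "y' = Pair a' b'" "t' = vsize x + s' + u'"
    by (rule run_ConsE) blast
  with run_Cons.IH show ?case by blast
next
  case (run_Seq P x a s Q b u)
  from \<open>run (PSeq P Q) x y' t'\<close> obtain a' s' u'
    where "run P x a' s'" "run Q a' y' u'" "t' = vsize x + s' + u'"
    by (rule run_SeqE) blast
  with run_Seq.IH show ?case by blast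
next
  case (run_If_true C x c s P y t Q)
  from \<open>run (PIf C P Q) x y' t'\<close> obtain c' s' u'
    where "run C x c' s'" "t' = vsize x + s' + u'"
      "c' \<noteq> Atom 0 \<and> run P x y' u' \<or> c' = Atom 0 \<and> run Q x y' u'"
    by (rule run_IfE) blast+
  with run_If_true.IH run_If_true.hyps show ?case by blast
next
  case (run_If_false C x s Q y t P)
  from \<open>run (PIf C P Q) x y' t'\<close> obtain c' s' u'
    where "run C x c' s'" "t' = vsize x + s' + u'"
      "c' \<noteq> Atom 0 \<and> run P x y' u' \<or> c' = Atom 0 \<and> run Q x y' u'"
    by (rule run_IfE) blast+
  with run_If_false.IH show ?case by blast
next
  case (run_While_true C x c s P y t z u)
  from \<open>run (PWhile C P) x y' t'\<close> obtain c' s' a' u' v'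
    where "run C x c' s'"
      "c' \<noteq> Atom 0 \<and> run P x a' u' \<and> run (PWhile C P) a' y' v' \<and> t' = vsize x + s' + u' + v'
        \<or> c' = Atom 0 \<and> y' = x \<and> t' = vsize x + s'"
    by (rule run_WhileE) blast+
  with run_While_true.IH run_While_true.hyps show ?case by blast
next
  case (run_While_false C x s P)
  from \<open>run (PWhile C P) x y' t'\<close> obtain c' s' a' u' v'
    where "run C x c' s'"
      "c' \<noteq> Atom 0 \<and> run P x a' u' \<and> run (PWhile C P) a' y' v' \<and> t' = vsize x + s' + u' + v'
        \<or> c' = Atom 0 \<and> y' = x \<and> t' = vsize x + s'"
    by (rule run_WhileE) blast+
  with run_While_false.IH show ?case by blast
qed (blast elim: run_ConstE run_IdE run_FstE run_SndE run_EqE)+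

lemma run_output_size: "run P x y t \<Longrightarrow> vsize y \<le> t"
proof (induction rule: run.induct)
  case (run_Fst x)
  show ?case by (cases x) auto
next
  case (run_Snd x)
  show ?case by (cases x) auto
next
  case (run_Eq x)
  show ?case by (cases x) auto
next
  case (run_Cons P x y s Q z t)
  have "1 \<le> vsize x" by (cases x) auto
  with run_Cons.IH show ?case by simp
qed auto


section \<open>Encoding of proofs as trees\<close>

primrec enc_lit :: "lit \<Rightarrow> val" where
  "enc_lit (Pos x) = Pair (Atom 0) (Atom x)"
| "enc_lit (Neg x) = Pair (Atom 1) (Atom x)"

primrec enc_ndt :: "ndt \<Rightarrow> val" where
  "enc_ndt (NLit p) = Pair (Atom 0) (enc_lit p)"
| "enc_ndt (NDec A p B) = Pair (Atom 1) (Pair (enc_ndt A) (Pair (enc_lit p) (enc_ndt B)))"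
| "enc_ndt (NOr A B) = Pair (Atom 2) (Pair (enc_ndt A) (enc_ndt B))"

primrec enc_bform :: "bform \<Rightarrow> val" where
  "enc_bform (BLit p) = Pair (Atom 0) (enc_lit p)"
| "enc_bform (BAnd A B) = Pair (Atom 1) (Pair (enc_bform A) (enc_bform B))"
| "enc_bform (BOr A B) = Pair (Atom 2) (Pair (enc_bform A) (enc_bform B))"

primrec enc_rule :: "rule \<Rightarrow> val" where
  "enc_rule Init_id = Atom 0"
| "enc_rule Init_l = Atom 1"
| "enc_rule Init_r = Atom 2"
| "enc_rule Contr_l = Atom 3"
| "enc_rule Contr_r = Atom 4"
| "enc_rule Weak_l = Atom 5"
| "enc_rule Weak_r = Atom 6"
| "enc_rule Cut = Atom 7"
| "enc_rule Dec_l = Atom 8"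
| "enc_rule Dec_r = Atom 9"
| "enc_rule And_l = Atom 10"
| "enc_rule And_r = Atom 11"
| "enc_rule Or_l = Atom 12"
| "enc_rule Or_r = Atom 13"

primrec enc_list :: "('x \<Rightarrow> val) \<Rightarrow> 'x list \<Rightarrow> val" where
  "enc_list enc [] = Atom 0"
| "enc_list enc (x # xs) = Pair (enc x) (enc_list enc xs)"

fun enc_line :: "('f \<Rightarrow> val) \<Rightarrow> 'f line \<Rightarrow> val" where
  "enc_line enc (r, A, \<Gamma>, \<Delta>) =
     Pair (enc_rule r) (Pair (enc A) (Pair (enc_list enc \<Gamma>) (enc_list enc \<Delta>)))"

definition enc_proof :: "('f \<Rightarrow> val) \<Rightarrow> 'f line list \<Rightarrow> val" where
  "enc_proof enc = enc_list (enc_line enc)"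

lemma enc_lit_inj: "enc_lit p = enc_lit q \<longleftrightarrow> p = q"
  by (cases p; cases q) auto

lemma enc_ndt_inj: "enc_ndt A = enc_ndt B \<longleftrightarrow> A = B"
proof (induction A arbitrary: B)
  case (NLit p)
  show ?case by (cases B) (auto simp: enc_lit_inj)
next
  case (NDec A1 p A2)
  then show ?case by (cases B) (auto simp: enc_lit_inj)
next
  case (NOr A1 A2)
  then show ?case by (cases B) auto
qed

lemma enc_bform_inj: "enc_bform A = enc_bform B \<longleftrightarrow> A = B"
proof (induction A arbitrary: B)
  case (BLit p)
  show ?case by (cases B) (auto simp: enc_lit_inj)
next
  case (BAnd A1 A2)
  then show ?case by (cases B) auto
next
  case (BOr A1 A2)
  then show ?case by (cases B) auto
qed

lemma enc_rule_inj: "enc_rule r = enc_rule s \<longleftrightarrow> r = s"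
  by (cases r; cases s) simp_all

lemma enc_list_inj: "inj enc \<Longrightarrow> enc_list enc xs = enc_list enc ys \<longleftrightarrow> xs = ys"
proof (induction xs arbitrary: ys)
  case Nil
  show ?case by (cases ys) auto
next
  case (Cons x xs)
  then show ?case by (cases ys) (auto dest: injD)
qed

lemma enc_proof_inj:
  assumes "inj enc"
  shows "inj (enc_proof enc)"
proof -
  have "inj (enc_line enc)"
    using assms by (auto intro!: injI simp: enc_rule_inj enc_list_inj dest: injD)
  then show ?thesis
    unfolding enc_proof_def by (auto intro!: injI simp: enc_list_inj)
qed

text \<open>\<open>outputs_in_time P q enc fsize enc' \<pi> \<pi>'\<close>: from the proof \<open>\<pi>\<close> the program \<open>P\<close> produces the
  proof \<open>\<pi>'\<close> in time \<open>q\<close> of the size of \<open>\<pi>\<close>.\<close>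

definition outputs_in_time ::
  "prog \<Rightarrow> nat poly \<Rightarrow> ('f \<Rightarrow> val) \<Rightarrow> ('f \<Rightarrow> nat) \<Rightarrow> ('g \<Rightarrow> val) \<Rightarrow> 'f line list \<Rightarrow> 'g line list \<Rightarrow> bool"
where
  "outputs_in_time P q enc fsize enc' \<pi> \<pi>' \<longleftrightarrow>
     (\<exists>t. run P (enc_proof enc \<pi>) (enc_proof enc' \<pi>') t \<and> t \<le> poly q (proof_size fsize \<pi>))"

end

theory Submission
  imports Defs
begin

text \<open>An inference of either calculus is determined by its rule, its principal formula and its
  conclusion. Hence a proof can be translated line by line: every line becomes a block of lines that
  derives the translated conclusion from the translated premises and uses each of them exactly once,
  so that tree-like proofs stay tree-like and the positions of the premises need not be known.

  An NDT formula is translated into a disjunction of terms, one for each path to a leaf; the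
  decision rules are simulated by cuts with short proofs relating the disjunctions for \<open>A\<close>, \<open>B\<close> and
  \<open>ApB\<close>. Conversely, disjunctions of terms are translated into disjunctions of formulas \<open>Conj\<close>, and
  a conjunction of clauses is replaced by its dual on the other side of the sequent. In the end,
  cuts with short proofs turn the translated formulas of the end sequent into the required ones.

  Running times are handled by closure properties of the functions computable in polynomial time,
  in particular under structural recursion with results of polynomial size.\<close>

section \<open>Polynomial-time functions\<close>

text \<open>Premises may be used only once, so where an argument needs something twice, a short side
  derivation is repeated or a formula is duplicated and contracted. Expanding NDT formulas into
  terms stays polynomial because formulas are trees: there are at most as many paths as leaves, and
  each decision adds one literal to a path. Lists of path clauses, in contrast, exist only for DT
  formulas, so clauses meet the terms only when the end sequent is converted. In the other direction
  nondeterminism offers disjunctions but no conjunctions of clauses. Clauses and terms count as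
  disjunctions of terms and keep their side, so only proper conjunctions of clauses move. The two
  kinds meet in the conjunction rules alone, where a formula that moves is built from clauses or
  terms that do not; short proofs of excluded middle and of contradiction for a clause and its dual
  carry these across. For the running time, the output of a program is no larger than its time, so
  composition is free; recursion is controlled by bounding how much one step adds to the sizes of
  the recursive results.\<close>

class encodable =
  fixes repr :: "'a \<Rightarrow> val"
  assumes repr_inject: "repr x = repr y \<longleftrightarrow> x = y"

instantiation bool :: encodable
begin
definition [simp]: "repr b = Atom (if b then 1 else 0)"
instance by standard auto
end

instantiation lit :: encodable
begin
definition [simp]: "repr p = enc_lit p"
instance by standard (simp add: enc_lit_inj)
end

instantiation ndt :: encodable
begin
definition [simp]: "repr A = enc_ndt A"
instance by standard (simp add: enc_ndt_inj)
end

instantiation bform :: encodable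
begin
definition [simp]: "repr F = enc_bform F"
instance by standard (simp add: enc_bform_inj)
end

instantiation rule :: encodable
begin
definition [simp]: "repr r = enc_rule r"
instance by standard (simp add: enc_rule_inj)
end

instantiation prod :: (encodable, encodable) encodable
begin
definition repr_prod: "repr p = Pair (repr (fst p)) (repr (snd p))"
instance by standard (auto simp: repr_prod repr_inject prod_eq_iff)
end

lemma repr_Pair [simp]: "repr (a, b) = Pair (repr a) (repr b)"
  by (simp add: repr_prod)

instantiation list :: (encodable) encodable
begin
definition repr_list: "repr xs = enc_list repr xs"
instance by standard (simp add: repr_list enc_list_inj inj_def repr_inject)
end

lemma repr_Nil [simp]: "repr [] = Atom 0"
  and repr_Cons [simp]: "repr (x # xs) = Pair (repr x) (repr xs)"
  by (simp_all add: repr_list)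

text \<open>Links the encoding fixed by \<open>outputs_in_time\<close> to the class encoding, so
  that all closure properties can be phrased with \<open>repr\<close>.\<close>

lemma enc_proof_repr:
  assumes "\<And>F. repr F = e F"
  shows "enc_proof e \<pi> = repr \<pi>"
proof -
  have "repr = e" using assms by auto
  moreover from this have "enc_line e l = repr l" for l
    by (cases l) (simp add: repr_list)
  ultimately show ?thesis
    by (simp add: enc_proof_def repr_list) (metis ext)
qed

section \<open>Sizes of codes\<close>

definition vsz :: "'a::encodable \<Rightarrow> nat" where
  "vsz x = vsize (repr x)"

lemma vsize_pos: "vsize v > 0"
  by (cases v) auto

lemma vsz_pos [simp]: "vsz x > 0"
  by (simp add: vsz_def vsize_pos)

lemma vsz_simps [simp]:
  "vsz (a, b) = 1 + vsz a + vsz b"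
  "vsz [] = 1"
  "vsz (x # xs) = 1 + vsz x + vsz xs"
  "vsz (c :: bool) = 1"
  "vsz (p :: lit) = 3"
  "vsz (NLit p) = 5"
  "vsz (NDec A p B) = 7 + vsz A + vsz B"
  "vsz (NOr A B) = 3 + vsz A + vsz B"
  "vsz (BLit p) = 5"
  "vsz (BAnd F G) = 3 + vsz F + vsz G"
  "vsz (BOr F G) = 3 + vsz F + vsz G"
  "vsz (r :: rule) = 1"
  by (cases p, simp_all add: vsz_def, cases p, simp_all, cases p, simp_all, cases p, simp_all,
      cases p, simp_all, cases r, simp_all)

text \<open>The subtracted 1 is the end marker of \<open>xs\<close>, whose place \<open>ys\<close>
  takes.\<close>

lemma vsz_append [simp]: "vsz (xs @ ys) = vsz xs + (vsz ys - 1)"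
  by (induction xs) auto

lemma poly_nat_mono: "x \<le> y \<Longrightarrow> poly (q :: nat poly) x \<le> poly q y"
  by (induction q) (auto intro!: add_mono mult_mono)

text \<open>Functions from an index set into trees make it possible to reason about the branches of a
  case distinction separately, each on the part of the domain on which it is taken.\<close>

definition ptime_on :: "'i set \<Rightarrow> ('i \<Rightarrow> val) \<Rightarrow> ('i \<Rightarrow> val) \<Rightarrow> bool" where
  "ptime_on S a b \<longleftrightarrow>
     (\<exists>P (q :: nat poly). \<forall>i\<in>S. \<exists>t. run P (a i) (b i) t \<and> t \<le> poly q (vsize (a i)))"

definition ptime :: "('a::encodable \<Rightarrow> 'b::encodable) \<Rightarrow> bool" where
  "ptime f \<longleftrightarrow> ptime_on UNIV repr (\<lambda>x. repr (f x))"

lemma ptime_onI: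
  assumes "\<And>i. i \<in> S \<Longrightarrow> \<exists>t. run P (a i) (b i) t \<and> t \<le> poly (q :: nat poly) (vsize (a i))"
  shows "ptime_on S a b"
  using assms unfolding ptime_on_def by blast

lemma ptime_on_subset: "ptime_on S a b \<Longrightarrow> T \<subseteq> S \<Longrightarrow> ptime_on T a b"
  unfolding ptime_on_def by (meson subsetD)

lemma ptime_on_cong: "(\<And>i. i \<in> S \<Longrightarrow> b i = b' i) \<Longrightarrow> ptime_on S a b \<Longrightarrow> ptime_on S a b'"
  unfolding ptime_on_def by (simp cong: ball_cong)

lemma ptime_on_id: "ptime_on S a a"
  by (rule ptime_onI[where P = PId and q = "[:0, 1:]"]) (auto intro: run_Id)

lemma ptime_on_const: "ptime_on S a (\<lambda>_. v)"
  by (rule ptime_onI[where P = "PConst v" and q = "[:vsize v, 1:]"]) (auto intro: exI run_Const)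

text \<open>By \<open>run_output_size\<close> the intermediate value is no larger than the time of
  the first program, so the time of the second is bounded by a composed polynomial.\<close>

lemma ptime_on_seq:
  assumes "ptime_on S a b" "ptime_on S b c"
  shows "ptime_on S a c"
proof -
  from assms(1) obtain P p where P: "\<And>i. i \<in> S \<Longrightarrow> \<exists>t. run P (a i) (b i) t \<and> t \<le> poly p (vsize (a i))"
    unfolding ptime_on_def by blast
  from assms(2) obtain Q q where Q: "\<And>i. i \<in> S \<Longrightarrow> \<exists>t. run Q (b i) (c i) t \<and> t \<le> poly q (vsize (b i))"
    unfolding ptime_on_def by blast
  show ?thesis
  proof (rule ptime_onI[where P = "PSeq P Q" and q = "[:0, 1:] + p + pcompose q p"])
    fix i assume "i \<in> S"
    with P Q obtain s t where s: "run P (a i) (b i) s" "s \<le> poly p (vsize (a i))"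
      and t: "run Q (b i) (c i) t" "t \<le> poly q (vsize (b i))" by blast
    have "vsize (b i) \<le> poly p (vsize (a i))"
      using run_output_size[OF s(1)] s(2) by simp
    then have "t \<le> poly q (poly p (vsize (a i)))"
      using t(2) poly_nat_mono le_trans by blast
    with s t show "\<exists>t. run (PSeq P Q) (a i) (c i) t
        \<and> t \<le> poly ([:0, 1:] + p + pcompose q p) (vsize (a i))"
      by (intro exI[of _ "vsize (a i) + s + t"]) (auto simp: poly_pcompose intro: run_Seq)
  qed
qed

lemma ptime_on_Pair:
  assumes "ptime_on S a b" "ptime_on S a c"
  shows "ptime_on S a (\<lambda>i. Pair (b i) (c i))"
proof -
  from assms(1) obtain P p where P: "\<And>i. i \<in> S \<Longrightarrow> \<exists>t. run P (a i) (b i) t \<and> t \<le> poly p (vsize (a i))"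
    unfolding ptime_on_def by blast
  from assms(2) obtain Q q where Q: "\<And>i. i \<in> S \<Longrightarrow> \<exists>t. run Q (a i) (c i) t \<and> t \<le> poly q (vsize (a i))"
    unfolding ptime_on_def by blast
  show ?thesis
  proof (rule ptime_onI[where P = "PCons P Q" and q = "[:0, 1:] + p + q"])
    fix i assume "i \<in> S"
    with P Q obtain s t where s: "run P (a i) (b i) s" "s \<le> poly p (vsize (a i))"
      and t: "run Q (a i) (c i) t" "t \<le> poly q (vsize (a i))" by blast
    then show "\<exists>t. run (PCons P Q) (a i) (Pair (b i) (c i)) t
        \<and> t \<le> poly ([:0, 1:] + p + q) (vsize (a i))"
      by (intro exI[of _ "vsize (a i) + s + t"]) (auto intro: run_Cons)
  qed
qed

lemma ptime_on_vfst: "ptime_on S a b \<Longrightarrow> ptime_on S a (\<lambda>i. vfst (b i))"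
  by (erule ptime_on_seq, rule ptime_onI[where P = PFst and q = "[:0, 1:]"]) (auto intro: run_Fst)

lemma ptime_on_vsnd: "ptime_on S a b \<Longrightarrow> ptime_on S a (\<lambda>i. vsnd (b i))"
  by (erule ptime_on_seq, rule ptime_onI[where P = PSnd and q = "[:0, 1:]"]) (auto intro: run_Snd)

lemma ptime_on_eq:
  assumes "ptime_on S a b" "ptime_on S a c"
  shows "ptime_on S a (\<lambda>i. repr (b i = c i))"
proof -
  have "ptime_on S a (\<lambda>i. veq (Pair (b i) (c i)))"
    by (rule ptime_on_seq[OF ptime_on_Pair[OF assms]],
        rule ptime_onI[where P = PEq and q = "[:0, 1:]"]) (auto intro: run_Eq simp del: veq.simps)
  then show ?thesis by (rule ptime_on_cong[rotated]) simp
qed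

lemma ptime_on_If:
  assumes "ptime_on S a (\<lambda>i. repr (c i))"
    and "ptime_on {i \<in> S. c i} a b1" "ptime_on {i \<in> S. \<not> c i} a b2"
  shows "ptime_on S a (\<lambda>i. if c i then b1 i else b2 i)"
proof -
  from assms(1) obtain C p where C: "\<And>i. i \<in> S \<Longrightarrow> \<exists>t. run C (a i) (repr (c i)) t \<and> t \<le> poly p (vsize (a i))"
    unfolding ptime_on_def by blast
  from assms(2) obtain P q where P: "\<And>i. i \<in> {i \<in> S. c i} \<Longrightarrow> \<exists>t. run P (a i) (b1 i) t \<and> t \<le> poly q (vsize (a i))"
    unfolding ptime_on_def by blast
  from assms(3) obtain Q r where Q: "\<And>i. i \<in> {i \<in> S. \<not> c i} \<Longrightarrow> \<exists>t. run Q (a i) (b2 i) t \<and> t \<le> poly r (vsize (a i))"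
    unfolding ptime_on_def by blast
  show ?thesis
  proof (rule ptime_onI[where P = "PIf C P Q" and q = "[:0, 1:] + p + q + r"])
    fix i assume i: "i \<in> S"
    with C obtain s where s: "run C (a i) (repr (c i)) s" "s \<le> poly p (vsize (a i))" by blast
    show "\<exists>t. run (PIf C P Q) (a i) (if c i then b1 i else b2 i) t
        \<and> t \<le> poly ([:0, 1:] + p + q + r) (vsize (a i))"
    proof (cases "c i")
      case True
      with P i obtain t where "run P (a i) (b1 i) t" "t \<le> poly q (vsize (a i))" by blast
      with s True show ?thesis
        by (intro exI[of _ "vsize (a i) + s + t"]) (auto intro: run_If_true)
    next
      case False
      with Q i obtain t where "run Q (a i) (b2 i) t" "t \<le> poly r (vsize (a i))" by blast
      with s False show ?thesis
        by (intro exI[of _ "vsize (a i) + s + t"]) (auto intro: run_If_false)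
    qed
  qed
qed

lemma ptime_on_app:
  assumes "ptime g" "ptime_on S a (\<lambda>i. repr (y i))"
  shows "ptime_on S a (\<lambda>i. repr (g (y i)))"
proof -
  from assms(1) obtain P p where P: "\<And>x. \<exists>t. run P (repr x) (repr (g x)) t \<and> t \<le> poly p (vsize (repr x))"
    unfolding ptime_def ptime_on_def by blast
  then have "ptime_on S (\<lambda>i. repr (y i)) (\<lambda>i. repr (g (y i)))"
    by (intro ptime_onI) blast
  with assms(2) show ?thesis by (rule ptime_on_seq)
qed

section \<open>Closure properties of polynomial-time functions\<close>

named_theorems ptime_intros

lemma ptime_app: "ptime g \<Longrightarrow> ptime f \<Longrightarrow> ptime (\<lambda>x. g (f x))"
  unfolding ptime_def[of f] ptime_def[of "\<lambda>x. g (f x)"] by (rule ptime_on_app)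

lemma ptime_id [ptime_intros]: "ptime (\<lambda>x. x)"
  unfolding ptime_def by (rule ptime_on_id)

lemma ptime_const [ptime_intros]: "ptime (\<lambda>_. c)"
  unfolding ptime_def by (rule ptime_on_const)

lemma ptime_pair [ptime_intros]: "ptime f \<Longrightarrow> ptime g \<Longrightarrow> ptime (\<lambda>x. (f x, g x))"
  unfolding ptime_def by (simp add: ptime_on_Pair)

text \<open>A program reads a single tree, so a curried function is called polynomial-time through
  its version on nested pairs; this and the next lemmas return to the curried form.\<close>

lemma ptime_app2:
  "ptime (\<lambda>p. h (fst p) (snd p)) \<Longrightarrow> ptime f \<Longrightarrow> ptime g \<Longrightarrow> ptime (\<lambda>x. h (f x) (g x))"
  by (drule ptime_app[OF _ ptime_pair]) auto

lemma ptime_app3: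
  "ptime (\<lambda>p. h (fst p) (fst (snd p)) (snd (snd p))) \<Longrightarrow> ptime f1 \<Longrightarrow> ptime f2 \<Longrightarrow> ptime f3 \<Longrightarrow>
   ptime (\<lambda>x. h (f1 x) (f2 x) (f3 x))"
  by (drule ptime_app[OF _ ptime_pair[OF _ ptime_pair], of _ f1 f2 f3]) auto

lemma ptime_app4:
  "ptime (\<lambda>p. h (fst p) (fst (snd p)) (fst (snd (snd p))) (snd (snd (snd p)))) \<Longrightarrow>
   ptime f1 \<Longrightarrow> ptime f2 \<Longrightarrow> ptime f3 \<Longrightarrow> ptime f4 \<Longrightarrow> ptime (\<lambda>x. h (f1 x) (f2 x) (f3 x) (f4 x))"
  by (drule ptime_app[OF _ ptime_pair[OF _ ptime_pair[OF _ ptime_pair]], of _ f1 f2 f3 f4]) auto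

lemma ptime_app5:
  "ptime (\<lambda>p. h (fst p) (fst (snd p)) (fst (snd (snd p))) (fst (snd (snd (snd p)))) (snd (snd (snd (snd p))))) \<Longrightarrow>
   ptime f1 \<Longrightarrow> ptime f2 \<Longrightarrow> ptime f3 \<Longrightarrow> ptime f4 \<Longrightarrow> ptime f5 \<Longrightarrow>
   ptime (\<lambda>x. h (f1 x) (f2 x) (f3 x) (f4 x) (f5 x))"
  by (drule ptime_app[OF _ ptime_pair[OF _ ptime_pair[OF _ ptime_pair[OF _ ptime_pair]]], of _ f1 f2 f3 f4 f5]) auto

lemma ptime_app6:
  "ptime (\<lambda>p. h (fst p) (fst (snd p)) (fst (snd (snd p))) (fst (snd (snd (snd p))))
     (fst (snd (snd (snd (snd p))))) (snd (snd (snd (snd (snd p)))))) \<Longrightarrow>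
   ptime f1 \<Longrightarrow> ptime f2 \<Longrightarrow> ptime f3 \<Longrightarrow> ptime f4 \<Longrightarrow> ptime f5 \<Longrightarrow> ptime f6 \<Longrightarrow>
   ptime (\<lambda>x. h (f1 x) (f2 x) (f3 x) (f4 x) (f5 x) (f6 x))"
  by (drule ptime_app[OF _ ptime_pair[OF _ ptime_pair[OF _ ptime_pair[OF _ ptime_pair[OF _ ptime_pair]]]],
        of _ f1 f2 f3 f4 f5 f6]) auto

lemma ptime_fst [ptime_intros]: "ptime f \<Longrightarrow> ptime (\<lambda>x. fst (f x))"
  unfolding ptime_def by (drule ptime_on_vfst) (simp add: repr_prod)

lemma ptime_snd [ptime_intros]: "ptime f \<Longrightarrow> ptime (\<lambda>x. snd (f x))"
  unfolding ptime_def by (drule ptime_on_vsnd) (simp add: repr_prod)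

lemma ptime_If [ptime_intros]:
  assumes "ptime c" "ptime f" "ptime g"
  shows "ptime (\<lambda>x. if c x then f x else g x)"
proof -
  have "ptime_on UNIV repr (\<lambda>x. if c x then repr (f x) else repr (g x))"
    using assms unfolding ptime_def
    by (intro ptime_on_If) (auto intro: ptime_on_subset)
  then show ?thesis unfolding ptime_def by (rule ptime_on_cong[rotated]) simp
qed

text \<open>\<open>PEq\<close> compares trees; this is where injectivity of \<open>repr\<close>
  turns equality of codes into equality of data.\<close>

lemma ptime_eq [ptime_intros]: "ptime f \<Longrightarrow> ptime g \<Longrightarrow> ptime (\<lambda>x. f x = g x)"
  unfolding ptime_def by (drule (1) ptime_on_eq) (simp only: repr_inject)

lemma ptime_not [ptime_intros]: "ptime c \<Longrightarrow> ptime (\<lambda>x. \<not> c x)"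
  by (drule ptime_eq[OF _ ptime_const, of _ False]) simp

lemma ptime_conj [ptime_intros]:
  assumes "ptime c" "ptime d"
  shows "ptime (\<lambda>x. c x \<and> d x)"
proof -
  have "(\<lambda>x. c x \<and> d x) = (\<lambda>x. if c x then d x else False)" by auto
  then show ?thesis using ptime_If[OF assms(1,2) ptime_const, of False] by simp
qed

lemma ptime_disj [ptime_intros]:
  assumes "ptime c" "ptime d"
  shows "ptime (\<lambda>x. c x \<or> d x)"
proof -
  have "(\<lambda>x. c x \<or> d x) = (\<lambda>x. if c x then True else d x)" by auto
  then show ?thesis using ptime_If[OF assms(1) ptime_const assms(2), of True] by simp
qed

lemma ptime_Cons [ptime_intros]: "ptime f \<Longrightarrow> ptime g \<Longrightarrow> ptime (\<lambda>x. f x # g x)"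
  unfolding ptime_def by (simp add: ptime_on_Pair)

lemma ptime_NLit [ptime_intros]: "ptime f \<Longrightarrow> ptime (\<lambda>x. NLit (f x))"
  unfolding ptime_def by (simp add: ptime_on_Pair ptime_on_const)

lemma ptime_NDec [ptime_intros]:
  "ptime f \<Longrightarrow> ptime p \<Longrightarrow> ptime g \<Longrightarrow> ptime (\<lambda>x. NDec (f x) (p x) (g x))"
  unfolding ptime_def by (simp add: ptime_on_Pair ptime_on_const)

lemma ptime_NOr [ptime_intros]: "ptime f \<Longrightarrow> ptime g \<Longrightarrow> ptime (\<lambda>x. NOr (f x) (g x))"
  unfolding ptime_def by (simp add: ptime_on_Pair ptime_on_const)

lemma ptime_BLit [ptime_intros]: "ptime f \<Longrightarrow> ptime (\<lambda>x. BLit (f x))"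
  unfolding ptime_def by (simp add: ptime_on_Pair ptime_on_const)

lemma ptime_BAnd [ptime_intros]: "ptime f \<Longrightarrow> ptime g \<Longrightarrow> ptime (\<lambda>x. BAnd (f x) (g x))"
  unfolding ptime_def by (simp add: ptime_on_Pair ptime_on_const)

lemma ptime_BOr [ptime_intros]: "ptime f \<Longrightarrow> ptime g \<Longrightarrow> ptime (\<lambda>x. BOr (f x) (g x))"
  unfolding ptime_def by (simp add: ptime_on_Pair ptime_on_const)

section \<open>Case distinctions on encoded data\<close>

lemma ptime_on_tag:
  assumes "ptime_on UNIV repr v"
  shows "ptime_on UNIV repr (\<lambda>x. repr (vfst (v x) = Atom k))"
  by (intro ptime_on_eq ptime_on_vfst assms ptime_on_const)

text \<open>The code of a nonempty list is already the pair of the codes of head and tail, so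
  pairing it with the input gives the argument of \<open>b\<close> without any destructor.\<close>

lemma ptime_case_list [ptime_intros]:
  assumes "ptime F" "ptime a" "ptime (\<lambda>p. b (fst p) (fst (snd p)) (snd (snd p)))"
  shows "ptime (\<lambda>x. case F x of [] \<Rightarrow> a x | y # ys \<Rightarrow> b x y ys)"
proof -
  let ?G = "\<lambda>x. if F x = [] then repr (a x) else repr (b x (hd (F x)) (tl (F x)))"
  have "ptime_on {x. F x \<noteq> []} repr (\<lambda>x. repr (x, hd (F x), tl (F x)))"
  proof (rule ptime_on_cong)
    show "ptime_on {x. F x \<noteq> []} repr (\<lambda>x. Pair (repr x) (repr (F x)))"
      using assms(1) unfolding ptime_def
      by (intro ptime_on_Pair ptime_on_id) (auto intro: ptime_on_subset)
    show "Pair (repr x) (repr (F x)) = repr (x, hd (F x), tl (F x))" if "x \<in> {x. F x \<noteq> []}" for x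
      using that by (cases "F x") auto
  qed
  from ptime_on_app[OF assms(3) this]
  have "ptime_on UNIV repr ?G"
    using assms(1,2) ptime_eq[OF assms(1) ptime_const, of "[]"] unfolding ptime_def
    by (intro ptime_on_If) (auto intro: ptime_on_subset)
  then show ?thesis
    unfolding ptime_def by (rule ptime_on_cong[rotated]) (auto split: list.splits)
qed


lemma ptime_on_tags:
  assumes v: "ptime_on UNIV repr v"
    and "ptime_on {x. vfst (v x) = Atom 0} repr a" "ptime_on {x. vfst (v x) = Atom 1} repr b"
      "ptime_on {x. vfst (v x) \<noteq> Atom 0 \<and> vfst (v x) \<noteq> Atom 1} repr c"
  shows "ptime_on UNIV repr (\<lambda>x. if vfst (v x) = Atom 0 then a x
    else if vfst (v x) = Atom 1 then b x else c x)"
proof -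
  have tag: "ptime_on S repr (\<lambda>x. repr (vfst (v x) = Atom k))" for k S
    using ptime_on_tag[OF v] by (rule ptime_on_subset) simp
  show ?thesis
    by (intro ptime_on_If tag; rule assms(2-4)[THEN ptime_on_subset]) auto
qed

lemma ptime_case_bform [ptime_intros]:
  assumes "ptime F" "ptime (\<lambda>p. a (fst p) (snd p))"
    "ptime (\<lambda>p. b (fst p) (fst (snd p)) (snd (snd p)))"
    "ptime (\<lambda>p. c (fst p) (fst (snd p)) (snd (snd p)))"
  shows "ptime (\<lambda>x. case F x of BLit p \<Rightarrow> a x p | BAnd A B \<Rightarrow> b x A B | BOr A B \<Rightarrow> c x A B)"
proof -
  let ?v = "\<lambda>x. repr (F x)"
  have v: "ptime_on UNIV repr ?v" using assms(1) unfolding ptime_def .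
  have arg: "ptime_on S repr (\<lambda>x. Pair (repr x) (vsnd (?v x)))" for S
    using v by (intro ptime_on_Pair ptime_on_id ptime_on_vsnd) (auto intro: ptime_on_subset)
  \<comment> \<open>The missing cases are unspecified values; each selector is applied only where
    the tag guarantees a constructor that it covers.\<close>
  define P where "P x = (case F x of BLit p \<Rightarrow> p)" for x
  define L where "L x = (case F x of BAnd A B \<Rightarrow> A | BOr A B \<Rightarrow> A)" for x
  define R where "R x = (case F x of BAnd A B \<Rightarrow> B | BOr A B \<Rightarrow> B)" for x
  have F: "vfst (?v x) = Atom 0 \<Longrightarrow> F x = BLit (P x)"
    "vfst (?v x) = Atom 1 \<Longrightarrow> F x = BAnd (L x) (R x)"
    "vfst (?v x) \<noteq> Atom 0 \<Longrightarrow> vfst (?v x) \<noteq> Atom 1 \<Longrightarrow> F x = BOr (L x) (R x)" for x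
    by (cases "F x"; simp add: P_def L_def R_def)+
  have 1: "ptime_on {x. vfst (?v x) = Atom 0} repr (\<lambda>x. repr (x, P x))"
    by (rule ptime_on_cong[OF _ arg], drule CollectD, drule F(1), simp)
  have 2: "ptime_on {x. vfst (?v x) = Atom 1} repr (\<lambda>x. repr (x, L x, R x))"
    by (rule ptime_on_cong[OF _ arg], drule CollectD, drule F(2), simp)
  have 3: "ptime_on {x. vfst (?v x) \<noteq> Atom 0 \<and> vfst (?v x) \<noteq> Atom 1} repr (\<lambda>x. repr (x, L x, R x))"
    by (rule ptime_on_cong[OF _ arg], drule CollectD, erule conjE, drule (1) F(3), simp)
  let ?H = "\<lambda>x. if vfst (?v x) = Atom 0 then repr (a x (P x))
    else if vfst (?v x) = Atom 1 then repr (b x (L x) (R x)) else repr (c x (L x) (R x))"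
  have "ptime_on UNIV repr ?H"
    using ptime_on_tags[OF v ptime_on_app[OF assms(2) 1] ptime_on_app[OF assms(3) 2]
      ptime_on_app[OF assms(4) 3]] by (simp only: fst_conv snd_conv cong: if_cong)
  moreover have "?H x = repr (case F x of BLit p \<Rightarrow> a x p | BAnd A B \<Rightarrow> b x A B | BOr A B \<Rightarrow> c x A B)" for x
    by (cases "F x") (simp_all add: P_def L_def R_def)
  ultimately show ?thesis
    unfolding ptime_def by simp
qed

lemma ptime_case_ndt [ptime_intros]:
  assumes "ptime F" "ptime (\<lambda>p. a (fst p) (snd p))"
    "ptime (\<lambda>p. b (fst p) (fst (snd p)) (fst (snd (snd p))) (snd (snd (snd p))))"
    "ptime (\<lambda>p. c (fst p) (fst (snd p)) (snd (snd p)))"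
  shows "ptime (\<lambda>x. case F x of NLit p \<Rightarrow> a x p | NDec A p B \<Rightarrow> b x A p B | NOr A B \<Rightarrow> c x A B)"
proof -
  let ?v = "\<lambda>x. repr (F x)"
  have v: "ptime_on UNIV repr ?v" using assms(1) unfolding ptime_def .
  have arg: "ptime_on S repr (\<lambda>x. Pair (repr x) (vsnd (?v x)))" for S
    using v by (intro ptime_on_Pair ptime_on_id ptime_on_vsnd) (auto intro: ptime_on_subset)
  define P where "P x = (case F x of NLit p \<Rightarrow> p | NDec A p B \<Rightarrow> p)" for x
  define L where "L x = (case F x of NDec A p B \<Rightarrow> A | NOr A B \<Rightarrow> A)" for x
  define R where "R x = (case F x of NDec A p B \<Rightarrow> B | NOr A B \<Rightarrow> B)" for x
  have F: "vfst (?v x) = Atom 0 \<Longrightarrow> F x = NLit (P x)"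
    "vfst (?v x) = Atom 1 \<Longrightarrow> F x = NDec (L x) (P x) (R x)"
    "vfst (?v x) \<noteq> Atom 0 \<Longrightarrow> vfst (?v x) \<noteq> Atom 1 \<Longrightarrow> F x = NOr (L x) (R x)" for x
    by (cases "F x"; simp add: P_def L_def R_def)+
  have 1: "ptime_on {x. vfst (?v x) = Atom 0} repr (\<lambda>x. repr (x, P x))"
    by (rule ptime_on_cong[OF _ arg], drule CollectD, drule F(1), simp)
  have 2: "ptime_on {x. vfst (?v x) = Atom 1} repr (\<lambda>x. repr (x, L x, P x, R x))"
    by (rule ptime_on_cong[OF _ arg], drule CollectD, drule F(2), simp)
  have 3: "ptime_on {x. vfst (?v x) \<noteq> Atom 0 \<and> vfst (?v x) \<noteq> Atom 1} repr (\<lambda>x. repr (x, L x, R x))"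
    by (rule ptime_on_cong[OF _ arg], drule CollectD, erule conjE, drule (1) F(3), simp)
  let ?H = "\<lambda>x. if vfst (?v x) = Atom 0 then repr (a x (P x))
    else if vfst (?v x) = Atom 1 then repr (b x (L x) (P x) (R x)) else repr (c x (L x) (R x))"
  have "ptime_on UNIV repr ?H"
    using ptime_on_tags[OF v ptime_on_app[OF assms(2) 1] ptime_on_app[OF assms(3) 2]
      ptime_on_app[OF assms(4) 3]] by (simp only: fst_conv snd_conv cong: if_cong)
  moreover have "?H x = repr (case F x of NLit p \<Rightarrow> a x p | NDec A p B \<Rightarrow> b x A p B | NOr A B \<Rightarrow> c x A B)" for x
    by (cases "F x") (simp_all add: P_def L_def R_def)
  ultimately show ?thesis
    unfolding ptime_def by simp
qed

lemma ptime_neg [ptime_intros]: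
  assumes "ptime f"
  shows "ptime (\<lambda>x. neg (f x))"
proof -
  let ?v = "\<lambda>x. repr (f x)"
  have v: "ptime_on S repr ?v" for S
    using assms unfolding ptime_def by (rule ptime_on_subset) simp
  have "ptime_on UNIV repr (\<lambda>x. if vfst (?v x) = Atom 0
      then Pair (Atom 1) (vsnd (?v x)) else Pair (Atom 0) (vsnd (?v x)))"
    by (intro ptime_on_If ptime_on_tag ptime_on_Pair ptime_on_const ptime_on_vsnd v)
  moreover have "(if vfst (?v x) = Atom 0 then Pair (Atom 1) (vsnd (?v x))
      else Pair (Atom 0) (vsnd (?v x))) = repr (neg (f x))" for x
    by (cases "f x") auto
  ultimately show ?thesis unfolding ptime_def by simp
qed

lemma ptime_vsz:
  assumes "ptime f"
  obtains q where "\<And>x. vsz (f x) \<le> poly (q :: nat poly) (vsz x)"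
proof -
  from assms obtain P q where "\<forall>x. \<exists>t. run P (repr x) (repr (f x)) t \<and> t \<le> poly q (vsize (repr x))"
    unfolding ptime_def ptime_on_def by blast
  then have "vsz (f x) \<le> poly q (vsz x)" for x
    unfolding vsz_def by (meson run_output_size le_trans)
  then show ?thesis by (rule that)
qed

subsection \<open>Loops and recursion\<close>

text \<open>The bound \<open>b\<close> is imposed on every state and not just on the last one,
  because each round of a loop is charged with the size of its state.\<close>

primrec iterates :: "('a::encodable \<Rightarrow> bool) \<Rightarrow> ('a \<Rightarrow> 'a) \<Rightarrow> nat \<Rightarrow> nat \<Rightarrow> 'a \<Rightarrow> 'a \<Rightarrow> bool" where
  "iterates c s b 0 x y \<longleftrightarrow> x = y \<and> vsz x \<le> b"
| "iterates c s b (Suc k) x y \<longleftrightarrow> c x \<and> vsz x \<le> b \<and> iterates c s b k (s x) y"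

lemma iterates_trans:
  "iterates c s b k x y \<Longrightarrow> iterates c s b l y z \<Longrightarrow> iterates c s b (k + l) x z"
  by (induction k arbitrary: x) auto

lemma ptime_while:
  assumes "ptime c" "ptime s" "ptime i"
    and z: "\<And>x. \<exists>k \<le> poly qk (vsz x). iterates c s (poly qb (vsz x)) k (i x) (z x) \<and> \<not> c (z x)"
  shows "ptime z"
proof -
  from assms(1) obtain C p where C: "\<And>x. \<exists>t. run C (repr x) (repr (c x)) t \<and> t \<le> poly p (vsz x)"
    unfolding ptime_def ptime_on_def vsz_def by blast
  from assms(2) obtain Q q where Q: "\<And>x. \<exists>t. run Q (repr x) (repr (s x)) t \<and> t \<le> poly q (vsz x)"
    unfolding ptime_def ptime_on_def vsz_def by blast
  from assms(3) obtain I r where I: "\<And>x. \<exists>t. run I (repr x) (repr (i x)) t \<and> t \<le> poly r (vsz x)"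
    unfolding ptime_def ptime_on_def vsz_def by blast
  \<comment> \<open>The factor is \<open>k + 1\<close> because the final, failing test is also
    charged.\<close>
  have loop: "\<exists>t. run (PWhile C Q) (repr x) (repr y) t \<and> t \<le> (k + 1) * (b + poly p b + poly q b)"
    if "iterates c s b k x y" "\<not> c y" for b k x y
    using that
  proof (induction k arbitrary: x)
    case 0
    then have [simp]: "x = y" and b: "vsz y \<le> b" by auto
    from C[of y] obtain t where t: "run C (repr y) (Atom 0) t" "t \<le> poly p (vsz y)"
      using 0 by auto
    then have "t \<le> poly p b" using poly_nat_mono[OF b] le_trans by blast
    with t b show ?case
      by (intro exI[of _ "vsize (repr x) + t"]) (auto intro: run_While_false simp: vsz_def)
  next
    case (Suc k)
    then have x: "c x" "vsz x \<le> b" by auto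
    from C[of x] obtain t where t: "run C (repr x) (Atom 1) t" "t \<le> poly p (vsz x)"
      using x by auto
    from Q[of x] obtain u where u: "run Q (repr x) (repr (s x)) u" "u \<le> poly q (vsz x)"
      by blast
    from Suc obtain w where w: "run (PWhile C Q) (repr (s x)) (repr y) w"
      "w \<le> (k + 1) * (b + poly p b + poly q b)" by auto
    have "t \<le> poly p b" "u \<le> poly q b" using t(2) u(2) poly_nat_mono[OF x(2)] le_trans by blast+
    with t u w x show ?case
      by (intro exI[of _ "vsize (repr x) + t + u + w"])
        (auto intro!: run_While_true[where c = "Atom 1"] simp: vsz_def)
  qed
  have "\<exists>t. run (PSeq I (PWhile C Q)) (repr x) (repr (z x)) t \<and> t \<le>
      poly ([:0, 1:] + r + (qk + 1) * (qb + pcompose p qb + pcompose q qb)) (vsize (repr x))" for x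
  proof -
    from z[of x] obtain k where k: "k \<le> poly qk (vsz x)"
      "iterates c s (poly qb (vsz x)) k (i x) (z x)" "\<not> c (z x)" by blast
    from loop[OF k(2,3)] obtain t where t: "run (PWhile C Q) (repr (i x)) (repr (z x)) t"
      "t \<le> (k + 1) * (poly qb (vsz x) + poly p (poly qb (vsz x)) + poly q (poly qb (vsz x)))"
      by blast
    from I[of x] obtain u where u: "run I (repr x) (repr (i x)) u" "u \<le> poly r (vsz x)" by blast
    have "t \<le> (poly qk (vsz x) + 1) * (poly qb (vsz x) + poly p (poly qb (vsz x)) + poly q (poly qb (vsz x)))"
      using t(2) k(1) by (meson add_le_mono1 le_trans mult_le_mono1)
    with t(1) u show ?thesis
      by (intro exI[of _ "vsize (repr x) + u + t"])
        (auto intro: run_Seq simp: poly_pcompose vsz_def)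
  qed
  then show ?thesis unfolding ptime_def by (intro ptime_onI) blast
qed

text \<open>The stack machine that evaluates a binary recursion: a todo item \<open>(False, x)\<close> asks for the
  value at \<open>x\<close>, an item \<open>(True, x)\<close> combines the two topmost results.\<close>

lemma ptime_rec:
  fixes f :: "'a::encodable \<Rightarrow> 'b::encodable"
  assumes pt: "ptime leaf" "ptime g" "ptime l" "ptime r"
    "ptime (\<lambda>p. h (fst p) (fst (snd p)) (snd (snd p)))"
    and f: "\<And>x. f x = (if leaf x then g x else h x (f (l x)) (f (r x)))"
    and m: "\<And>x. \<not> leaf x \<Longrightarrow> m (l x) + m (r x) < m x"
    and mq: "\<And>x. m x \<le> vsz x"
    and size: "\<And>x. \<not> leaf x \<Longrightarrow> vsz (l x) \<le> vsz x" "\<And>x. \<not> leaf x \<Longrightarrow> vsz (r x) \<le> vsz x"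
    and fq: "\<And>x. vsz (f x) \<le> poly q (vsz x)"
  shows "ptime f"
proof -
  define c :: "(bool \<times> 'a) list \<times> 'b list \<Rightarrow> bool" where "c = (\<lambda>st. fst st \<noteq> [])"
  \<comment> \<open>The right argument is evaluated after the left one, so its value
    \<open>b\<close> lies on top of \<open>a\<close> when an item is combined.\<close>
  define s :: "(bool \<times> 'a) list \<times> 'b list \<Rightarrow> (bool \<times> 'a) list \<times> 'b list" where
    "s = (\<lambda>st. case fst st of [] \<Rightarrow> st
      | t # ts \<Rightarrow> if fst t then
            (case snd st of [] \<Rightarrow> st | b # bs \<Rightarrow> (case bs of [] \<Rightarrow> st | a # rs \<Rightarrow>
               (ts, h (snd t) a b # rs)))
          else if leaf (snd t) then (ts, g (snd t) # snd st)
          else ((False, l (snd t)) # (False, r (snd t)) # (True, snd t) # ts, snd st))"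
  have c: "ptime c" unfolding c_def by (intro ptime_intros)
  have s: "ptime s" unfolding s_def
    by (intro ptime_intros ptime_app[OF pt(1)] ptime_app[OF pt(2)] ptime_app[OF pt(3)]
        ptime_app[OF pt(4)] ptime_app3[OF pt(5)])
  define K where "K n = 3 * n + 2 * poly q n + 10" for n
  \<comment> \<open>An inner node costs one round to push its calls and one to combine. With
    \<open>m (l x) + m (r x) \<le> m x - 1\<close> the total
    \<open>3 * m (l x) + 3 * m (r x) + 4\<close> is at most \<open>3 * m x + 1\<close>. The space
    bound works because \<open>Ml\<close> and \<open>Mr\<close> leave room for one more
    \<open>K n\<close> within \<open>M\<close>.\<close>
  have eval: "\<exists>k \<le> 3 * m x + 1. iterates c s b k ((False, x) # ts, rs) (ts, f x # rs)"
    if "vsz x \<le> n" "vsz ts + vsz rs + (2 * m x + 1) * K n \<le> b" for x n b ts rs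
    using that
  proof (induction "m x" arbitrary: x b ts rs rule: less_induct)
    case less
    define M Ml Mr where "M = (2 * m x + 1) * K n" and "Ml = (2 * m (l x) + 1) * K n"
      and "Mr = (2 * m (r x) + 1) * K n"
    have b: "vsz ts + vsz rs + M \<le> b" using less.prems by (simp only: M_def)
    have Kn: "K n = 3 * n + 2 * poly q n + 10" by (fact K_def)
    have KM: "K n \<le> M" unfolding M_def by simp
    have fn: "vsz (f y) \<le> poly q n" if "vsz y \<le> n" for y
      using fq[of y] poly_nat_mono[OF that, of q] by simp
    show ?case
    proof (cases "leaf x")
      case True
      have "iterates c s b 1 ((False, x) # ts, rs) (ts, f x # rs)"
        using True b Kn KM less.prems(1) fn[OF less.prems(1)] f[of x] by (simp add: c_def s_def)
      moreover have "1 \<le> 3 * m x + 1" by simp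
      ultimately show ?thesis by blast
    next
      case False
      then have ml: "m (l x) < m x" and mr: "m (r x) < m x" using m[OF False] by auto
      have ln: "vsz (l x) \<le> n" and rn: "vsz (r x) \<le> n"
        using size[OF False] less.prems(1) by auto
      have "Ml + K n = (2 * m (l x) + 2) * K n" "Mr + K n = (2 * m (r x) + 2) * K n"
        unfolding Ml_def Mr_def by simp_all
      then have KMl: "Ml + K n \<le> M" and KMr: "Mr + K n \<le> M"
        unfolding M_def using ml mr by (simp_all only:, intro mult_le_mono1, simp, intro mult_le_mono1, simp)
      have "vsz ((False, r x) # (True, x) # ts) + vsz rs + Ml \<le> b"
        using b Kn KMl rn less.prems(1) by simp
      from less.hyps[OF ml ln this[unfolded Ml_def]] obtain k1 where k1: "k1 \<le> 3 * m (l x) + 1"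
        "iterates c s b k1 ((False, l x) # (False, r x) # (True, x) # ts, rs)
          ((False, r x) # (True, x) # ts, f (l x) # rs)" by blast
      have "vsz ((True, x) # ts) + vsz (f (l x) # rs) + Mr \<le> b"
        using b Kn KMr fn[OF ln] less.prems(1) by simp
      from less.hyps[OF mr rn this[unfolded Mr_def]] obtain k2 where k2: "k2 \<le> 3 * m (r x) + 1"
        "iterates c s b k2 ((False, r x) # (True, x) # ts, f (l x) # rs)
          ((True, x) # ts, f (r x) # f (l x) # rs)" by blast
      have 1: "iterates c s b 1 ((False, x) # ts, rs)
          ((False, l x) # (False, r x) # (True, x) # ts, rs)"
        using False b Kn KM ln rn less.prems(1) by (simp add: c_def s_def)
      have fx: "h x (f (l x)) (f (r x)) = f x" using f[of x] False by simp
      have 3: "iterates c s b 1 ((True, x) # ts, f (r x) # f (l x) # rs) (ts, f x # rs)"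
        using b Kn KM fn[OF ln] fn[OF rn] fn[OF less.prems(1)] less.prems(1)
        by (simp add: c_def s_def fx)
      have "iterates c s b (1 + (k1 + (k2 + 1))) ((False, x) # ts, rs) (ts, f x # rs)"
        by (rule iterates_trans[OF 1 iterates_trans[OF k1(2) iterates_trans[OF k2(2) 3]]])
      moreover have "1 + (k1 + (k2 + 1)) \<le> 3 * m x + 1"
        using k1(1) k2(1) m[OF False] by simp
      ultimately show ?thesis by blast
    qed
  qed
  define z where "z x = ([] :: (bool \<times> 'a) list, [f x])" for x
  have "ptime z"
  proof (rule ptime_while[OF c s])
    show "ptime (\<lambda>x. ([(False, x)], [] :: 'b list))" by (intro ptime_intros)
    fix x
    have "(2 * m x + 1) * K (vsz x) \<le> (2 * vsz x + 1) * K (vsz x)"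
      using mq[of x] by (intro mult_le_mono1) simp
    then have "vsz ([] :: (bool \<times> 'a) list) + vsz ([] :: 'b list) + (2 * m x + 1) * K (vsz x)
        \<le> poly ([:2:] + [:1, 2:] * ([:10, 3:] + smult 2 q)) (vsz x)"
      by (simp add: K_def algebra_simps)
    from eval[OF le_refl this] obtain k where "k \<le> 3 * m x + 1"
      "iterates c s (poly ([:2:] + [:1, 2:] * ([:10, 3:] + smult 2 q)) (vsz x)) k ([(False, x)], []) (z x)"
      unfolding z_def by blast
    moreover from this(1) have "k \<le> poly [:1, 3:] (vsz x)" using mq[of x] by simp
    moreover have "\<not> c (z x)" by (simp add: z_def c_def)
    ultimately show "\<exists>k\<le>poly [:1, 3:] (vsz x).
        iterates c s (poly ([:2:] + [:1, 2:] * ([:10, 3:] + smult 2 q)) (vsz x)) k ([(False, x)], []) (z x)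
        \<and> \<not> c (z x)" by blast
  qed
  then have "ptime (\<lambda>x. case snd (z x) of [] \<Rightarrow> g x | y # ys \<Rightarrow> y)"
    by (intro ptime_intros ptime_app[OF pt(2)])
  then show ?thesis by (simp add: z_def)
qed

text \<open>The recursion tree at \<open>x\<close> has at most \<open>2 * m x + 1\<close> nodes, and
  each adds at most a fixed polynomial to the sum of the sizes of its recursive results, so the
  value has polynomial size. Additivity is what excludes exponential growth by repeated doubling.
  The amount added is measured by the output of a polynomial-time function \<open>e\<close>, whose
  size is automatically polynomial.\<close>

lemma ptime_rec_add:
  fixes f :: "'a::encodable \<Rightarrow> 'b::encodable" and e :: "'a \<Rightarrow> 'c::encodable"
  assumes pt: "ptime leaf" "ptime g" "ptime l" "ptime r"
    "ptime (\<lambda>p. h (fst p) (fst (snd p)) (snd (snd p)))"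
    and f: "\<And>x. f x = (if leaf x then g x else h x (f (l x)) (f (r x)))"
    and m: "\<And>x. \<not> leaf x \<Longrightarrow> m (l x) + m (r x) < m x"
    and mq: "\<And>x. m x \<le> vsz x"
    and size: "\<And>x. \<not> leaf x \<Longrightarrow> vsz (l x) \<le> vsz x" "\<And>x. \<not> leaf x \<Longrightarrow> vsz (r x) \<le> vsz x"
    and e: "ptime e"
    and add: "\<And>x. \<not> leaf x \<Longrightarrow>
      vsz (h x (f (l x)) (f (r x))) \<le> vsz (f (l x)) + vsz (f (r x)) + vsz (e x)"
  shows "ptime f"
proof -
  from ptime_vsz[OF pt(2)] obtain p where p: "\<And>x. vsz (g x) \<le> poly p (vsz x)" by metis
  from ptime_vsz[OF e] obtain q where q: "\<And>x. vsz (e x) \<le> poly q (vsz x)" by metis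
  have "vsz (f x) \<le> (2 * m x + 1) * poly (p + q) n" if "vsz x \<le> n" for x n
    using that
  proof (induction "m x" arbitrary: x rule: less_induct)
    case less
    have pn: "poly p (vsz x) + poly q (vsz x) \<le> poly (p + q) n"
      using poly_nat_mono[OF less.prems, of "p + q"] by simp
    show ?case
    proof (cases "leaf x")
      case True
      then have "vsz (f x) \<le> poly (p + q) n" using f[of x] p[of x] pn by simp
      then show ?thesis by (rule order_trans) simp
    next
      case False
      let ?P = "poly (p + q) n"
      have "vsz (f (l x)) \<le> (2 * m (l x) + 1) * ?P" "vsz (f (r x)) \<le> (2 * m (r x) + 1) * ?P"
        using less.hyps m[OF False] size[OF False] less.prems by auto
      then have "vsz (f x) \<le> (2 * m (l x) + 1) * ?P + (2 * m (r x) + 1) * ?P + ?P"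
        using f[of x] add[OF False] False q[of x] pn by simp
      also have "\<dots> = (2 * (m (l x) + m (r x)) + 3) * ?P" by (simp add: algebra_simps)
      also have "\<dots> \<le> (2 * m x + 1) * ?P" using m[OF False] by (intro mult_le_mono1) simp
      finally show ?thesis .
    qed
  qed
  then have "vsz (f x) \<le> (2 * m x + 1) * poly (p + q) (vsz x)" for x by blast
  moreover have "(2 * m x + 1) * poly (p + q) (vsz x) \<le> poly ([:1, 2:] * (p + q)) (vsz x)" for x
    using mult_le_mono1[of "2 * m x + 1" "2 * vsz x + 1" "poly (p + q) (vsz x)"] mq[of x]
    by (simp add: algebra_simps)
  ultimately have "vsz (f x) \<le> poly ([:1, 2:] * (p + q)) (vsz x)" for x
    using le_trans by blast
  from ptime_rec[OF pt f m mq size this] show ?thesis .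
qed

text \<open>Linear recursion is fitted to the binary scheme by a second call flagged
  \<open>True\<close>, which is a leaf. The bound on \<open>u\<close> makes the list element that is
  dropped pay for the growth of the parameter. Putting a fixed \<open>c\<close> for the recursive
  value isolates what \<open>h\<close> itself adds, and yields the function \<open>e\<close> of the
  previous lemma.\<close>

lemma ptime_rec_list:
  fixes f :: "'e::encodable \<Rightarrow> 'x::encodable list \<Rightarrow> 'b::encodable"
  assumes "\<And>v. f v [] = g v" "\<And>v x xs. f v (x # xs) = h v x xs (f (u v x) xs)"
    and pt: "ptime g" "ptime (\<lambda>p. h (fst p) (fst (snd p)) (fst (snd (snd p))) (snd (snd (snd p))))"
    "ptime (\<lambda>p. u (fst p) (snd p))"
    and u: "\<And>v x. vsz (u v x) \<le> vsz v + vsz x + 1"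
    and add: "\<And>v x xs. vsz (h v x xs (f (u v x) xs)) \<le> vsz (f (u v x) xs) + vsz (h v x xs c)"
  shows "ptime (\<lambda>p. f (fst p) (snd p))"
proof -
  define F :: "bool \<times> 'e \<times> 'x list \<Rightarrow> 'b" where
    "F = (\<lambda>y. if fst y then g (fst (snd y)) else f (fst (snd y)) (snd (snd y)))"
  define leaf :: "bool \<times> 'e \<times> 'x list \<Rightarrow> bool" where "leaf = (\<lambda>y. fst y \<or> snd (snd y) = [])"
  define l :: "bool \<times> 'e \<times> 'x list \<Rightarrow> bool \<times> 'e \<times> 'x list" where
    "l = (\<lambda>y. case snd (snd y) of [] \<Rightarrow> y | x # xs \<Rightarrow> (False, u (fst (snd y)) x, xs))"
  define r :: "bool \<times> 'e \<times> 'x list \<Rightarrow> bool \<times> 'e \<times> 'x list" where "r = (\<lambda>y. (True, snd y))"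
  define H where "H = (\<lambda>(y :: bool \<times> 'e \<times> 'x list) (a :: 'b) (b :: 'b). case snd (snd y) of [] \<Rightarrow> a
      | x # xs \<Rightarrow> h (fst (snd y)) x xs a)"
  define E where "E = (\<lambda>y :: bool \<times> 'e \<times> 'x list. case snd (snd y) of [] \<Rightarrow> []
      | x # xs \<Rightarrow> [h (fst (snd y)) x xs c])"
  define m :: "bool \<times> 'e \<times> 'x list \<Rightarrow> nat" where
    "m y = (if fst y then 0 else length (snd (snd y)))" for y
  have "ptime F"
  proof (rule ptime_rec_add[where leaf = leaf and l = l and r = r and h = H and m = m and e = E
        and g = "\<lambda>y. g (fst (snd y))"])
    show "ptime leaf" unfolding leaf_def by (intro ptime_intros)
    show "ptime (\<lambda>y :: bool \<times> 'e \<times> 'x list. g (fst (snd y)))"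
      by (intro ptime_app[OF pt(1)] ptime_intros)
    show "ptime l" unfolding l_def by (intro ptime_intros ptime_app2[OF pt(3)])
    show "ptime r" unfolding r_def by (intro ptime_intros)
    show "ptime (\<lambda>p. H (fst p) (fst (snd p)) (snd (snd p)))" unfolding H_def
      by (intro ptime_intros ptime_app4[OF pt(2)])
    show "ptime E" unfolding E_def by (intro ptime_intros ptime_app4[OF pt(2)])
    show "F y = (if leaf y then g (fst (snd y)) else H y (F (l y)) (F (r y)))" for y
      by (auto simp: F_def leaf_def H_def l_def assms(1,2) split: list.splits)
    show "m (l y) + m (r y) < m y" if "\<not> leaf y" for y
      using that by (auto simp: m_def leaf_def l_def r_def split: list.splits)
    show "vsz (l y) \<le> vsz y" if "\<not> leaf y" for y
      using that u[of "fst (snd y)" "hd (snd (snd y))"]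
      by (cases y; cases "snd (snd y)") (auto simp: leaf_def l_def)
    show "vsz (r y) \<le> vsz y" for y by (cases y) (auto simp: r_def)
    show "vsz (H y (F (l y)) (F (r y))) \<le> vsz (F (l y)) + vsz (F (r y)) + vsz (E y)"
      if "\<not> leaf y" for y
      using that add[of "fst (snd y)" "hd (snd (snd y))" "tl (snd (snd y))"]
      by (cases "snd (snd y)") (auto simp: leaf_def l_def H_def E_def F_def)
    have "length xs \<le> vsz xs" for xs :: "'x list" by (induction xs) auto
    then show "m y \<le> vsz y" for y by (cases y) (auto simp: m_def intro!: le_SucI trans_le_add2)
  qed
  from ptime_app[OF this, of "\<lambda>p. (False, fst p, snd p)"]
  show ?thesis by (simp add: F_def ptime_intros)
qed

lemma ptime_rec_bform:
  fixes f :: "'e::encodable \<Rightarrow> bform \<Rightarrow> 'b::encodable"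
  assumes f: "\<And>v p. f v (BLit p) = g v p"
      "\<And>v A B. f v (BAnd A B) = h v A B (f v A) (f v B)"
      "\<And>v A B. f v (BOr A B) = k v A B (f v A) (f v B)"
    and pt: "ptime (\<lambda>p. g (fst p) (snd p))" 
      "ptime (\<lambda>p. h (fst p) (fst (snd p)) (fst (snd (snd p))) (fst (snd (snd (snd p)))) (snd (snd (snd (snd p)))))"
      "ptime (\<lambda>p. k (fst p) (fst (snd p)) (fst (snd (snd p))) (fst (snd (snd (snd p)))) (snd (snd (snd (snd p)))))"
    and add: "\<And>v A B. vsz (h v A B (f v A) (f v B)) \<le> vsz (f v A) + vsz (f v B) + vsz (h v A B c c)"
      "\<And>v A B. vsz (k v A B (f v A) (f v B)) \<le> vsz (f v A) + vsz (f v B) + vsz (k v A B c c)"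
  shows "ptime (\<lambda>p. f (fst p) (snd p))"
proof -
  define leaf :: "'e \<times> bform \<Rightarrow> bool" where
    "leaf = (\<lambda>y. case snd y of BLit p \<Rightarrow> True | BAnd A B \<Rightarrow> False | BOr A B \<Rightarrow> False)"
  define l :: "'e \<times> bform \<Rightarrow> 'e \<times> bform" where
    "l = (\<lambda>y. (fst y, case snd y of BLit p \<Rightarrow> snd y | BAnd A B \<Rightarrow> A | BOr A B \<Rightarrow> A))"
  define r :: "'e \<times> bform \<Rightarrow> 'e \<times> bform" where
    "r = (\<lambda>y. (fst y, case snd y of BLit p \<Rightarrow> snd y | BAnd A B \<Rightarrow> B | BOr A B \<Rightarrow> B))"
  \<comment> \<open>\<open>Pos 0\<close> is a filler literal for formulas that are not
    leaves.\<close>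
  define G where "G = (\<lambda>y. case snd y of BLit p \<Rightarrow> g (fst y) p
      | BAnd A B \<Rightarrow> g (fst y) (Pos 0) | BOr A B \<Rightarrow> g (fst y) (Pos 0))"
  define H where "H = (\<lambda>y a b. case snd y of BLit p \<Rightarrow> a
      | BAnd A B \<Rightarrow> h (fst y) A B a b | BOr A B \<Rightarrow> k (fst y) A B a b)"
  define e where "e = (\<lambda>y. case snd y of BLit p \<Rightarrow> c
      | BAnd A B \<Rightarrow> h (fst y) A B c c | BOr A B \<Rightarrow> k (fst y) A B c c)"
  show ?thesis
  proof (rule ptime_rec_add[where m = "\<lambda>y. vsz (snd y)" and leaf = leaf and l = l and r = r
        and g = G and h = H and e = e])
    show "ptime leaf" unfolding leaf_def by (intro ptime_intros)
    show "ptime l" unfolding l_def by (intro ptime_intros)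
    show "ptime r" unfolding r_def by (intro ptime_intros)
    show "ptime G" unfolding G_def by (intro ptime_intros ptime_app2[OF pt(1)])
    show "ptime (\<lambda>p. H (fst p) (fst (snd p)) (snd (snd p)))" unfolding H_def
      by (intro ptime_intros ptime_app5[OF pt(2)] ptime_app5[OF pt(3)])
    show "ptime e" unfolding e_def
      by (intro ptime_intros ptime_app5[OF pt(2)] ptime_app5[OF pt(3)])
    show "f (fst y) (snd y) = (if leaf y then G y else
        H y (f (fst (l y)) (snd (l y))) (f (fst (r y)) (snd (r y))))" for y
      by (cases "snd y") (simp_all add: leaf_def l_def r_def G_def H_def f)
    show "vsz (snd (l y)) + vsz (snd (r y)) < vsz (snd y)" "vsz (l y) \<le> vsz y" "vsz (r y) \<le> vsz y"
      if "\<not> leaf y" for y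
      using that by (cases y; cases "snd y"; simp add: leaf_def l_def r_def)+
    show "vsz (snd y) \<le> vsz y" for y :: "'e \<times> bform" by (cases y) simp
    show "vsz (H y (f (fst (l y)) (snd (l y))) (f (fst (r y)) (snd (r y))))
        \<le> vsz (f (fst (l y)) (snd (l y))) + vsz (f (fst (r y)) (snd (r y))) + vsz (e y)"
      if "\<not> leaf y" for y
      using that add by (cases y; cases "snd y") (simp_all add: leaf_def l_def r_def H_def e_def)
  qed
qed

text \<open>Unlike for \<open>bform\<close>, the growth \<open>e\<close> is given separately:
  \<open>h\<close> may rework its recursive values throughout, as \<open>to_dnf\<close> does with
  \<open>pre\<close>, and then its size at fixed values does not measure the growth.\<close>

lemma ptime_rec_ndt:
  fixes f :: "'e::encodable \<Rightarrow> ndt \<Rightarrow> 'b::encodable"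
    and e :: "'e \<times> ndt \<Rightarrow> 'c::encodable"
  assumes f: "\<And>v p. f v (NLit p) = g v p"
      "\<And>v A p B. f v (NDec A p B) = h v A p B (f v A) (f v B)"
      "\<And>v A B. f v (NOr A B) = k v A B (f v A) (f v B)"
    and pt: "ptime (\<lambda>p. g (fst p) (snd p))" 
      "ptime (\<lambda>p. h (fst p) (fst (snd p)) (fst (snd (snd p))) (fst (snd (snd (snd p))))
        (fst (snd (snd (snd (snd p))))) (snd (snd (snd (snd (snd p))))))"
      "ptime (\<lambda>p. k (fst p) (fst (snd p)) (fst (snd (snd p))) (fst (snd (snd (snd p)))) (snd (snd (snd (snd p)))))"
      "ptime e"
    and add: "\<And>v A p B. vsz (h v A p B (f v A) (f v B)) \<le> vsz (f v A) + vsz (f v B) + vsz (e (v, NDec A p B))"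
      "\<And>v A B. vsz (k v A B (f v A) (f v B)) \<le> vsz (f v A) + vsz (f v B) + vsz (e (v, NOr A B))"
  shows "ptime (\<lambda>p. f (fst p) (snd p))"
proof -
  define leaf :: "'e \<times> ndt \<Rightarrow> bool" where
    "leaf = (\<lambda>y. case snd y of NLit p \<Rightarrow> True | NDec A p B \<Rightarrow> False | NOr A B \<Rightarrow> False)"
  define l :: "'e \<times> ndt \<Rightarrow> 'e \<times> ndt" where
    "l = (\<lambda>y. (fst y, case snd y of NLit p \<Rightarrow> snd y | NDec A p B \<Rightarrow> A | NOr A B \<Rightarrow> A))"
  define r :: "'e \<times> ndt \<Rightarrow> 'e \<times> ndt" where
    "r = (\<lambda>y. (fst y, case snd y of NLit p \<Rightarrow> snd y | NDec A p B \<Rightarrow> B | NOr A B \<Rightarrow> B))"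
  define G where "G = (\<lambda>y. case snd y of NLit p \<Rightarrow> g (fst y) p
      | NDec A p B \<Rightarrow> g (fst y) (Pos 0) | NOr A B \<Rightarrow> g (fst y) (Pos 0))"
  define H where "H = (\<lambda>y a b. case snd y of NLit p \<Rightarrow> a
      | NDec A p B \<Rightarrow> h (fst y) A p B a b | NOr A B \<Rightarrow> k (fst y) A B a b)"
  show ?thesis
  proof (rule ptime_rec_add[where m = "\<lambda>y. vsz (snd y)" and leaf = leaf and l = l and r = r
        and g = G and h = H and e = e])
    show "ptime leaf" unfolding leaf_def by (intro ptime_intros)
    show "ptime l" unfolding l_def by (intro ptime_intros)
    show "ptime r" unfolding r_def by (intro ptime_intros)
    show "ptime G" unfolding G_def by (intro ptime_intros ptime_app2[OF pt(1)])
    show "ptime (\<lambda>p. H (fst p) (fst (snd p)) (snd (snd p)))" unfolding H_def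
      by (intro ptime_intros ptime_app6[OF pt(2)] ptime_app5[OF pt(3)])
    show "ptime e" by (fact pt(4))
    show "f (fst y) (snd y) = (if leaf y then G y else
        H y (f (fst (l y)) (snd (l y))) (f (fst (r y)) (snd (r y))))" for y
      by (cases "snd y") (simp_all add: leaf_def l_def r_def G_def H_def f)
    show "vsz (snd (l y)) + vsz (snd (r y)) < vsz (snd y)" "vsz (l y) \<le> vsz y" "vsz (r y) \<le> vsz y"
      if "\<not> leaf y" for y
      using that by (cases y; cases "snd y"; simp add: leaf_def l_def r_def)+
    show "vsz (snd y) \<le> vsz y" for y :: "'e \<times> ndt" by (cases y) simp
    show "vsz (H y (f (fst (l y)) (snd (l y))) (f (fst (r y)) (snd (r y))))
        \<le> vsz (f (fst (l y)) (snd (l y))) + vsz (f (fst (r y)) (snd (r y))) + vsz (e y)"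
      if "\<not> leaf y" for y
      using that add by (cases y; cases "snd y") (simp_all add: leaf_def l_def r_def H_def)
  qed
qed


subsection \<open>Lists\<close>

lemma ptime_append [ptime_intros]:
  assumes "ptime f" "ptime g"
  shows "ptime (\<lambda>x. f x @ g x)"
proof -
  have "ptime (\<lambda>p :: 'b list \<times> 'b list. snd p @ fst p)"
    by (rule ptime_rec_list[where g = "\<lambda>v. v" and h = "\<lambda>v x xs r. x # r" and u = "\<lambda>v x. v"
          and c = "[]"]) (auto intro!: ptime_intros)
  from ptime_app[OF this ptime_pair[OF assms(2,1)]] show ?thesis by simp
qed

lemma ptime_map [ptime_intros]:
  assumes "ptime (\<lambda>p. g (fst p) (snd p))" "ptime f"
  shows "ptime (\<lambda>x. map (g x) (f x))"
proof -
  have "ptime (\<lambda>p. map (g (fst p)) (snd p))"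
    by (rule ptime_rec_list[where g = "\<lambda>v. []" and h = "\<lambda>v x xs r. g v x # r" and u = "\<lambda>v x. v"
          and c = "[]"]) (auto intro!: ptime_intros ptime_app2[OF assms(1)])
  from ptime_app[OF this ptime_pair[OF ptime_id assms(2)]] show ?thesis by simp
qed

lemma ptime_filter [ptime_intros]:
  assumes "ptime (\<lambda>p. g (fst p) (snd p))" "ptime f"
  shows "ptime (\<lambda>x. filter (g x) (f x))"
proof -
  have "ptime (\<lambda>p. filter (g (fst p)) (snd p))"
    by (rule ptime_rec_list[where g = "\<lambda>v. []" and h = "\<lambda>v x xs r. if g v x then x # r else r"
          and u = "\<lambda>v x. v" and c = "[]"])
      (auto intro!: ptime_intros ptime_app2[OF assms(1)])
  from ptime_app[OF this ptime_pair[OF ptime_id assms(2)]] show ?thesis by simp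
qed

lemma ptime_member [ptime_intros]:
  assumes "ptime f" "ptime g"
  shows "ptime (\<lambda>x. f x \<in> set (g x))"
proof -
  have "ptime (\<lambda>p. fst p \<in> set (snd p))"
    by (rule ptime_rec_list[where g = "\<lambda>v. False" and h = "\<lambda>v x xs r. v = x \<or> r" and u = "\<lambda>v x. v"
          and c = "True"]) (auto intro!: ptime_intros)
  from ptime_app[OF this ptime_pair[OF assms]] show ?thesis by simp
qed

lemma ptime_remove1 [ptime_intros]:
  assumes "ptime f" "ptime g"
  shows "ptime (\<lambda>x. remove1 (f x) (g x))"
proof -
  have "ptime (\<lambda>p. remove1 (fst p) (snd p))"
    by (rule ptime_rec_list[where g = "\<lambda>v. []" and h = "\<lambda>v x xs r. if v = x then xs else x # r"
          and u = "\<lambda>v x. v" and c = "[]"]) (auto intro!: ptime_intros)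
  from ptime_app[OF this ptime_pair[OF assms]] show ?thesis by simp
qed

lemma ptime_concat [ptime_intros]:
  assumes "ptime f"
  shows "ptime (\<lambda>x. concat (f x))"
proof -
  have "vsz (x @ xs) \<le> vsz xs + vsz x" for x xs :: "'b list"
    by simp
  then have "ptime (\<lambda>p :: bool \<times> 'b list list. concat (snd p))"
    by (intro ptime_rec_list[where g = "\<lambda>v. []" and h = "\<lambda>v x xs r. x @ r" and u = "\<lambda>v x. v"
          and c = "[]"]) (auto intro!: ptime_intros)
  from ptime_app[OF this ptime_pair[OF ptime_const assms], of True] show ?thesis by simp
qed

section \<open>Transformations of proofs\<close>

text \<open>A tree-like proof is a process that starts from no sequents and in which every line consumes
  its premises and produces its conclusion. Since only the available sequents matter, the parts of a
  proof can be transformed independently of where their premises stand.\<close>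

primrec consumes ::
  "(rule \<Rightarrow> 'f \<Rightarrow> 'f sequent list \<Rightarrow> 'f sequent \<Rightarrow> bool) \<Rightarrow> 'f line list \<Rightarrow>
   'f sequent multiset \<Rightarrow> 'f sequent multiset \<Rightarrow> bool"
where
  "consumes I [] M M' \<longleftrightarrow> M = M'"
| "consumes I (l # L) M M' \<longleftrightarrow> (\<exists>Ss N. M = mset Ss + N \<and>
     I (fst l) (fst (snd l)) Ss (seq_of l) \<and> consumes I L (add_mset (seq_of l) N) M')"

primrec uses ::
  "(rule \<Rightarrow> 'f \<Rightarrow> 'f sequent list \<Rightarrow> 'f sequent \<Rightarrow> bool) \<Rightarrow> 'f line list \<Rightarrow> 'f sequent set \<Rightarrow> bool"
where
  "uses I [] K \<longleftrightarrow> True"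
| "uses I (l # L) K \<longleftrightarrow> (\<exists>Ss. set Ss \<subseteq> K \<and>
     I (fst l) (fst (snd l)) Ss (seq_of l) \<and> uses I L (insert (seq_of l) K))"

lemma consumes_append:
  "consumes I (L1 @ L2) M M' \<longleftrightarrow> (\<exists>M1. consumes I L1 M M1 \<and> consumes I L2 M1 M')"
  by (induction L1 arbitrary: M) (simp, simp, blast)

text \<open>A frame rule: sequents that a block does not touch wait beside it. This is what allows a
  block to be inserted amid other pending sequents.\<close>

lemma consumes_frame: "consumes I L M M' \<Longrightarrow> consumes I L (M + N) (M' + N)"
proof (induction L arbitrary: M)
  case (Cons l L)
  then obtain Ss K where *: "M = mset Ss + K" "I (fst l) (fst (snd l)) Ss (seq_of l)"
    "consumes I L (add_mset (seq_of l) K) M'" by auto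
  from Cons.IH[OF *(3)] *(1,2) show ?case
    by (auto intro!: exI[of _ Ss] exI[of _ "K + N"])
qed simp

lemma consumes_last: "consumes I L M {#S#} \<Longrightarrow> L \<noteq> [] \<Longrightarrow> seq_of (last L) = S"
proof (induction L arbitrary: M)
  case (Cons l L)
  from Cons.prems(1) obtain N where "consumes I L (add_mset (seq_of l) N) {#S#}" by auto
  with Cons.IH show ?case by (cases "L = []") auto
qed simp

lemma uses_append: "uses I (L1 @ L2) K \<longleftrightarrow> uses I L1 K \<and> uses I L2 (K \<union> seq_of ` set L1)"
  by (induction L1 arbitrary: K) auto

text \<open>Forgetting multiplicities turns a tree-like block into a dag-like one, so the blocks
  need to be constructed for the tree-like case only.\<close>

lemma consumes_uses:
  "consumes I L M M' \<Longrightarrow> set_mset M \<subseteq> K \<Longrightarrow> uses I L K \<and> set_mset M' \<subseteq> K \<union> seq_of ` set L"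
proof (induction L arbitrary: M K)
  case (Cons l L)
  then obtain Ss N where *: "M = mset Ss + N" "I (fst l) (fst (snd l)) Ss (seq_of l)"
    "consumes I L (add_mset (seq_of l) N) M'" by auto
  with Cons.IH[OF *(3), of "insert (seq_of l) K"] Cons.prems(2) show ?case
    by auto
qed simp

lemma uses_iff:
  "uses I L K \<longleftrightarrow> (\<forall>i < length L. \<exists>Ss. set Ss \<subseteq> K \<union> seq_of ` set (take i L) \<and>
     I (fst (L ! i)) (fst (snd (L ! i))) Ss (seq_of (L ! i)))"
proof (induction L arbitrary: K)
  case (Cons l L)
  show ?case by (simp add: Cons.IH All_less_Suc2) blast
qed simp

text \<open>Earlier sequents are the images of earlier positions, so a list of premises lifts to a
  list of indices; choosing one such list for every line gives \<open>prem\<close>.\<close>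

lemma proof_of_Dag_iff:
  "proof_of I Dag_like \<pi> S \<longleftrightarrow> uses I \<pi> {} \<and> \<pi> \<noteq> [] \<and> seq_of (last \<pi>) = S"
proof -
  have img: "seq_of ` set (take i \<pi>) = (\<lambda>j. seq_of (\<pi> ! j)) ` {..<i}" if "i < length \<pi>" for i
  proof -
    have "set (take i \<pi>) = (!) \<pi> ` {..<i}"
      using nth_image[of i \<pi>] that by (simp add: lessThan_atLeast0)
    then show ?thesis by (simp add: image_image)
  qed
  have lists: "(\<exists>Ss. set Ss \<subseteq> f ` A \<and> P Ss) \<longleftrightarrow> (\<exists>js. set js \<subseteq> A \<and> P (map f js))"
    for f :: "nat \<Rightarrow> 'a sequent" and A P
  proof
    assume "\<exists>Ss. set Ss \<subseteq> f ` A \<and> P Ss"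
    then obtain Ss where "Ss \<in> lists (f ` A)" "P Ss" by auto
    then show "\<exists>js. set js \<subseteq> A \<and> P (map f js)" unfolding lists_image by auto
  next
    assume "\<exists>js. set js \<subseteq> A \<and> P (map f js)"
    then obtain js where "set js \<subseteq> A" "P (map f js)" by blast
    then show "\<exists>Ss. set Ss \<subseteq> f ` A \<and> P Ss" by (intro exI[of _ "map f js"]) auto
  qed
  have "uses I \<pi> {} \<longleftrightarrow> (\<forall>i. \<exists>js. i < length \<pi> \<longrightarrow> (\<forall>j\<in>set js. j < i) \<and>
      I (fst (\<pi> ! i)) (fst (snd (\<pi> ! i))) (map (\<lambda>j. seq_of (\<pi> ! j)) js) (seq_of (\<pi> ! i)))"
  proof -
    have "(\<exists>Ss. set Ss \<subseteq> {} \<union> seq_of ` set (take i \<pi>) \<and> P Ss) \<longleftrightarrow>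
        (\<exists>js. (\<forall>j\<in>set js. j < i) \<and> P (map (\<lambda>j. seq_of (\<pi> ! j)) js))" if "i < length \<pi>" for i P
      unfolding img[OF that] Un_empty_left lists by (simp add: subset_eq)
    then show ?thesis unfolding uses_iff by auto
  qed
  also have "\<dots> \<longleftrightarrow> (\<exists>prem. justifies I prem \<pi>)"
    unfolding choice_iff justifies_def by blast
  finally show ?thesis unfolding proof_of_def by auto
qed

text \<open>After \<open>k\<close> lines the pending sequents are those at positions below
  \<open>k\<close> that no earlier line has used; \<open>U k\<close> collects the positions used.
  After the last line only the root is left.\<close>

lemma proof_of_Tree_consumes:
  assumes "proof_of I Tree_like \<pi> S"
  shows "consumes I \<pi> {#} {#S#}"
proof -
  let ?n = "length \<pi>" and ?f = "\<lambda>j. seq_of (\<pi> ! j)"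
  from assms obtain prem where ne: "\<pi> \<noteq> []" and S: "seq_of (last \<pi>) = S"
    and j: "justifies I prem \<pi>"
    and once: "mset (concat (map prem [0..<?n])) = mset [0..<?n - 1]"
    unfolding proof_of_def by auto
  define U where "U k = mset (concat (map prem [0..<k]))" for k
  have U_Suc: "U (Suc k) = U k + mset (prem k)" for k by (simp add: U_def)
  have U_mono: "U k \<subseteq># U n" if "k \<le> n" for k n
    using that by (induction rule: dec_induct) (auto simp: U_Suc intro: subset_mset.order_trans)
  \<comment> \<open>\<open>once\<close> bounds the multiplicity of each position by 1, and
    \<open>justifies\<close> puts the premises of lines \<open>0\<close> to \<open>k\<close> below
    \<open>k\<close>. Hence the multiset subtraction in the invariant is exact.\<close>
  have U_sub: "U (Suc k) \<subseteq># mset [0..<k]" if "k < ?n" for k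
  proof (rule mset_subset_eqI)
    fix i
    have "U (Suc k) \<subseteq># mset [0..<?n - 1]"
      using U_mono[of "Suc k" ?n] that once by (simp add: U_def)
    then have "count (U (Suc k)) i \<le> count (mset [0..<?n - 1]) i" by (rule mset_subset_eq_count)
    also have "\<dots> \<le> 1" by (simp add: count_mset_set')
    finally have 1: "count (U (Suc k)) i \<le> 1" .
    have "i < k" if "i \<in># U (Suc k)"
    proof -
      from that obtain a where "a < Suc k" "i \<in> set (prem a)" by (auto simp: U_def simp del: upt_Suc)
      moreover from this have "a < ?n" using \<open>k < ?n\<close> by simp
      ultimately have "i < a" using j unfolding justifies_def by blast
      with \<open>a < Suc k\<close> show ?thesis by simp
    qed
    then have "count (U (Suc k)) i = 0 \<or> i < k" by (cases "i \<in># U (Suc k)") (simp_all add: not_in_iff)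
    with 1 show "count (U (Suc k)) i \<le> count (mset [0..<k]) i" by (auto simp: count_mset_set')
  qed
  have "consumes I (take k \<pi>) {#} (image_mset ?f (mset [0..<k] - U k))" if "k \<le> ?n" for k
    using that
  proof (induction k)
    case (Suc k)
    let ?N = "mset [0..<k] - U (Suc k)"
    have k: "k < ?n" using Suc.prems by simp
    have eq: "mset [0..<k] - U k = mset (prem k) + ?N"
      using U_sub[OF k] by (auto simp: U_Suc multiset_eq_iff subseteq_mset_def)
    have eq': "mset [0..<Suc k] - U (Suc k) = add_mset k ?N"
      using U_sub[OF k] mset_subset_eq_count[OF U_sub[OF k], of k]
      by (auto simp: multiset_eq_iff subseteq_mset_def Suc_diff_le)
    have "I (fst (\<pi> ! k)) (fst (snd (\<pi> ! k))) (map ?f (prem k)) (?f k)"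
      using j k unfolding justifies_def by auto
    then have "consumes I [\<pi> ! k] (image_mset ?f (mset [0..<k] - U k))
        (image_mset ?f (mset [0..<Suc k] - U (Suc k)))"
      unfolding eq eq' by (auto intro!: exI[of _ "map ?f (prem k)"])
    with Suc k show ?case
      by (auto simp: take_Suc_conv_app_nth consumes_append simp del: upt_Suc)
  qed (simp add: U_def)
  from this[of ?n] have "consumes I \<pi> {#} (image_mset ?f (mset [0..<?n] - mset [0..<?n - 1]))"
    using once by (simp add: U_def)
  moreover have "mset [0..<?n] - mset [0..<?n - 1] = {#?n - 1#}"
    using ne by (cases ?n) auto
  moreover have "?f (?n - 1) = S" using S ne by (simp add: last_conv_nth)
  ultimately show ?thesis by simp
qed

lemma image_mset_eq_mset:
  "image_mset f J = mset xs \<Longrightarrow> \<exists>js. mset js = J \<and> map f js = xs"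
proof (induction xs arbitrary: J)
  case (Cons x xs)
  then have "x \<in># image_mset f J" by simp
  then obtain j where j: "j \<in># J" "x = f j" by auto
  then obtain J' where J: "J = add_mset j J'" by (metis mset_add)
  with Cons j obtain js where "mset js = J'" "map f js = xs" by auto
  with J j show ?case by (intro exI[of _ "j # js"]) simp
qed simp

text \<open>\<open>J\<close> and \<open>J'\<close> are the positions of the sequents pending before
  and after \<open>L\<close>. The last equation is a conservation law: every position pending at the
  start or produced by \<open>L\<close> is either used once as a premise or still pending at the
  end.\<close>

lemma consumes_prems:
  assumes "consumes I L M M'" "\<pi> = \<pi>0 @ L"
    "image_mset (\<lambda>j. seq_of (\<pi> ! j)) J = M" "\<forall>j\<in>#J. j < length \<pi>0"
  shows "\<exists>prem J'. (\<forall>i. length \<pi>0 \<le> i \<and> i < length \<pi> \<longrightarrow> (\<forall>j\<in>set (prem i). j < i) \<and>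
      I (fst (\<pi> ! i)) (fst (snd (\<pi> ! i))) (map (\<lambda>j. seq_of (\<pi> ! j)) (prem i)) (seq_of (\<pi> ! i))) \<and>
    image_mset (\<lambda>j. seq_of (\<pi> ! j)) J' = M' \<and>
    mset (concat (map prem [length \<pi>0..<length \<pi>])) + J' = J + mset [length \<pi>0..<length \<pi>]"
  using assms
proof (induction L arbitrary: M \<pi>0 J)
  case Nil
  then show ?case by auto
next
  case (Cons l L)
  let ?f = "\<lambda>j. seq_of (\<pi> ! j)" and ?k = "length \<pi>0"
  from Cons.prems obtain Ss N where *: "M = mset Ss + N" "I (fst l) (fst (snd l)) Ss (seq_of l)"
    "consumes I L (add_mset (seq_of l) N) M'" by auto
  from image_mset_eq_plusD[OF trans[OF Cons.prems(3) *(1)]]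
  obtain J1 J2 where J: "J = J1 + J2" "image_mset ?f J1 = mset Ss" "image_mset ?f J2 = N" by auto
  from image_mset_eq_mset[OF J(2)] obtain js where js: "mset js = J1" "map ?f js = Ss" by blast
  have nth: "\<pi> ! ?k = l" using Cons.prems(2) by simp
  have "\<pi> = (\<pi>0 @ [l]) @ L" "image_mset ?f (add_mset ?k J2) = add_mset (seq_of l) N"
    "\<forall>j\<in>#add_mset ?k J2. j < length (\<pi>0 @ [l])"
    using Cons.prems(2,4) J(1,3) nth by (simp_all add: less_Suc_eq)
  from Cons.IH[OF *(3) this] obtain prem J' where P:
    "\<forall>i. Suc ?k \<le> i \<and> i < length \<pi> \<longrightarrow> (\<forall>j\<in>set (prem i). j < i) \<and>
      I (fst (\<pi> ! i)) (fst (snd (\<pi> ! i))) (map ?f (prem i)) (?f i)"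
    "image_mset ?f J' = M'"
    "mset (concat (map prem [Suc ?k..<length \<pi>])) + J' = add_mset ?k J2 + mset [Suc ?k..<length \<pi>]"
    by auto
  have k: "?k < length \<pi>" using Cons.prems(2) by simp
  have upt: "[?k..<length \<pi>] = ?k # [Suc ?k..<length \<pi>]" using k by (simp add: upt_conv_Cons)
  have "map (prem(?k := js)) [Suc ?k..<length \<pi>] = map prem [Suc ?k..<length \<pi>]" by auto
  then have "mset (concat (map (prem(?k := js)) [?k..<length \<pi>])) + J' = J + mset [?k..<length \<pi>]"
    unfolding upt using P(3) js(1) J(1) by simp
  moreover have "\<forall>j\<in>set js. j < ?k"
    using js(1) J(1) Cons.prems(4) by (metis set_mset_mset union_iff)
  then have "\<forall>i. ?k \<le> i \<and> i < length \<pi> \<longrightarrow> (\<forall>j\<in>set ((prem(?k := js)) i). j < i) \<and>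
      I (fst (\<pi> ! i)) (fst (snd (\<pi> ! i))) (map ?f ((prem(?k := js)) i)) (?f i)"
    using P(1) *(2) js(2) nth by auto
  ultimately show ?case using P(2) by blast
qed

lemma proof_of_Tree_iff: "proof_of I Tree_like \<pi> S \<longleftrightarrow> consumes I \<pi> {#} {#S#}"
proof
  assume c: "consumes I \<pi> {#} {#S#}"
  let ?f = "\<lambda>j. seq_of (\<pi> ! j)" and ?n = "length \<pi>"
  from c have ne: "\<pi> \<noteq> []" by auto
  from consumes_prems[OF c, of \<pi> "[]" "{#}"] obtain prem J' where P:
    "\<forall>i < ?n. (\<forall>j\<in>set (prem i). j < i) \<and>
      I (fst (\<pi> ! i)) (fst (snd (\<pi> ! i))) (map ?f (prem i)) (?f i)"
    "image_mset ?f J' = {#S#}" "mset (concat (map prem [0..<?n])) + J' = mset [0..<?n]"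
    by auto
  from P(2) obtain j where J': "J' = {#j#}" by (metis msed_map_invR image_mset_is_empty_iff)
  \<comment> \<open>Premises precede their conclusion, so no line can use the last position; hence
    it is the one that survives.\<close>
  have "?n - 1 \<notin># mset (concat (map prem [0..<?n]))" using P(1) by fastforce
  moreover have "?n - 1 \<in># mset [0..<?n]" using ne by simp
  ultimately have "j = ?n - 1" using P(3) J' by (metis add_mset_add_single insert_iff set_mset_add_mset_insert)
  moreover have "mset [0..<?n] = add_mset (?n - 1) (mset [0..<?n - 1])"
    using ne by (cases ?n) auto
  ultimately have "mset (concat (map prem [0..<?n])) = mset [0..<?n - 1]"
    using P(3) J' by simp
  moreover have "seq_of (last \<pi>) = S" using consumes_last[OF c ne] .
  ultimately show "proof_of I Tree_like \<pi> S"
    using P(1) ne unfolding proof_of_def justifies_def by auto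
qed (rule proof_of_Tree_consumes)

text \<open>Both translations are instances of this theorem. Nonempty blocks ensure that the proof
  ends in the right line even if \<open>fin\<close> is empty, as happens for an end sequent with
  empty antecedent in the direction to LNDT.\<close>

theorem proof_of_transform:
  assumes \<pi>: "proof_of I sh \<pi> S"
    and sim: "\<And>l Ss. I (fst l) (fst (snd l)) Ss (seq_of l) \<Longrightarrow>
      consumes I' (blk l) (image_mset tr (mset Ss)) {#tr (seq_of l)#} \<and> blk l \<noteq> []"
    and fin: "consumes I' fin {#tr S#} {#S'#}"
  shows "proof_of I' sh (concat (map blk \<pi>) @ fin) S'"
proof (cases sh)
  case Tree_like
  have "consumes I L M M' \<Longrightarrow> consumes I' (concat (map blk L)) (image_mset tr M) (image_mset tr M')"
    for L M M'
  proof (induction L arbitrary: M)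
    case (Cons l L)
    then obtain Ss N where *: "M = mset Ss + N" "I (fst l) (fst (snd l)) Ss (seq_of l)"
      "consumes I L (add_mset (seq_of l) N) M'" by auto
    have "consumes I' (blk l) (image_mset tr M) (add_mset (tr (seq_of l)) (image_mset tr N))"
      using consumes_frame[OF conjunct1[OF sim[OF *(2)]], of "image_mset tr N"] *(1) by simp
    with Cons.IH[OF *(3)] show ?case by (auto simp: consumes_append)
  qed simp
  from this[of \<pi> "{#}" "{#S#}"] \<pi> fin show ?thesis
    unfolding Tree_like proof_of_Tree_iff by (auto simp: consumes_append)
next
  case Dag_like
  from \<pi> have u: "uses I \<pi> {}" and ne: "\<pi> \<noteq> []" and S: "seq_of (last \<pi>) = S"
    unfolding Dag_like proof_of_Dag_iff by auto
  have conv: "tr (seq_of l) \<in> K \<union> seq_of ` set (blk l) \<and> uses I' (blk l) K"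
    if "set Ss \<subseteq> K0" "tr ` K0 \<subseteq> K" "I (fst l) (fst (snd l)) Ss (seq_of l)" for l Ss K0 K
    using consumes_uses[OF conjunct1[OF sim[OF that(3)]], of K] that by auto
  have *: "uses I L K \<Longrightarrow> tr ` K \<subseteq> K' \<Longrightarrow>
      uses I' (concat (map blk L)) K' \<and> tr ` seq_of ` set L \<subseteq> K' \<union> seq_of ` set (concat (map blk L))"
    for L K K'
  proof (induction L arbitrary: K K')
    case (Cons l L)
    then obtain Ss where Ss: "set Ss \<subseteq> K" "I (fst l) (fst (snd l)) Ss (seq_of l)"
      "uses I L (insert (seq_of l) K)" by auto
    let ?K = "K' \<union> seq_of ` set (blk l)"
    have "tr ` insert (seq_of l) K \<subseteq> ?K" using conv[OF Ss(1) Cons.prems(2) Ss(2)] Cons.prems(2) by auto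
    from Cons.IH[OF Ss(3) this] conv[OF Ss(1) Cons.prems(2) Ss(2)] show ?case
      by (auto simp: uses_append)
  qed simp
  from *[OF u, of "{}"] have 1: "uses I' (concat (map blk \<pi>)) {}"
    and 2: "tr ` seq_of ` set \<pi> \<subseteq> seq_of ` set (concat (map blk \<pi>))" by auto
  have "tr S \<in> seq_of ` set (concat (map blk \<pi>))" using 2 S ne by (metis image_eqI last_in_set subsetD)
  then have "uses I' fin (seq_of ` set (concat (map blk \<pi>)))"
    using consumes_uses[OF fin] by auto
  moreover have "seq_of (last (concat (map blk \<pi>) @ fin)) = S' \<and> concat (map blk \<pi>) @ fin \<noteq> []"
  proof -
    from u ne obtain Ss where Ss: "I (fst (last \<pi>)) (fst (snd (last \<pi>))) Ss (seq_of (last \<pi>))"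
      unfolding uses_iff by (metis diff_less last_conv_nth length_greater_0_conv less_one)
    from sim[OF this] fin S have c: "consumes I' (blk (last \<pi>) @ fin) (image_mset tr (mset Ss)) {#S'#}"
      and b: "blk (last \<pi>) \<noteq> []"
      by (auto simp: consumes_append)
    have "concat (map blk (butlast \<pi> @ [last \<pi>])) @ fin = concat (map blk (butlast \<pi>)) @ blk (last \<pi>) @ fin"
      by simp
    then have "concat (map blk \<pi>) @ fin = concat (map blk (butlast \<pi>)) @ blk (last \<pi>) @ fin"
      using ne by simp
    with consumes_last[OF c] b show ?thesis by simp
  qed
  ultimately show ?thesis
    unfolding Dag_like proof_of_Dag_iff using 1 by (simp add: uses_append)
qed


subsection \<open>Derivations from hypotheses\<close>

definition seq_all :: "('f \<Rightarrow> bool) \<Rightarrow> 'f sequent \<Rightarrow> bool" where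
  "seq_all ok S \<longleftrightarrow> (\<forall>F \<in># fst S + snd S. ok F)"

lemma seq_all_simps [simp]:
  "seq_all ok (add_mset A \<Gamma>, \<Delta>) \<longleftrightarrow> ok A \<and> seq_all ok (\<Gamma>, \<Delta>)"
  "seq_all ok (\<Gamma>, add_mset A \<Delta>) \<longleftrightarrow> ok A \<and> seq_all ok (\<Gamma>, \<Delta>)"
  "seq_all ok ({#}, {#})"
  "seq_all ok (\<Gamma> + \<Gamma>', \<Delta>) \<longleftrightarrow> seq_all ok (\<Gamma>, {#}) \<and> seq_all ok (\<Gamma>', \<Delta>)"
  by (auto simp: seq_all_def)

text \<open>The rules of 2-LK restrict premises as well as conclusions, so a derivation carries
  along that its conclusion is admissible; this discharges the side condition of the next
  inference.\<close>

definition derives ::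
  "(rule \<Rightarrow> 'f \<Rightarrow> 'f sequent list \<Rightarrow> 'f sequent \<Rightarrow> bool) \<Rightarrow> ('f \<Rightarrow> bool) \<Rightarrow> 'f line list \<Rightarrow>
   'f sequent multiset \<Rightarrow> 'f sequent \<Rightarrow> bool"
where
  "derives I ok L M S \<longleftrightarrow> consumes I L M {#S#} \<and> seq_all ok S"

section \<open>Weakening and cut as derived blocks\<close>

fun weaken_l :: "'f list \<Rightarrow> 'f list \<Rightarrow> 'f list \<Rightarrow> 'f line list" where
  "weaken_l [] G D = []"
| "weaken_l (A # As) G D = weaken_l As G D @ [(Weak_l, A, A # As @ G, D)]"

fun weaken_r :: "'f list \<Rightarrow> 'f list \<Rightarrow> 'f list \<Rightarrow> 'f line list" where
  "weaken_r [] G D = []"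
| "weaken_r (A # As) G D = weaken_r As G D @ [(Weak_r, A, G, A # As @ D)]"

definition weaken :: "'f list \<Rightarrow> 'f list \<Rightarrow> 'f list \<Rightarrow> 'f list \<Rightarrow> 'f line list" where
  "weaken As Bs G D = weaken_l As G D @ weaken_r Bs (As @ G) D"

text \<open>Cut with independent contexts. The rule \<open>Cut\<close> shares its context, so each
  premise is first weakened by the context of the other.\<close>

definition mix_cut :: "'f \<Rightarrow> 'f list \<Rightarrow> 'f list \<Rightarrow> 'f list \<Rightarrow> 'f list \<Rightarrow> 'f line list" where
  "mix_cut A G1 D1 G2 D2 = weaken G2 D2 G1 (A # D1) @ weaken G1 D1 (A # G2) D2 @
     [(Cut, A, G1 @ G2, D1 @ D2)]"

text \<open>Interpreted for both calculi, with \<open>ok\<close> being \<open>depth_two\<close> or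
  always true, so that derived cuts are constructed once.\<close>

locale structural =
  fixes I :: "rule \<Rightarrow> 'f \<Rightarrow> 'f sequent list \<Rightarrow> 'f sequent \<Rightarrow> bool" and ok :: "'f \<Rightarrow> bool"
  assumes I_weak_l: "seq_all ok (add_mset A \<Gamma>, \<Delta>) \<Longrightarrow> I Weak_l A [(\<Gamma>, \<Delta>)] (add_mset A \<Gamma>, \<Delta>)"
    and I_weak_r: "seq_all ok (\<Gamma>, add_mset A \<Delta>) \<Longrightarrow> I Weak_r A [(\<Gamma>, \<Delta>)] (\<Gamma>, add_mset A \<Delta>)"
    and I_contr_l: "seq_all ok (add_mset A \<Gamma>, \<Delta>) \<Longrightarrow>
      I Contr_l A [(add_mset A (add_mset A \<Gamma>), \<Delta>)] (add_mset A \<Gamma>, \<Delta>)"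
    and I_contr_r: "seq_all ok (\<Gamma>, add_mset A \<Delta>) \<Longrightarrow>
      I Contr_r A [(\<Gamma>, add_mset A (add_mset A \<Delta>))] (\<Gamma>, add_mset A \<Delta>)"
    and I_cut: "seq_all ok (\<Gamma>, \<Delta>) \<Longrightarrow> ok A \<Longrightarrow>
      I Cut A [(\<Gamma>, add_mset A \<Delta>), (add_mset A \<Gamma>, \<Delta>)] (\<Gamma>, \<Delta>)"
begin

abbreviation "der \<equiv> derives I ok"

lemma hyp: "seq_all ok S \<Longrightarrow> der [] {#S#} S"
  by (simp add: derives_def)

lemma d_trans: "der L1 M S \<Longrightarrow> der L2 {#S#} T \<Longrightarrow> der (L1 @ L2) M T"
  unfolding derives_def consumes_append by blast

lemma step0: "I r A [] (mset G, mset D) \<Longrightarrow> seq_all ok (mset G, mset D) \<Longrightarrow>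
    der [(r, A, G, D)] {#} (mset G, mset D)"
  by (auto simp: derives_def intro!: exI[of _ "[]"])

lemma step1: "der L M S \<Longrightarrow> I r A [S] (mset G, mset D) \<Longrightarrow> seq_all ok (mset G, mset D) \<Longrightarrow>
    der (L @ [(r, A, G, D)]) M (mset G, mset D)"
  by (auto simp: derives_def consumes_append intro!: exI[of _ "[S]"] exI[of _ "{#S#}"])

lemma step2:
  assumes "der L1 M1 S1" "der L2 M2 S2" "I r A [S1, S2] (mset G, mset D)"
    "seq_all ok (mset G, mset D)"
  shows "der (L1 @ L2 @ [(r, A, G, D)]) (M1 + M2) (mset G, mset D)"
proof -
  have "consumes I L1 (M1 + M2) (add_mset S1 M2)"
    using consumes_frame[of I L1 M1 "{#S1#}" M2] assms(1) by (simp add: derives_def)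
  moreover have "consumes I L2 (add_mset S1 M2) {#S1, S2#}"
    using consumes_frame[of I L2 M2 "{#S2#}" "{#S1#}"] assms(2)
    by (simp add: derives_def add_mset_commute)
  moreover have "consumes I [(r, A, G, D)] {#S1, S2#} {#(mset G, mset D)#}"
    using assms(3) by (auto intro!: exI[of _ "[S1, S2]"])
  ultimately show ?thesis using assms(4) unfolding derives_def consumes_append by blast
qed

text \<open>The cedents of the conclusion are variables tied by equations, so that the rule applies
  by unification and the multisets are matched by simplification afterwards. The later derivation
  rules have the same form.\<close>

lemma d_weak_l: "der L M (\<Gamma>, \<Delta>) \<Longrightarrow> ok A \<Longrightarrow> \<Gamma>' = add_mset A \<Gamma> \<Longrightarrow> \<Delta>' = \<Delta> \<Longrightarrow>
    mset G = \<Gamma>' \<Longrightarrow> mset D = \<Delta>' \<Longrightarrow> der (L @ [(Weak_l, A, G, D)]) M (\<Gamma>', \<Delta>')"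
  using step1[of L M "(\<Gamma>, \<Delta>)" Weak_l A G D] I_weak_l[of A \<Gamma> \<Delta>] by (simp add: derives_def)

lemma d_weak_r: "der L M (\<Gamma>, \<Delta>) \<Longrightarrow> ok A \<Longrightarrow> \<Gamma>' = \<Gamma> \<Longrightarrow> \<Delta>' = add_mset A \<Delta> \<Longrightarrow>
    mset G = \<Gamma>' \<Longrightarrow> mset D = \<Delta>' \<Longrightarrow> der (L @ [(Weak_r, A, G, D)]) M (\<Gamma>', \<Delta>')"
  using step1[of L M "(\<Gamma>, \<Delta>)" Weak_r A G D] I_weak_r[of \<Gamma> A \<Delta>] by (simp add: derives_def)

lemma d_contr_l: "der L M (\<Gamma>, \<Delta>) \<Longrightarrow> \<Gamma> = add_mset A \<Gamma>' \<Longrightarrow> A \<in># \<Gamma>' \<Longrightarrow> \<Delta>' = \<Delta> \<Longrightarrow>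
    mset G = \<Gamma>' \<Longrightarrow> mset D = \<Delta>' \<Longrightarrow> der (L @ [(Contr_l, A, G, D)]) M (\<Gamma>', \<Delta>')"
  using step1[of L M "(\<Gamma>, \<Delta>)" Contr_l A G D] I_contr_l[of A "\<Gamma>' - {#A#}" \<Delta>]
  by (simp add: derives_def)

lemma d_contr_r: "der L M (\<Gamma>, \<Delta>) \<Longrightarrow> \<Delta> = add_mset A \<Delta>' \<Longrightarrow> A \<in># \<Delta>' \<Longrightarrow> \<Gamma>' = \<Gamma> \<Longrightarrow>
    mset G = \<Gamma>' \<Longrightarrow> mset D = \<Delta>' \<Longrightarrow> der (L @ [(Contr_r, A, G, D)]) M (\<Gamma>', \<Delta>')"
  using step1[of L M "(\<Gamma>, \<Delta>)" Contr_r A G D] I_contr_r[of \<Gamma> A "\<Delta>' - {#A#}"]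
  by (simp add: derives_def)

lemma d_cut: "der L1 M1 (\<Gamma>, \<Delta>1) \<Longrightarrow> der L2 M2 (\<Gamma>2, \<Delta>) \<Longrightarrow>
    \<Delta>1 = add_mset A \<Delta>' \<Longrightarrow> \<Gamma>2 = add_mset A \<Gamma>' \<Longrightarrow> \<Gamma>' = \<Gamma> \<Longrightarrow> \<Delta>' = \<Delta> \<Longrightarrow>
    mset G = \<Gamma>' \<Longrightarrow> mset D = \<Delta>' \<Longrightarrow> der (L1 @ L2 @ [(Cut, A, G, D)]) (M1 + M2) (\<Gamma>', \<Delta>')"
  using step2[of L1 M1 "(\<Gamma>, \<Delta>1)" L2 M2 "(\<Gamma>2, \<Delta>)" Cut A G D] I_cut[of \<Gamma> \<Delta> A]
  by (simp add: derives_def)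

lemma d_weaken:
  assumes "der L M (\<Gamma>, \<Delta>)" "list_all ok As" "list_all ok Bs" "mset G = \<Gamma>" "mset D = \<Delta>"
    "\<Gamma>' = mset As + \<Gamma>" "\<Delta>' = mset Bs + \<Delta>"
  shows "der (L @ weaken As Bs G D) M (\<Gamma>', \<Delta>')"
proof -
  have 1: "der (L @ weaken_l As G D) M (mset As + \<Gamma>, \<Delta>)"
    using assms(1,2,4,5)
  proof (induction As)
    case (Cons A As)
    then show ?case
      using d_weak_l[of "L @ weaken_l As G D" M "mset As + \<Gamma>" \<Delta> A "mset (A # As) + \<Gamma>" \<Delta>
        "A # As @ G" D] by simp
  qed simp
  have "der ((L @ weaken_l As G D) @ weaken_r Bs (As @ G) D) M (mset As + \<Gamma>, mset Bs + \<Delta>)"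
    using 1 assms(3,4,5)
  proof (induction Bs)
    case (Cons B Bs)
    then show ?case
      using d_weak_r[of "(L @ weaken_l As G D) @ weaken_r Bs (As @ G) D" M "mset As + \<Gamma>"
        "mset Bs + \<Delta>" B "mset As + \<Gamma>" "mset (B # Bs) + \<Delta>" "As @ G" "B # Bs @ D"] by simp
  qed simp
  then show ?thesis using assms(6,7) by (simp add: weaken_def)
qed

lemma list_all_ok: "seq_all ok (mset G, mset D) \<longleftrightarrow> list_all ok G \<and> list_all ok D"
  by (auto simp: seq_all_def list_all_iff)

lemma d_mix_cut:
  assumes "der L1 M1 (\<Gamma>1, \<Delta>1)" "der L2 M2 (\<Gamma>2, \<Delta>2)"
    "mset G1 = \<Gamma>1" "add_mset A (mset D1) = \<Delta>1" "add_mset A (mset G2) = \<Gamma>2" "mset D2 = \<Delta>2"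
    "\<Gamma> = mset (G1 @ G2)" "\<Delta> = mset (D1 @ D2)" "M = M1 + M2"
  shows "der (L1 @ L2 @ mix_cut A G1 D1 G2 D2) M (\<Gamma>, \<Delta>)"
proof -
  have ok: "list_all ok G1" "list_all ok (A # D1)" "list_all ok (A # G2)" "list_all ok D2"
    using assms(1,2) unfolding derives_def assms(3-6)[symmetric]
    by (simp_all add: list_all_ok)
  let ?S1 = "(\<Gamma>1, \<Delta>1)" and ?S2 = "(\<Gamma>2, \<Delta>2)"
  let ?T1 = "(\<Gamma>, add_mset A \<Delta>)" and ?T2 = "(add_mset A \<Gamma>, \<Delta>)"
  have S: "seq_all ok ?S1" "seq_all ok ?S2" using assms(1,2) by (simp_all add: derives_def)
  have T: "der (weaken G2 D2 G1 (A # D1)) {#?S1#} ?T1"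
    "der (weaken G1 D1 (A # G2) D2) {#?S2#} ?T2"
    using d_weaken[OF hyp[OF S(1)], of G2 D2 G1 "A # D1" "fst ?T1" "snd ?T1"]
      d_weaken[OF hyp[OF S(2)], of G1 D1 "A # G2" D2 "fst ?T2" "snd ?T2"] ok assms(3-8)
    by auto
  have "der ([] @ [] @ [(Cut, A, G1 @ G2, D1 @ D2)]) ({#?T1#} + {#?T2#}) (\<Gamma>, \<Delta>)"
    using T assms(7,8) by (intro d_cut[OF hyp hyp]) (simp_all add: derives_def)
  then have C: "consumes I [(Cut, A, G1 @ G2, D1 @ D2)] ({#?T1#} + {#?T2#}) {#(\<Gamma>, \<Delta>)#}"
    and ok': "seq_all ok (\<Gamma>, \<Delta>)" unfolding derives_def by (simp_all only: append.simps)
  \<comment> \<open>Both derivations run before the two weakenings; each piece is framed by whatever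
    is pending beside it, and commutativity lines the multisets up.\<close>
  have L1: "consumes I L1 (M1 + M2) ({#?S1#} + M2)"
    using assms(1) by (intro consumes_frame) (simp add: derives_def)
  have L2: "consumes I L2 (M2 + {#?S1#}) ({#?S2#} + {#?S1#})"
    using assms(2) by (intro consumes_frame) (simp add: derives_def)
  have W1: "consumes I (weaken G2 D2 G1 (A # D1)) ({#?S1#} + {#?S2#}) ({#?T1#} + {#?S2#})"
    using T(1) by (intro consumes_frame) (simp add: derives_def)
  have W2: "consumes I (weaken G1 D1 (A # G2) D2) ({#?S2#} + {#?T1#}) ({#?T2#} + {#?T1#})"
    using T(2) by (intro consumes_frame) (simp add: derives_def)
  show ?thesis
    unfolding derives_def mix_cut_def consumes_append assms(9)
    using L1 L2[unfolded add.commute[of M2]] W1[unfolded add.commute[of "{#?S1#}"]]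
      W2[unfolded add.commute[of "{#?S2#}" "{#?T1#}"]] C[unfolded add.commute[of "{#?T1#}" "{#?T2#}"]] ok'
    by blast
qed

end


lemma ptime_weaken_l:
  assumes "ptime As" "ptime G" "ptime D"
  shows "ptime (\<lambda>x. weaken_l (As x) (G x) (D x))"
proof -
  have "ptime (\<lambda>p :: ('b list \<times> 'b list) \<times> 'b list. weaken_l (snd p) (fst (fst p)) (snd (fst p)))"
    by (intro ptime_rec_list[where g = "\<lambda>v. []" and u = "\<lambda>v x. v"
          and h = "\<lambda>v A As r. r @ [(Weak_l, A, A # As @ fst v, snd v)]"
          and c = "[]"]) (auto intro!: ptime_intros)
  from ptime_app[OF this ptime_pair[OF ptime_pair[OF assms(2,3)] assms(1)]] show ?thesis by simp
qed

lemma ptime_weaken_r: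
  assumes "ptime As" "ptime G" "ptime D"
  shows "ptime (\<lambda>x. weaken_r (As x) (G x) (D x))"
proof -
  have "ptime (\<lambda>p :: ('b list \<times> 'b list) \<times> 'b list. weaken_r (snd p) (fst (fst p)) (snd (fst p)))"
    by (intro ptime_rec_list[where g = "\<lambda>v. []" and u = "\<lambda>v x. v"
          and h = "\<lambda>v A As r. r @ [(Weak_r, A, fst v, A # As @ snd v)]"
          and c = "[]"]) (auto intro!: ptime_intros)
  from ptime_app[OF this ptime_pair[OF ptime_pair[OF assms(2,3)] assms(1)]] show ?thesis by simp
qed

lemma ptime_weaken [ptime_intros]:
  "ptime As \<Longrightarrow> ptime Bs \<Longrightarrow> ptime G \<Longrightarrow> ptime D \<Longrightarrow> ptime (\<lambda>x. weaken (As x) (Bs x) (G x) (D x))"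
  unfolding weaken_def by (intro ptime_intros ptime_weaken_l ptime_weaken_r)

lemma ptime_mix_cut [ptime_intros]:
  "ptime A \<Longrightarrow> ptime G1 \<Longrightarrow> ptime D1 \<Longrightarrow> ptime G2 \<Longrightarrow> ptime D2 \<Longrightarrow>
   ptime (\<lambda>x. mix_cut (A x) (G1 x) (D1 x) (G2 x) (D2 x))"
  unfolding mix_cut_def by (intro ptime_intros)


subsection \<open>Sizes of proofs\<close>

lemma proof_of_uses: "proof_of I sh \<pi> S \<Longrightarrow> uses I \<pi> {}"
  using proof_of_Dag_iff[of I \<pi> S] unfolding proof_of_def by auto

text \<open>The size of a proof only bounds the size of its code because a sound calculus does not derive
  the empty sequent, whose lines would have size 0, and because the principal formula of a line
  occurs in a sequent of the proof.\<close>

definition holds :: "('f \<Rightarrow> bool) \<Rightarrow> 'f sequent \<Rightarrow> bool" where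
  "holds v S \<longleftrightarrow> (\<exists>F\<in>#fst S. \<not> v F) \<or> (\<exists>F\<in>#snd S. v F)"

lemma uses_holds:
  assumes "uses I L K" "\<forall>S\<in>K. holds v S"
    and "\<And>r A Ss S. I r A Ss S \<Longrightarrow> \<forall>S\<in>set Ss. holds v S \<Longrightarrow> holds v S"
  shows "\<forall>l\<in>set L. holds v (seq_of l)"
  using assms(1,2)
proof (induction L arbitrary: K)
  case (Cons l L)
  then obtain Ss where Ss: "set Ss \<subseteq> K" "I (fst l) (fst (snd l)) Ss (seq_of l)"
    "uses I L (insert (seq_of l) K)" by auto
  then have "holds v (seq_of l)" using assms(3) Cons.prems(2) by blast
  with Cons.IH[OF Ss(3)] Cons.prems(2) show ?case by simp
qed simp

text \<open>Truth under the assignment that makes every variable false. The name refers to the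
  assignment, so a negated variable holds. A single assignment suffices to exclude the empty
  sequent.\<close>

primrec false_lit :: "lit \<Rightarrow> bool" where
  "false_lit (Pos x) = False" | "false_lit (Neg x) = True"

primrec false_ndt :: "ndt \<Rightarrow> bool" where
  "false_ndt (NLit p) = false_lit p"
| "false_ndt (NDec A p B) = (if false_lit p then false_ndt B else false_ndt A)"
| "false_ndt (NOr A B) = (false_ndt A \<or> false_ndt B)"

primrec false_bform :: "bform \<Rightarrow> bool" where
  "false_bform (BLit p) = false_lit p"
| "false_bform (BAnd A B) = (false_bform A \<and> false_bform B)"
| "false_bform (BOr A B) = (false_bform A \<or> false_bform B)"

lemma false_lit_neg [simp]: "false_lit (neg p) \<longleftrightarrow> \<not> false_lit p"
  by (cases p) auto

lemma lndt_sound: "lndt r A Ss S \<Longrightarrow> \<forall>S\<in>set Ss. holds false_ndt S \<Longrightarrow> holds false_ndt S"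
  by (induction rule: lndt.induct) (auto simp: holds_def split: if_splits)

lemma lk_sound: "lk r A Ss S \<Longrightarrow> \<forall>S\<in>set Ss. holds false_bform S \<Longrightarrow> holds false_bform S"
  by (induction rule: lk.induct) (auto simp: holds_def)

definition principal_in :: "'f \<Rightarrow> 'f sequent \<Rightarrow> bool" where
  "principal_in A S \<longleftrightarrow> A \<in># fst S + snd S"

lemma lndt_principal: "lndt r A Ss S \<Longrightarrow> \<exists>T\<in>set (S # Ss). principal_in A T"
  by (induction rule: lndt.induct) (auto simp: principal_in_def)

lemma lk_principal: "lk r A Ss S \<Longrightarrow> \<exists>T\<in>set (S # Ss). principal_in A T"
  by (induction rule: lk.induct) (auto simp: principal_in_def)

text \<open>A disjunction adds three tree nodes to the code but nothing to the formula size; the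
  slack 3 pays for them in the induction. A literal has a code of size 5, whence the factor
  8.\<close>

lemma vsz_ndt: "vsz A + 3 \<le> 8 * ndt_size A"
  by (induction A) auto

lemma vsz_bform: "vsz A + 3 \<le> 8 * bform_size A"
  by (induction A) auto

lemma ndt_size_pos: "ndt_size A > 0"
  by (induction A) auto

lemma bform_size_pos: "bform_size A > 0"
  by (induction A) auto

lemma vsz_proof:
  fixes fsize :: "'f::encodable \<Rightarrow> nat"
  assumes \<pi>: "uses I \<pi> {}"
    and sound: "\<And>r A Ss S. I r A Ss S \<Longrightarrow> \<forall>S\<in>set Ss. holds v S \<Longrightarrow> holds v S"
    and principal: "\<And>r A Ss S. I r A Ss S \<Longrightarrow> \<exists>T\<in>set (S # Ss). principal_in A T"
    and fsize: "\<And>F. vsz F \<le> 8 * fsize F" "\<And>F. fsize F > 0"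
  shows "vsz \<pi> \<le> poly [:1, 16, 8:] (proof_size fsize \<pi>)"
proof -
  define ls where "ls l = sum_list (map fsize (fst (snd (snd l)) @ snd (snd (snd l))))"
    for l :: "'f line"
  define N where "N = proof_size fsize \<pi>"
  have N: "N = sum_list (map ls \<pi>)"
    unfolding N_def proof_size_def ls_def by (intro arg_cong[where f = sum_list]) auto
  have ls_le: "ls l \<le> N" if "l \<in> set \<pi>" for l
    unfolding N using that by (intro member_le_sum_list) auto
  have elem: "vsz F \<le> 8 * N" if "principal_in F (seq_of l)" "l \<in> set \<pi>" for F l
  proof -
    have "F \<in> set (fst (snd (snd l)) @ snd (snd (snd l)))"
      using that(1) by (cases l) (auto simp: principal_in_def)
    then have "fsize F \<le> ls l" unfolding ls_def by (intro member_le_sum_list) auto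
    then show ?thesis using ls_le[OF that(2)] fsize(1)[of F] by linarith
  qed
  \<comment> \<open>A cut formula occurs only in the premises, hence on other lines, so its size is
    bounded through the whole proof. Charging \<open>N\<close> to every line makes the final bound
    quadratic.\<close>
  have A: "vsz (fst (snd l)) \<le> 8 * N" if "l \<in> set \<pi>" for l
  proof -
    from that obtain i where i: "i < length \<pi>" "l = \<pi> ! i" by (auto simp: in_set_conv_nth)
    with \<pi> obtain Ss where Ss: "set Ss \<subseteq> seq_of ` set (take i \<pi>)"
      "I (fst l) (fst (snd l)) Ss (seq_of l)" unfolding uses_iff by auto
    from principal[OF Ss(2)] obtain T where T: "T \<in> set (seq_of l # Ss)"
      "principal_in (fst (snd l)) T" by blast
    then have "T \<in> seq_of ` set \<pi>"
      using Ss(1) that set_take_subset[of i \<pi>] by auto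
    with T(2) obtain k where "k \<in> set \<pi>" "principal_in (fst (snd l)) (seq_of k)" by blast
    then show ?thesis by (rule elem[rotated])
  qed
  have ne: "ls l > 0" if "l \<in> set \<pi>" for l
  proof -
    have "holds v (seq_of l)" using uses_holds[OF \<pi> _ sound] that by auto
    then obtain F where "F \<in> set (fst (snd (snd l)) @ snd (snd (snd l)))"
      by (cases l) (auto simp: holds_def)
    then have "fsize F \<le> ls l" unfolding ls_def by (intro member_le_sum_list) auto
    then show ?thesis using fsize(2)[of F] by linarith
  qed
  have fs: "vsz \<Gamma> \<le> 1 + 9 * sum_list (map fsize \<Gamma>)" for \<Gamma>
  proof (induction \<Gamma>)
    case (Cons F \<Gamma>)
    then show ?case using fsize[of F] by simp
  qed simp
  have line: "vsz l \<le> 6 + 8 * N + 9 * ls l" if "l \<in> set \<pi>" for l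
    using A[OF that] fs[of "fst (snd (snd l))"] fs[of "snd (snd (snd l))"]
    by (cases l) (simp add: ls_def)
  have "vsz L \<le> 1 + (\<Sum>l\<leftarrow>L. (16 + 8 * N) * ls l)" if "set L \<subseteq> set \<pi>" for L
    using that
  proof (induction L)
    case (Cons l L)
    then have l: "l \<in> set \<pi>" by simp
    have "1 + vsz l \<le> 7 + 8 * N + 9 * ls l" using line[OF l] by simp
    \<comment> \<open>By \<open>ne\<close> the line has positive size, so multiplying the constant
      part by \<open>ls l\<close> is allowed; then the lines can be summed.\<close>
    also have "\<dots> \<le> (7 + 8 * N) * ls l + 9 * ls l" using ne[OF l] by (cases "ls l") auto
    also have "\<dots> = (16 + 8 * N) * ls l" by (simp add: algebra_simps)
    finally show ?case using Cons by simp
  qed simp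
  from this[of \<pi>] have "vsz \<pi> \<le> 1 + (16 + 8 * N) * N"
    by (simp add: sum_list_const_mult N)
  then show ?thesis by (simp add: N_def[symmetric] algebra_simps)
qed

lemma ptime_outputs:
  assumes "ptime f" and enc: "\<And>F. repr F = e F" "\<And>F. repr F = e' F"
  shows "\<exists>P q. \<forall>\<pi>. vsz \<pi> \<le> poly p (proof_size fsize \<pi>) \<longrightarrow> outputs_in_time P q e fsize e' \<pi> (f \<pi>)"
proof -
  from assms(1) obtain P q where P: "\<And>x. \<exists>t. run P (repr x) (repr (f x)) t \<and> t \<le> poly q (vsz x)"
    unfolding ptime_def ptime_on_def vsz_def by blast
  have "outputs_in_time P (pcompose q p) e fsize e' \<pi> (f \<pi>)"
    if "vsz \<pi> \<le> poly p (proof_size fsize \<pi>)" for \<pi>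
  proof -
    from P[of \<pi>] obtain t where "run P (repr \<pi>) (repr (f \<pi>)) t" "t \<le> poly q (vsz \<pi>)" by blast
    moreover have "poly q (vsz \<pi>) \<le> poly (pcompose q p) (proof_size fsize \<pi>)"
      using poly_nat_mono[OF that] by (simp add: poly_pcompose)
    ultimately show ?thesis
      unfolding outputs_in_time_def enc_proof_repr[OF enc(1)] enc_proof_repr[OF enc(2)]
      using le_trans by blast
  qed
  then show ?thesis by blast
qed

section \<open>Depth two formulas\<close>

text \<open>Recursive tests in place of the existential definitions, usable both in inductions and
  by a program.\<close>

primrec is_clause :: "bform \<Rightarrow> bool" where
  "is_clause (BLit p) = True"
| "is_clause (BAnd A B) = False"
| "is_clause (BOr A B) = (is_clause A \<and> is_clause B)"

primrec is_term :: "bform \<Rightarrow> bool" where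
  "is_term (BLit p) = True"
| "is_term (BAnd A B) = (is_term A \<and> is_term B)"
| "is_term (BOr A B) = False"

primrec is_dnf :: "bform \<Rightarrow> bool" where
  "is_dnf (BLit p) = True"
| "is_dnf (BAnd A B) = (is_term A \<and> is_term B)"
| "is_dnf (BOr A B) = (is_dnf A \<and> is_dnf B)"

primrec is_cnf :: "bform \<Rightarrow> bool" where
  "is_cnf (BLit p) = True"
| "is_cnf (BAnd A B) = (is_cnf A \<and> is_cnf B)"
| "is_cnf (BOr A B) = (is_clause A \<and> is_clause B)"

lemma is_dnf_term: "is_term F \<Longrightarrow> is_dnf F" by (cases F) auto
lemma is_cnf_clause: "is_clause F \<Longrightarrow> is_cnf F" by (cases F) auto
lemma is_dnf_clause: "is_clause F \<Longrightarrow> is_dnf F" by (induction F) auto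

lemma clause_iff: "clause F \<longleftrightarrow> is_clause F"
proof
  have "nested_or As F \<Longrightarrow> \<forall>A\<in>set As. is_clause A \<Longrightarrow> is_clause F" for As
    by (induction rule: nested_or.induct) auto
  then show "clause F \<Longrightarrow> is_clause F" unfolding clause_def big_or_def by force
next
  assume "is_clause F"
  then have "\<exists>ps. nested_or (map BLit ps) F"
  proof (induction F)
    case (BLit p)
    then show ?case using nested_or.intros(1)[of "BLit p"] by (intro exI[of _ "[p]"]) simp
  next
    case (BOr A B)
    then obtain ps qs where "nested_or (map BLit ps) A" "nested_or (map BLit qs) B" by auto
    from nested_or.intros(2)[OF this] show ?case by (intro exI[of _ "ps @ qs"]) simp
  qed simp
  then show "clause F" unfolding clause_def big_or_def .
qed

lemma dnf_term_iff: "dnf_term F \<longleftrightarrow> is_term F"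
proof
  have "nested_and As F \<Longrightarrow> \<forall>A\<in>set As. is_term A \<Longrightarrow> is_term F" for As
    by (induction rule: nested_and.induct) auto
  then show "dnf_term F \<Longrightarrow> is_term F" unfolding dnf_term_def big_and_def by force
next
  assume "is_term F"
  then have "\<exists>ps. nested_and (map BLit ps) F"
  proof (induction F)
    case (BLit p)
    then show ?case using nested_and.intros(1)[of "BLit p"] by (intro exI[of _ "[p]"]) simp
  next
    case (BAnd A B)
    then obtain ps qs where "nested_and (map BLit ps) A" "nested_and (map BLit qs) B" by auto
    from nested_and.intros(2)[OF this] show ?case by (intro exI[of _ "ps @ qs"]) simp
  qed simp
  then show "dnf_term F" unfolding dnf_term_def big_and_def .
qed

text \<open>A clause is a conjunction of one clause and a term a disjunction of one term, so the
  four kinds collapse to two.\<close>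

lemma depth_two_iff: "depth_two F \<longleftrightarrow> is_dnf F \<or> is_cnf F"
proof
  have "nested_or As F \<Longrightarrow> \<forall>A\<in>set As. is_dnf A \<Longrightarrow> is_dnf F" for As
    by (induction rule: nested_or.induct) auto
  moreover have "nested_and As F \<Longrightarrow> \<forall>A\<in>set As. is_cnf A \<Longrightarrow> is_cnf F" for As
    by (induction rule: nested_and.induct) auto
  ultimately show "depth_two F \<Longrightarrow> is_dnf F \<or> is_cnf F"
    unfolding depth_two_def clause_iff dnf_term_iff using is_dnf_term is_cnf_clause by blast
next
  have "is_dnf F \<Longrightarrow> \<exists>Ts. (\<forall>T\<in>set Ts. is_term T) \<and> nested_or Ts F"
  proof (induction F)
    case (BLit p)
    then show ?case using nested_or.intros(1)[of "BLit p"] by (intro exI[of _ "[BLit p]"]) simp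
  next
    case (BAnd A B)
    then show ?case using nested_or.intros(1)[of "BAnd A B"] by (intro exI[of _ "[BAnd A B]"]) simp
  next
    case (BOr A B)
    then obtain S T where "\<forall>T\<in>set S. is_term T" "\<forall>T\<in>set T. is_term T" "nested_or S A" "nested_or T B"
      by auto
    with nested_or.intros(2)[OF this(3,4)] show ?case by (intro exI[of _ "S @ T"]) auto
  qed
  moreover have "is_cnf F \<Longrightarrow> \<exists>Cs. (\<forall>C\<in>set Cs. is_clause C) \<and> nested_and Cs F"
  proof (induction F)
    case (BLit p)
    then show ?case using nested_and.intros(1)[of "BLit p"] by (intro exI[of _ "[BLit p]"]) simp
  next
    case (BOr A B)
    then show ?case using nested_and.intros(1)[of "BOr A B"] by (intro exI[of _ "[BOr A B]"]) simp
  next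
    case (BAnd A B)
    then obtain S T where "\<forall>T\<in>set S. is_clause T" "\<forall>T\<in>set T. is_clause T" "nested_and S A" "nested_and T B"
      by auto
    with nested_and.intros(2)[OF this(3,4)] show ?case by (intro exI[of _ "S @ T"]) auto
  qed
  ultimately show "is_dnf F \<or> is_cnf F \<Longrightarrow> depth_two F"
    unfolding depth_two_def clause_iff dnf_term_iff by blast
qed

lemma dnf_depth_two [simp]: "is_dnf F \<Longrightarrow> depth_two F"
  by (simp add: depth_two_iff)

section \<open>The calculi\<close>

lemma two_lk_iff: "two_lk r A Ss S \<longleftrightarrow> lk r A Ss S \<and> list_all (seq_all depth_two) (S # Ss)"
  unfolding two_lk_def seq_all_def list_all_iff by (auto split: prod.splits)

interpretation lk: structural two_lk depth_two
  using lk.intros(4-8) unfolding structural_def two_lk_iff by simp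

interpretation nd: structural lndt "\<lambda>_. True"
  using lndt.intros(4-8) unfolding structural_def by simp

lemma seq_all_True [simp]: "seq_all (\<lambda>_. True) S" by (simp add: seq_all_def)

lemma lk_init:
  "mset G = {#BLit p#} \<Longrightarrow> mset D = {#BLit p#} \<Longrightarrow>
    lk.der [(Init_id, BLit p, G, D)] {#} ({#BLit p#}, {#BLit p#})"
  "mset G = {#BLit p, BLit (neg p)#} \<Longrightarrow> D = [] \<Longrightarrow>
    lk.der [(Init_l, BLit p, G, D)] {#} ({#BLit p, BLit (neg p)#}, {#})"
  "G = [] \<Longrightarrow> mset D = {#BLit p, BLit (neg p)#} \<Longrightarrow>
    lk.der [(Init_r, BLit p, G, D)] {#} ({#}, {#BLit p, BLit (neg p)#})"
  using lk.step0[of Init_id "BLit p" G D] lk.step0[of Init_l "BLit p" G D]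
    lk.step0[of Init_r "BLit p" G D] lk.intros(1-3)[of p]
  by (simp_all add: two_lk_iff)

lemma lk_and_l: "lk.der L M (\<Gamma>, \<Delta>) \<Longrightarrow> \<Gamma> = add_mset A (add_mset B (\<Gamma>' - {#BAnd A B#})) \<Longrightarrow>
    BAnd A B \<in># \<Gamma>' \<Longrightarrow> \<Delta>' = \<Delta> \<Longrightarrow> depth_two (BAnd A B) \<Longrightarrow> mset G = \<Gamma>' \<Longrightarrow> mset D = \<Delta>' \<Longrightarrow>
    lk.der (L @ [(And_l, BAnd A B, G, D)]) M (\<Gamma>', \<Delta>')"
  using lk.step1[of L M "(\<Gamma>, \<Delta>)" And_l "BAnd A B" G D] lk.intros(9)[of A B "\<Gamma>' - {#BAnd A B#}" \<Delta>]
  by (auto simp: derives_def two_lk_iff dest!: multi_member_split)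

lemma lk_or_r: "lk.der L M (\<Gamma>, \<Delta>) \<Longrightarrow> \<Delta> = add_mset A (add_mset B (\<Delta>' - {#BOr A B#})) \<Longrightarrow>
    BOr A B \<in># \<Delta>' \<Longrightarrow> \<Gamma>' = \<Gamma> \<Longrightarrow> depth_two (BOr A B) \<Longrightarrow> mset G = \<Gamma>' \<Longrightarrow> mset D = \<Delta>' \<Longrightarrow>
    lk.der (L @ [(Or_r, BOr A B, G, D)]) M (\<Gamma>', \<Delta>')"
  using lk.step1[of L M "(\<Gamma>, \<Delta>)" Or_r "BOr A B" G D] lk.intros(12)[of A B \<Gamma> "\<Delta>' - {#BOr A B#}"]
  by (auto simp: derives_def two_lk_iff dest!: multi_member_split)

lemma lk_and_r: "lk.der L1 M1 (\<Gamma>1, \<Delta>1) \<Longrightarrow> lk.der L2 M2 (\<Gamma>2, \<Delta>2) \<Longrightarrow> BAnd A B \<in># \<Delta>' \<Longrightarrow>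
    \<Delta>1 = add_mset A (\<Delta>' - {#BAnd A B#}) \<Longrightarrow> \<Delta>2 = add_mset B (\<Delta>' - {#BAnd A B#}) \<Longrightarrow>
    \<Gamma>' = \<Gamma>1 \<Longrightarrow> \<Gamma>' = \<Gamma>2 \<Longrightarrow> M = M1 + M2 \<Longrightarrow> depth_two (BAnd A B) \<Longrightarrow> mset G = \<Gamma>' \<Longrightarrow> mset D = \<Delta>' \<Longrightarrow>
    lk.der (L1 @ L2 @ [(And_r, BAnd A B, G, D)]) M (\<Gamma>', \<Delta>')"
  using lk.step2[of L1 M1 "(\<Gamma>1, \<Delta>1)" L2 M2 "(\<Gamma>2, \<Delta>2)" And_r "BAnd A B" G D]
    lk.intros(10)[of A B \<Gamma>' "\<Delta>' - {#BAnd A B#}"]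
  by (auto simp: derives_def two_lk_iff dest!: multi_member_split)

lemma lk_or_l: "lk.der L1 M1 (\<Gamma>1, \<Delta>1) \<Longrightarrow> lk.der L2 M2 (\<Gamma>2, \<Delta>2) \<Longrightarrow> BOr A B \<in># \<Gamma>' \<Longrightarrow>
    \<Gamma>1 = add_mset A (\<Gamma>' - {#BOr A B#}) \<Longrightarrow> \<Gamma>2 = add_mset B (\<Gamma>' - {#BOr A B#}) \<Longrightarrow>
    \<Delta>' = \<Delta>1 \<Longrightarrow> \<Delta>' = \<Delta>2 \<Longrightarrow> M = M1 + M2 \<Longrightarrow> depth_two (BOr A B) \<Longrightarrow> mset G = \<Gamma>' \<Longrightarrow> mset D = \<Delta>' \<Longrightarrow>
    lk.der (L1 @ L2 @ [(Or_l, BOr A B, G, D)]) M (\<Gamma>', \<Delta>')"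
  using lk.step2[of L1 M1 "(\<Gamma>1, \<Delta>1)" L2 M2 "(\<Gamma>2, \<Delta>2)" Or_l "BOr A B" G D]
    lk.intros(11)[of A B "\<Gamma>' - {#BOr A B#}" \<Delta>']
  by (auto simp: derives_def two_lk_iff dest!: multi_member_split)

section \<open>From LNDT to 2-LK\<close>

text \<open>A conjunction with the whole formula would in general have depth three, so the literal
  is distributed over the terms.\<close>

primrec pre :: "lit \<Rightarrow> bform \<Rightarrow> bform" where
  "pre l (BLit p) = BAnd (BLit l) (BLit p)"
| "pre l (BAnd A B) = BAnd (BLit l) (BAnd A B)"
| "pre l (BOr A B) = BOr (pre l A) (pre l B)"

primrec to_dnf :: "ndt \<Rightarrow> bform" where
  "to_dnf (NLit p) = BLit p"
| "to_dnf (NDec A p B) = BOr (pre (neg p) (to_dnf A)) (pre p (to_dnf B))"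
| "to_dnf (NOr A B) = BOr (to_dnf A) (to_dnf B)"

lemma is_dnf_pre [simp]: "is_dnf F \<Longrightarrow> is_dnf (pre l F)"
  by (induction F) auto

lemma is_dnf_to_dnf [simp]: "is_dnf (to_dnf A)"
  by (induction A) auto

text \<open>Initial sequents are atomic, so identities for terms have to be derived.\<close>

primrec id_term :: "bform \<Rightarrow> bform line list" where
  "id_term (BLit p) = [(Init_id, BLit p, [BLit p], [BLit p])]"
| "id_term (BAnd A B) = (id_term A @ [(Weak_l, B, [A, B], [A])]) @ (id_term B @ [(Weak_l, A, [A, B], [B])]) @
     [(And_r, BAnd A B, [A, B], [BAnd A B]), (And_l, BAnd A B, [BAnd A B], [BAnd A B])]"
| "id_term (BOr A B) = []"

lemma der_id_term: "is_term F \<Longrightarrow> lk.der (id_term F) {#} ({#F#}, {#F#})"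
proof (induction F)
  case (BLit p)
  then show ?case by (simp add: lk_init)
next
  case (BAnd A B)
  then have dt: "depth_two A" "depth_two B" "depth_two (BAnd A B)"
    by (simp_all add: is_dnf_term)
  have 1: "lk.der (id_term A @ [(Weak_l, B, [A, B], [A])]) {#} ({#A, B#}, {#A#})"
    by (rule lk.d_weak_l) (use BAnd dt in simp_all)
  have 2: "lk.der (id_term B @ [(Weak_l, A, [A, B], [B])]) {#} ({#A, B#}, {#B#})"
    by (rule lk.d_weak_l) (use BAnd dt in simp_all)
  have 3: "lk.der ((id_term A @ [(Weak_l, B, [A, B], [A])]) @ (id_term B @ [(Weak_l, A, [A, B], [B])]) @
     [(And_r, BAnd A B, [A, B], [BAnd A B])]) {#} ({#A, B#}, {#BAnd A B#})"
    by (rule lk_and_r[OF 1 2]) (use dt in simp_all)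
  from lk_and_l[OF this, of A B "{#BAnd A B#}"] dt show ?case by simp
qed simp

text \<open>\<open>pre_elim\<close>, \<open>pre_lit\<close> and \<open>pre_intro\<close> are the
  laws of conjunction, two eliminations and the introduction, for a literal distributed by
  \<open>pre\<close>.\<close>

definition pre_elim_term :: "lit \<Rightarrow> bform \<Rightarrow> bform line list" where
  "pre_elim_term l F = (id_term F @ [(Weak_l, BLit l, [BLit l, F], [F])]) @
     [(And_l, BAnd (BLit l) F, [BAnd (BLit l) F], [F])]"

lemma der_pre_elim_term: "is_term F \<Longrightarrow> lk.der (pre_elim_term l F) {#} ({#BAnd (BLit l) F#}, {#F#})"
  unfolding pre_elim_term_def
  by (rule lk_and_l, rule lk.d_weak_l, rule der_id_term) (simp_all add: is_dnf_term)

primrec pre_elim :: "lit \<Rightarrow> bform \<Rightarrow> bform line list" where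
  "pre_elim l (BLit p) = pre_elim_term l (BLit p)"
| "pre_elim l (BAnd A B) = pre_elim_term l (BAnd A B)"
| "pre_elim l (BOr A B) = ((pre_elim l A @ [(Weak_r, B, [pre l A], [A, B])]) @
     (pre_elim l B @ [(Weak_r, A, [pre l B], [A, B])]) @
     [(Or_l, BOr (pre l A) (pre l B), [BOr (pre l A) (pre l B)], [A, B])]) @
     [(Or_r, BOr A B, [BOr (pre l A) (pre l B)], [BOr A B])]"

lemma der_pre_elim: "is_dnf F \<Longrightarrow> lk.der (pre_elim l F) {#} ({#pre l F#}, {#F#})"
proof (induction F)
  case (BOr A B)
  have "lk.der ((pre_elim l A @ [(Weak_r, B, [pre l A], [A, B])]) @
     (pre_elim l B @ [(Weak_r, A, [pre l B], [A, B])]) @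
     [(Or_l, BOr (pre l A) (pre l B), [BOr (pre l A) (pre l B)], [A, B])]) {#}
     ({#BOr (pre l A) (pre l B)#}, {#A, B#})"
    by (rule lk_or_l[OF lk.d_weak_r[where \<Gamma>' = "{#pre l A#}" and \<Delta>' = "{#A, B#}"]
          lk.d_weak_r[where \<Gamma>' = "{#pre l B#}" and \<Delta>' = "{#A, B#}"]]) (use BOr in simp_all)
  then show ?case unfolding pre_elim.simps by (rule lk_or_r) (use BOr.prems in simp_all)
qed (use der_pre_elim_term in auto)

definition pre_lit_term :: "lit \<Rightarrow> bform \<Rightarrow> bform line list" where
  "pre_lit_term l F = ([(Init_id, BLit l, [BLit l], [BLit l])] @ [(Weak_l, F, [BLit l, F], [BLit l])]) @
     [(And_l, BAnd (BLit l) F, [BAnd (BLit l) F], [BLit l])]"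

lemma der_pre_lit_term: "is_term F \<Longrightarrow> lk.der (pre_lit_term l F) {#} ({#BAnd (BLit l) F#}, {#BLit l#})"
  unfolding pre_lit_term_def
  by (rule lk_and_l, rule lk.d_weak_l, rule lk_init(1)) (simp_all add: is_dnf_term)

primrec pre_lit :: "lit \<Rightarrow> bform \<Rightarrow> bform line list" where
  "pre_lit l (BLit p) = pre_lit_term l (BLit p)"
| "pre_lit l (BAnd A B) = pre_lit_term l (BAnd A B)"
| "pre_lit l (BOr A B) = pre_lit l A @ pre_lit l B @
     [(Or_l, BOr (pre l A) (pre l B), [BOr (pre l A) (pre l B)], [BLit l])]"

lemma der_pre_lit: "is_dnf F \<Longrightarrow> lk.der (pre_lit l F) {#} ({#pre l F#}, {#BLit l#})"
proof (induction F)
  case (BOr A B)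
  then have "lk.der (pre_lit l A) {#} ({#pre l A#}, {#BLit l#})"
    "lk.der (pre_lit l B) {#} ({#pre l B#}, {#BLit l#})" by simp_all
  then show ?case unfolding pre_lit.simps pre.simps by (rule lk_or_l) (use BOr in simp_all)
qed (use der_pre_lit_term in auto)

definition pre_intro_term :: "lit \<Rightarrow> bform \<Rightarrow> bform line list" where
  "pre_intro_term l F = ([(Init_id, BLit l, [BLit l], [BLit l])] @ [(Weak_l, F, [BLit l, F], [BLit l])]) @
     (id_term F @ [(Weak_l, BLit l, [BLit l, F], [F])]) @
     [(And_r, BAnd (BLit l) F, [BLit l, F], [BAnd (BLit l) F])]"

lemma der_pre_intro_term:
  "is_term F \<Longrightarrow> lk.der (pre_intro_term l F) {#} ({#BLit l, F#}, {#BAnd (BLit l) F#})"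
  unfolding pre_intro_term_def
  by (rule lk_and_r[OF lk.d_weak_l[OF lk_init(1), where \<Gamma>' = "{#BLit l, F#}" and \<Delta>' = "{#BLit l#}"]
        lk.d_weak_l[OF der_id_term, where \<Gamma>' = "{#BLit l, F#}" and \<Delta>' = "{#F#}"]])
    (simp_all add: is_dnf_term)

primrec pre_intro :: "lit \<Rightarrow> bform \<Rightarrow> bform line list" where
  "pre_intro l (BLit p) = pre_intro_term l (BLit p)"
| "pre_intro l (BAnd A B) = pre_intro_term l (BAnd A B)"
| "pre_intro l (BOr A B) =
     ((pre_intro l A @ [(Weak_r, pre l B, [BLit l, A], [pre l A, pre l B])]) @
     (pre_intro l B @ [(Weak_r, pre l A, [BLit l, B], [pre l A, pre l B])]) @
     [(Or_l, BOr A B, [BLit l, BOr A B], [pre l A, pre l B])]) @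
     [(Or_r, BOr (pre l A) (pre l B), [BLit l, BOr A B], [BOr (pre l A) (pre l B)])]"

lemma der_pre_intro: "is_dnf F \<Longrightarrow> lk.der (pre_intro l F) {#} ({#BLit l, F#}, {#pre l F#})"
proof (induction F)
  case (BOr A B)
  have "lk.der ((pre_intro l A @ [(Weak_r, pre l B, [BLit l, A], [pre l A, pre l B])]) @
     (pre_intro l B @ [(Weak_r, pre l A, [BLit l, B], [pre l A, pre l B])]) @
     [(Or_l, BOr A B, [BLit l, BOr A B], [pre l A, pre l B])]) {#}
     ({#BLit l, BOr A B#}, {#pre l A, pre l B#})"
    by (rule lk_or_l[OF lk.d_weak_r[where \<Gamma>' = "{#BLit l, A#}" and \<Delta>' = "{#pre l A, pre l B#}"]
          lk.d_weak_r[where \<Gamma>' = "{#BLit l, B#}" and \<Delta>' = "{#pre l A, pre l B#}"]])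
      (use BOr in simp_all)
  then show ?case unfolding pre_intro.simps by (rule lk_or_r) (use BOr.prems in simp_all)
qed (use der_pre_intro_term in auto)

section \<open>Path terms and path clauses of a decision tree\<close>

primrec disjuncts :: "bform \<Rightarrow> bform list" where
  "disjuncts (BLit p) = [BLit p]"
| "disjuncts (BAnd A B) = [BAnd A B]"
| "disjuncts (BOr A B) = disjuncts A @ disjuncts B"

primrec split_dnf :: "bform \<Rightarrow> bform line list" where
  "split_dnf (BLit p) = id_term (BLit p)"
| "split_dnf (BAnd A B) = id_term (BAnd A B)"
| "split_dnf (BOr A B) = (split_dnf A @ weaken [] (disjuncts B) [A] (disjuncts A)) @
     (split_dnf B @ weaken [] (disjuncts A) [B] (disjuncts B)) @
     [(Or_l, BOr A B, [BOr A B], disjuncts A @ disjuncts B)]"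

lemma is_term_disjuncts: "is_dnf F \<Longrightarrow> T \<in> set (disjuncts F) \<Longrightarrow> is_term T"
  by (induction F) auto

lemma depth_two_disjuncts [simp]: "is_dnf F \<Longrightarrow> list_all depth_two (disjuncts F)"
  by (simp add: list_all_iff is_term_disjuncts is_dnf_term)

lemma der_split_dnf: "is_dnf F \<Longrightarrow> lk.der (split_dnf F) {#} ({#F#}, mset (disjuncts F))"
proof (induction F)
  case (BOr A B)
  let ?D = "mset (disjuncts A) + mset (disjuncts B)"
  show ?case
    unfolding split_dnf.simps
    by (rule lk_or_l[OF lk.d_weaken[where \<Gamma>' = "{#A#}" and \<Delta>' = ?D]
          lk.d_weaken[where \<Gamma>' = "{#B#}" and \<Delta>' = ?D]]) (use BOr in simp_all)
qed (use der_id_term[of "BLit _"] der_id_term[of "BAnd _ _"] in auto)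

text \<open>An ordered version of \<open>Cls\<close> on \<open>ndt\<close>, the type of formulas
  that the program reads. The empty list for \<open>NOr\<close> is a filler.\<close>

primrec cls :: "ndt \<Rightarrow> bform list" where
  "cls (NLit p) = [BLit p]"
| "cls (NDec B p C) = map (BOr (BLit p)) (cls B) @ map (BOr (BLit (neg p))) (cls C)"
| "cls (NOr B C) = []"

lemma mset_cls: "mset (cls (ndt_of A)) = Cls A"
  by (induction A) auto

lemma mset_disjuncts_pre: "mset (disjuncts (pre l F)) = image_mset (BAnd (BLit l)) (mset (disjuncts F))"
  by (induction F) auto

lemma mset_disjuncts_to_dnf: "mset (disjuncts (to_dnf (ndt_of A))) = Tms A"
  by (induction A) (auto simp: mset_disjuncts_pre)

lemma is_clause_cls: "\<forall>C\<in>set (cls A). is_clause C"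
  by (induction A) auto

lemma depth_two_cls [simp]: "list_all depth_two (cls A)"
  using is_clause_cls[of A] by (auto simp: list_all_iff is_dnf_clause)

text \<open>The context \<open>Ctx\<close> holds the clauses that have already been passed in the recursion and are
  not yet extended.\<close>

fun extend_clauses :: "lit \<times> bform \<times> bform list \<Rightarrow> bform list \<Rightarrow> bform line list" where
  "extend_clauses (p, T, Ctx) [] = []"
| "extend_clauses (p, T, Ctx) (D # Ds) =
     ([(Init_id, BLit p, [BLit p], [BLit p])] @
        weaken (map (BOr (BLit p)) Ds @ Ctx) [T] [BLit p] [BLit p]) @
     extend_clauses (p, T, D # Ctx) Ds @
     [(Or_l, BOr (BLit p) D, BOr (BLit p) D # map (BOr (BLit p)) Ds @ Ctx, [T, BLit p])]"

lemma der_extend_clauses: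
  assumes "\<forall>C\<in>set (Ds @ Ctx). is_clause C" "is_dnf T"
  shows "lk.der (extend_clauses (p, T, Ctx) Ds) {#(mset (Ds @ Ctx), {#T, BLit p#})#}
    (mset (map (BOr (BLit p)) Ds @ Ctx), {#T, BLit p#})"
  using assms
proof (induction Ds arbitrary: Ctx)
  case Nil
  then show ?case
    unfolding extend_clauses.simps
    by (simp add: lk.hyp seq_all_def is_dnf_clause)
next
  case (Cons D Ds)
  let ?G = "mset (map (BOr (BLit p)) Ds @ Ctx)" and ?D = "{#T, BLit p#}"
  have 1: "lk.der (extend_clauses (p, T, D # Ctx) Ds) {#(mset (Ds @ D # Ctx), ?D)#}
      (mset (map (BOr (BLit p)) Ds @ D # Ctx), ?D)"
    by (rule Cons.IH) (use Cons.prems in auto)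
  have 2: "lk.der ([(Init_id, BLit p, [BLit p], [BLit p])] @
      weaken (map (BOr (BLit p)) Ds @ Ctx) [T] [BLit p] [BLit p]) {#} (add_mset (BLit p) ?G, ?D)"
    by (rule lk.d_weaken[OF lk_init(1)]) (use Cons.prems in \<open>auto simp: list_all_iff is_dnf_clause\<close>)
  show ?case
    unfolding extend_clauses.simps
    by (rule lk_or_l[OF 2 1]) (use Cons.prems in \<open>auto simp: is_dnf_clause\<close>)
qed

definition pre_intro_neg :: "lit \<Rightarrow> bform \<Rightarrow> bform line list" where
  "pre_intro_neg p F = [(Init_r, BLit p, [], [BLit p, BLit (neg p)])] @ pre_intro (neg p) F @
     mix_cut (BLit (neg p)) [] [BLit p] [F] [pre (neg p) F]"

lemma der_pre_intro_neg:
  "is_dnf F \<Longrightarrow> lk.der (pre_intro_neg p F) {#} ({#F#}, {#BLit p, pre (neg p) F#})"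
  unfolding pre_intro_neg_def
  by (rule lk.d_mix_cut[OF lk_init(3) der_pre_intro]) simp_all

definition pre_lit_neg :: "lit \<Rightarrow> bform \<Rightarrow> bform line list" where
  "pre_lit_neg p F = pre_lit (neg p) F @ [(Init_l, BLit p, [BLit p, BLit (neg p)], [])] @
     mix_cut (BLit (neg p)) [pre (neg p) F] [] [BLit p] []"

lemma der_pre_lit_neg:
  "is_dnf F \<Longrightarrow> lk.der (pre_lit_neg p F) {#} ({#pre (neg p) F, BLit p#}, {#})"
  unfolding pre_lit_neg_def
  by (rule lk.d_mix_cut[OF der_pre_lit lk_init(2)]) simp_all

text \<open>Disjoining \<open>p\<close> to the clauses is harmless once \<open>p\<close> stands on
  the right, since the branch \<open>p\<close> of each extended clause is then closed. This is why
  \<open>p\<close> is weakened in before the extension.\<close>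

definition cls_der1 :: "ndt \<Rightarrow> lit \<Rightarrow> bform line list" where
  "cls_der1 B p = (let T = to_dnf B; \<Gamma> = map (BOr (BLit p)) (cls B) in
     [(Weak_r, BLit p, cls B, [T, BLit p])] @ extend_clauses (p, T, []) (cls B) @
     pre_intro_neg p T @ mix_cut T \<Gamma> [BLit p] [] [BLit p, pre (neg p) T] @
     [(Contr_r, BLit p, \<Gamma>, [BLit p, pre (neg p) T])])"

text \<open>The extension leaves \<open>neg p\<close> on the right. Cutting it against the initial
  sequent with \<open>p\<close> and \<open>neg p\<close> on the left produces a second
  \<open>p\<close> there, which is contracted.\<close>

definition cls_der2 :: "lit \<Rightarrow> ndt \<Rightarrow> bform line list" where
  "cls_der2 p C = (let T = to_dnf C; \<Gamma> = map (BOr (BLit (neg p))) (cls C) in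
     [(Weak_r, BLit (neg p), cls C, [T, BLit (neg p)])] @ extend_clauses (neg p, T, []) (cls C) @
     pre_intro p T @ mix_cut T \<Gamma> [BLit (neg p)] [BLit p] [pre p T] @
     [(Init_l, BLit p, [BLit p, BLit (neg p)], [])] @
     mix_cut (BLit (neg p)) (\<Gamma> @ [BLit p]) [pre p T] [BLit p] [] @
     [(Contr_l, BLit p, BLit p # \<Gamma>, [pre p T])])"

primrec cls_der :: "ndt \<Rightarrow> bform line list" where
  "cls_der (NLit p) = [(Init_id, BLit p, [BLit p], [BLit p])]"
| "cls_der (NDec B p C) = cls_der B @ cls_der1 B p @ cls_der C @ cls_der2 p C @
     mix_cut (BLit p) (map (BOr (BLit p)) (cls B)) [pre (neg p) (to_dnf B)]
       (map (BOr (BLit (neg p))) (cls C)) [pre p (to_dnf C)] @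
     [(Or_r, to_dnf (NDec B p C), cls (NDec B p C), [to_dnf (NDec B p C)])]"
| "cls_der (NOr B C) = []"

text \<open>Decide \<open>p\<close>. If it is false, the clauses extended by \<open>p\<close> reduce
  to those of the left subtree and give its terms; if it is true, those extended by
  \<open>neg p\<close> do so for the right subtree. These are \<open>cls_der1\<close> and
  \<open>cls_der2\<close>, and a cut on \<open>p\<close> joins them. The result trades translated
  antecedent formulas for the required clauses at the end.\<close>

lemma der_cls_der: "lk.der (cls_der (ndt_of A)) {#} (mset (cls (ndt_of A)), {#to_dnf (ndt_of A)#})"
proof (induction A)
  case (DLit p)
  then show ?case by (simp add: lk_init)
next
  case (DDec B' p C')
  define B C where BC: "B = ndt_of B'" "C = ndt_of C'"
  let ?p = "BLit p" and ?n = "BLit (neg p)"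
  let ?GB = "map (BOr ?p) (cls B)" and ?GC = "map (BOr ?n) (cls C)"
  let ?YB = "pre (neg p) (to_dnf B)" and ?YC = "pre p (to_dnf C)"
  have IH: "lk.der (cls_der B) {#} (mset (cls B), {#to_dnf B#})"
    "lk.der (cls_der C) {#} (mset (cls C), {#to_dnf C#})" using DDec BC by simp_all
  let ?W1 = "cls_der B @ [(Weak_r, ?p, cls B, [to_dnf B, ?p])]"
  let ?L1 = "?W1 @ extend_clauses (p, to_dnf B, []) (cls B)"
  have "lk.der ?W1 {#} (mset (cls B), {#to_dnf B, ?p#})"
    by (rule lk.d_weak_r[OF IH(1)]) simp_all
  from lk.d_trans[OF this der_extend_clauses[of "cls B" "[]", simplified]]
  have "lk.der ?L1 {#} (mset ?GB, {#to_dnf B, ?p#})" by (simp add: is_clause_cls)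
  from lk.d_mix_cut[OF this der_pre_intro_neg[of "to_dnf B" p], of ?GB "to_dnf B" "[?p]" "[]" "[?p, ?YB]"]
  have "lk.der (?L1 @ pre_intro_neg p (to_dnf B) @ mix_cut (to_dnf B) ?GB [?p] [] [?p, ?YB]) {#}
      (mset ?GB, {#?p, ?p, ?YB#})"
    by simp
  from lk.d_contr_r[OF this, of ?p "{#?p, ?YB#}" "mset ?GB" ?GB "[?p, ?YB]"]
  have 1: "lk.der (cls_der B @ cls_der1 B p) {#} (mset ?GB, {#?p, ?YB#})"
    by (simp add: cls_der1_def Let_def)
  let ?W2 = "cls_der C @ [(Weak_r, ?n, cls C, [to_dnf C, ?n])]"
  let ?L2 = "?W2 @ extend_clauses (neg p, to_dnf C, []) (cls C)"
  let ?L3 = "?L2 @ pre_intro p (to_dnf C) @ mix_cut (to_dnf C) ?GC [?n] [?p] [?YC]"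
  have "lk.der ?W2 {#} (mset (cls C), {#to_dnf C, ?n#})"
    by (rule lk.d_weak_r[OF IH(2)]) simp_all
  from lk.d_trans[OF this der_extend_clauses[of "cls C" "[]", simplified]]
  have "lk.der ?L2 {#} (mset ?GC, {#to_dnf C, ?n#})" by (simp add: is_clause_cls)
  from lk.d_mix_cut[OF this der_pre_intro[of "to_dnf C" p], of ?GC "to_dnf C" "[?n]" "[?p]" "[?YC]"]
  have "lk.der ?L3 {#} (mset (?GC @ [?p]), {#?n, ?YC#})"
    by (simp add: add_mset_commute)
  from lk.d_mix_cut[OF this lk_init(2)[of "[?p, ?n]" p "[]", simplified], of "?GC @ [?p]" ?n "[?YC]" "[?p]" "[]"]
  have "lk.der (?L3 @ [(Init_l, ?p, [?p, ?n], [])] @ mix_cut ?n (?GC @ [?p]) [?YC] [?p] []) {#}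
      (add_mset ?p (add_mset ?p (mset ?GC)), {#?YC#})"
    by (simp add: add_mset_commute)
  from lk.d_contr_l[OF this, of ?p "mset (?p # ?GC)" "{#?YC#}" "?p # ?GC" "[?YC]"]
  have 2: "lk.der (cls_der C @ cls_der2 p C) {#} (mset (?p # ?GC), {#?YC#})"
    by (simp add: cls_der2_def Let_def)
  from lk.d_mix_cut[OF 1 2, of ?GB ?p "[?YB]" ?GC "[?YC]"]
  have "lk.der (cls_der B @ cls_der1 B p @ cls_der C @ cls_der2 p C @ mix_cut ?p ?GB [?YB] ?GC [?YC]) {#}
      (mset (?GB @ ?GC), {#?YB, ?YC#})" by simp
  from lk_or_r[OF this, of ?YB ?YC "{#BOr ?YB ?YC#}" "mset (?GB @ ?GC)" "?GB @ ?GC" "[BOr ?YB ?YC]"]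
  show ?case by (simp flip: BC)
qed

subsection \<open>Inferences\<close>

text \<open>\<open>Y\<close> yields \<open>a\<close> and refutes \<open>p\<close>, while
  \<open>Z\<close> yields \<open>b\<close> and \<open>p\<close>. It is \<open>Y\<close> and
  \<open>Z\<close> that get used twice and contracted, whereas each premise enters one cut. An empty
  list among the appended ones stands for a premise that is already pending.\<close>

definition dec_l_block :: "bform \<Rightarrow> lit \<Rightarrow> bform \<Rightarrow> bform list \<Rightarrow> bform list \<Rightarrow> bform line list" where
  "dec_l_block a p b G D = (let Y = pre (neg p) a; Z = pre p b in
     (((pre_elim (neg p) a @ [] @ mix_cut a [Y] [] G (BLit p # D)) @ pre_lit_neg p a @
       mix_cut (BLit p) (Y # G) D [Y] []) @ [(Contr_l, Y, Y # G, D)]) @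
     ((pre_lit p b @ (pre_elim p b @ [] @ mix_cut b [Z] [] (BLit p # G) D) @
       mix_cut (BLit p) [Z] [] (Z # G) D) @ [(Contr_l, Z, Z # G, D)]) @
     [(Or_l, BOr Y Z, BOr Y Z # G, D)])"

lemma der_dec_l_block:
  assumes "is_dnf a" "is_dnf b" "list_all depth_two (G @ D)"
  shows "lk.der (dec_l_block a p b G D)
    {#(add_mset a (mset G), add_mset (BLit p) (mset D)), (add_mset (BLit p) (add_mset b (mset G)), mset D)#}
    (add_mset (BOr (pre (neg p) a) (pre p b)) (mset G), mset D)"
proof -
  let ?p = "BLit p" and ?Y = "pre (neg p) a" and ?Z = "pre p b"
  let ?S1 = "(add_mset a (mset G), add_mset ?p (mset D))"
  let ?S2 = "(add_mset ?p (add_mset b (mset G)), mset D)"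
  have S: "seq_all depth_two ?S1" "seq_all depth_two ?S2"
    using assms by (simp_all add: lk.list_all_ok)
  let ?L1 = "pre_elim (neg p) a @ [] @ mix_cut a [?Y] [] G (?p # D)"
  let ?L2 = "pre_elim p b @ [] @ mix_cut b [?Z] [] (?p # G) D"
  let ?M1 = "?L1 @ pre_lit_neg p a @ mix_cut ?p (?Y # G) D [?Y] []"
  let ?M2 = "pre_lit p b @ ?L2 @ mix_cut ?p [?Z] [] (?Z # G) D"
  have "lk.der ?L1 {#?S1#} (mset (?Y # G), mset (?p # D))"
    by (rule lk.d_mix_cut[OF der_pre_elim lk.hyp[OF S(1)]]) (use assms in simp_all)
  from lk.d_mix_cut[OF this der_pre_lit_neg[of a p], of "?Y # G" ?p D "[?Y]" "[]"] assms(1)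
  have "lk.der ?M1 {#?S1#} (mset (?Y # ?Y # G), mset D)" by (simp add: add_mset_commute)
  from lk.d_contr_l[OF this, of ?Y "mset (?Y # G)" "mset D" "?Y # G" D]
  have 1: "lk.der (?M1 @ [(Contr_l, ?Y, ?Y # G, D)]) {#?S1#} (mset (?Y # G), mset D)" by simp
  have 2: "lk.der ?L2 {#?S2#} (mset (?Z # ?p # G), mset D)"
    by (rule lk.d_mix_cut[OF der_pre_elim lk.hyp[OF S(2)]]) (use assms in simp_all)
  from lk.d_mix_cut[OF der_pre_lit[of b p] 2, of "[?Z]" ?p "[]" "?Z # G" D] assms(2)
  have "lk.der ?M2 {#?S2#} (mset (?Z # ?Z # G), mset D)" by (simp add: add_mset_commute)
  from lk.d_contr_l[OF this, of ?Z "mset (?Z # G)" "mset D" "?Z # G" D]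
  have 2: "lk.der (?M2 @ [(Contr_l, ?Z, ?Z # G, D)]) {#?S2#} (mset (?Z # G), mset D)" by simp
  show ?thesis unfolding dec_l_block_def Let_def
    by (rule lk_or_l[OF 1 2]) (use assms in simp_all)
qed

text \<open>The first premise gives \<open>Y\<close> or \<open>p\<close>, the second gives
  \<open>Z\<close> from \<open>p\<close>; both make a second copy of \<open>p\<close>, which is
  contracted. The closing cut on \<open>p\<close> shares its context, so each side is weakened by
  the disjunct of the other.\<close>

definition dec_r_block :: "bform \<Rightarrow> lit \<Rightarrow> bform \<Rightarrow> bform list \<Rightarrow> bform list \<Rightarrow> bform line list" where
  "dec_r_block a p b G D = (let Y = pre (neg p) a; Z = pre p b in
     (((([] @ pre_intro_neg p a @ mix_cut a G (BLit p # D) [] [BLit p, Y]) @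
       [(Contr_r, BLit p, G, BLit p # Y # D)]) @ [(Weak_r, Z, G, BLit p # Y # Z # D)]) @
     ((([] @ pre_intro p b @ mix_cut b (BLit p # G) D [BLit p] [Z]) @
       [(Contr_l, BLit p, BLit p # G, Z # D)]) @ [(Weak_r, Y, BLit p # G, Y # Z # D)]) @
     [(Cut, BLit p, G, Y # Z # D)]) @
     [(Or_r, BOr Y Z, G, BOr Y Z # D)])"

lemma der_dec_r_block:
  assumes "is_dnf a" "is_dnf b" "list_all depth_two (G @ D)"
  shows "lk.der (dec_r_block a p b G D)
    {#(mset G, add_mset a (add_mset (BLit p) (mset D))), (add_mset (BLit p) (mset G), add_mset b (mset D))#}
    (mset G, add_mset (BOr (pre (neg p) a) (pre p b)) (mset D))"
proof -
  let ?p = "BLit p" and ?Y = "pre (neg p) a" and ?Z = "pre p b"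
  let ?S1 = "(mset G, add_mset a (add_mset ?p (mset D)))"
  let ?S2 = "(add_mset ?p (mset G), add_mset b (mset D))"
  have S: "seq_all depth_two ?S1" "seq_all depth_two ?S2"
    using assms by (simp_all add: lk.list_all_ok)
  let ?L1 = "[] @ pre_intro_neg p a @ mix_cut a G (?p # D) [] [?p, ?Y]"
  let ?L2 = "[] @ pre_intro p b @ mix_cut b (?p # G) D [?p] [?Z]"
  let ?M1 = "?L1 @ [(Contr_r, ?p, G, ?p # ?Y # D)]" and ?M2 = "?L2 @ [(Contr_l, ?p, ?p # G, ?Z # D)]"
  have "lk.der ?L1 {#?S1#} (mset G, mset (?p # ?p # ?Y # D))"
    by (rule lk.d_mix_cut[OF lk.hyp[OF S(1)] der_pre_intro_neg]) (use assms in simp_all)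
  from lk.d_contr_r[OF this, of ?p "mset (?p # ?Y # D)" "mset G" G "?p # ?Y # D"]
  have "lk.der ?M1 {#?S1#} (mset G, mset (?p # ?Y # D))" by simp
  from lk.d_weak_r[OF this, of ?Z "mset G" "mset (?p # ?Y # ?Z # D)" G "?p # ?Y # ?Z # D"] assms(2)
  have 1: "lk.der (?M1 @ [(Weak_r, ?Z, G, ?p # ?Y # ?Z # D)]) {#?S1#} (mset G, mset (?p # ?Y # ?Z # D))"
    by (simp add: add_mset_commute)
  have "lk.der ?L2 {#?S2#} (mset (?p # ?p # G), mset (?Z # D))"
    by (rule lk.d_mix_cut[OF lk.hyp[OF S(2)] der_pre_intro]) (use assms in simp_all)
  from lk.d_contr_l[OF this, of ?p "mset (?p # G)" "mset (?Z # D)" "?p # G" "?Z # D"]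
  have "lk.der ?M2 {#?S2#} (mset (?p # G), mset (?Z # D))" by simp
  from lk.d_weak_r[OF this, of ?Y "mset (?p # G)" "mset (?Y # ?Z # D)" "?p # G" "?Y # ?Z # D"] assms(1)
  have 2: "lk.der (?M2 @ [(Weak_r, ?Y, ?p # G, ?Y # ?Z # D)]) {#?S2#} (mset (?p # G), mset (?Y # ?Z # D))"
    by simp
  from lk.d_cut[OF 1 2, of ?p "mset (?Y # ?Z # D)" "mset G" G "?Y # ?Z # D"]
  show ?thesis unfolding dec_r_block_def Let_def
    by (intro lk_or_r) (use assms in \<open>simp_all add: add_mset_commute\<close>)
qed


section \<open>Simulation of one LNDT line\<close>

lemmas lk_intros = lk.intros[simplified]

definition dnf_seq :: "ndt sequent \<Rightarrow> bform sequent" where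
  "dnf_seq S = (image_mset to_dnf (fst S), image_mset to_dnf (snd S))"

text \<open>Apart from decisions, the rules of LNDT are rules of LK under the same names, so one
  line suffices. For a decision, removing one copy of the principal formula from the conclusion
  recovers the context.\<close>

definition lndt_block :: "ndt line \<Rightarrow> bform line list" where
  "lndt_block l = (let r = fst l; A = fst (snd l); \<Gamma> = fst (snd (snd l)); \<Delta> = snd (snd (snd l)) in
     case A of
       NLit p \<Rightarrow> [(r, to_dnf A, map to_dnf \<Gamma>, map to_dnf \<Delta>)]
     | NDec B p C \<Rightarrow>
         if r = Dec_l then
           dec_l_block (to_dnf B) p (to_dnf C) (map to_dnf (remove1 A \<Gamma>)) (map to_dnf \<Delta>)
         else if r = Dec_r then
           dec_r_block (to_dnf B) p (to_dnf C) (map to_dnf \<Gamma>) (map to_dnf (remove1 A \<Delta>))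
         else [(r, to_dnf A, map to_dnf \<Gamma>, map to_dnf \<Delta>)]
     | NOr B C \<Rightarrow> [(r, to_dnf A, map to_dnf \<Gamma>, map to_dnf \<Delta>)])"

lemma seq_all_dnf_seq: "seq_all depth_two (dnf_seq S)"
  by (auto simp: seq_all_def dnf_seq_def)

lemma lndt_block_sim:
  assumes "lndt (fst l) (fst (snd l)) Ss (seq_of l)"
  shows "consumes two_lk (lndt_block l) (image_mset dnf_seq (mset Ss)) {#dnf_seq (seq_of l)#} \<and>
    lndt_block l \<noteq> []"
proof -
  obtain r A \<Gamma> \<Delta> where l: "l = (r, A, \<Gamma>, \<Delta>)" by (cases l) auto
  let ?L = "[(r, to_dnf A, map to_dnf \<Gamma>, map to_dnf \<Delta>)]"
  have ss: "list_all (seq_all depth_two) (map dnf_seq Ss)" for Ss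
    by (simp add: list_all_iff seq_all_dnf_seq)
  have dt: "list_all depth_two (map to_dnf xs)" for xs
    by (simp add: list_all_iff)
  have map_remove1: "mset (map to_dnf (remove1 A xs)) = image_mset to_dnf (mset xs - {#A#})" for xs
    by simp
  have direct: ?thesis if "lk r (to_dnf A) (map dnf_seq Ss) (dnf_seq (mset \<Gamma>, mset \<Delta>))"
    "lndt_block l = ?L"
    using that ss[of Ss] seq_all_dnf_seq[of "(mset \<Gamma>, mset \<Delta>)"]
    by (auto simp: l two_lk_iff dnf_seq_def intro!: exI[of _ "map dnf_seq Ss"])
  from assms have "lndt r A Ss (mset \<Gamma>, mset \<Delta>)" by (simp add: l)
  then show ?thesis
  proof cases
    case (9 B p C \<Gamma>')
    have "mset (map to_dnf (remove1 A \<Gamma>)) = image_mset to_dnf \<Gamma>'"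
      unfolding map_remove1 using 9 by simp
    with der_dec_l_block[of "to_dnf B" "to_dnf C" "map to_dnf (remove1 A \<Gamma>)" "map to_dnf \<Delta>" p] 9
    show ?thesis
      by (simp add: lndt_block_def l dnf_seq_def derives_def dt) (simp add: dec_l_block_def Let_def)
  next
    case (10 B p C \<Delta>')
    have "mset (map to_dnf (remove1 A \<Delta>)) = image_mset to_dnf \<Delta>'"
      unfolding map_remove1 using 10 by simp
    with der_dec_r_block[of "to_dnf B" "to_dnf C" "map to_dnf \<Gamma>" "map to_dnf (remove1 A \<Delta>)" p] 10
    show ?thesis
      by (simp add: lndt_block_def l dnf_seq_def derives_def dt) (simp add: dec_r_block_def Let_def)
  qed ((rule direct; force simp: dnf_seq_def lndt_block_def l split: ndt.split intro: lk_intros)+)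
qed


section \<open>The cedents of the end sequent\<close>

fun conv_l :: "bform list \<times> ndt list \<Rightarrow> ndt list \<Rightarrow> bform line list" where
  "conv_l (D, Ctx) [] = []"
| "conv_l (D, Ctx) (A # As) = cls_der A @ conv_l (D, A # Ctx) As @
     mix_cut (to_dnf A) (cls A) [] (concat (map cls As) @ map to_dnf Ctx) D"

fun conv_r :: "bform list \<times> ndt list \<Rightarrow> ndt list \<Rightarrow> bform line list" where
  "conv_r (G, Ctx) [] = []"
| "conv_r (G, Ctx) (B # Bs) = conv_r (G, B # Ctx) Bs @ split_dnf (to_dnf B) @
     mix_cut (to_dnf B) G (concat (map (\<lambda>B. disjuncts (to_dnf B)) Bs) @ map to_dnf Ctx) []
       (disjuncts (to_dnf B))"

text \<open>The formulas after \<open>A\<close> are converted first, while \<open>A\<close> waits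
  unconverted in \<open>Ctx\<close>; the cut on \<open>A\<close> comes last. Thus the pending
  sequent is threaded through once. Only for images of DT formulas do the clauses imply the
  translated formula.\<close>

lemma der_conv_l:
  assumes "\<forall>A\<in>set As. A \<in> range ndt_of" "list_all depth_two D"
  shows "lk.der (conv_l (D, Ctx) As) {#(mset (map to_dnf (As @ Ctx)), mset D)#}
    (mset (concat (map cls As) @ map to_dnf Ctx), mset D)"
  using assms
proof (induction As arbitrary: Ctx)
  case Nil
  then show ?case
    unfolding conv_l.simps by (simp add: lk.hyp lk.list_all_ok list_all_iff flip: mset_map)
next
  case (Cons A As)
  from Cons.prems obtain A' where A: "A = ndt_of A'" by auto
  have IH: "lk.der (conv_l (D, A # Ctx) As) {#(mset (map to_dnf (As @ A # Ctx)), mset D)#}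
    (mset (concat (map cls As) @ map to_dnf (A # Ctx)), mset D)"
    by (rule Cons.IH) (use Cons.prems in auto)
  show ?case
    unfolding conv_l.simps
    by (rule lk.d_mix_cut[OF der_cls_der[of A', folded A] IH]) simp_all
qed

lemma der_conv_r:
  assumes "list_all depth_two G"
  shows "lk.der (conv_r (G, Ctx) Bs) {#(mset G, mset (map to_dnf (Bs @ Ctx)))#}
    (mset G, mset (concat (map (\<lambda>B. disjuncts (to_dnf B)) Bs) @ map to_dnf Ctx))"
  using assms
proof (induction Bs arbitrary: Ctx)
  case Nil
  then show ?case
    unfolding conv_r.simps by (simp add: lk.hyp lk.list_all_ok list_all_iff flip: mset_map)
next
  case (Cons B Bs)
  have IH: "lk.der (conv_r (G, B # Ctx) Bs) {#(mset G, mset (map to_dnf (Bs @ B # Ctx)))#}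
    (mset G, mset (concat (map (\<lambda>B. disjuncts (to_dnf B)) Bs) @ map to_dnf (B # Ctx)))"
    by (rule Cons.IH) (use Cons.prems in auto)
  show ?case
    unfolding conv_r.simps
    by (rule lk.d_mix_cut[OF IH der_split_dnf[of "to_dnf B"]]) simp_all
qed

definition lndt_final :: "ndt line \<Rightarrow> bform line list" where
  "lndt_final l = conv_l (map to_dnf (snd (snd (snd l))), []) (fst (snd (snd l))) @
     conv_r (concat (map cls (fst (snd (snd l)))), []) (snd (snd (snd l)))"

definition lndt_to_lk :: "ndt line list \<Rightarrow> bform line list" where
  "lndt_to_lk \<pi> = concat (map lndt_block \<pi>) @ lndt_final (last \<pi>)"

lemma lndt_to_lk_correct:
  assumes "proof_of lndt sh \<pi> (mset (map ndt_of As), mset (map ndt_of Bs))"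
  shows "proof_of two_lk sh (lndt_to_lk \<pi>) (sum_list (map Cls As), sum_list (map Tms Bs))"
  unfolding lndt_to_lk_def
proof (rule proof_of_transform[OF assms lndt_block_sim])
  obtain r A \<Gamma> \<Delta> where l: "last \<pi> = (r, A, \<Gamma>, \<Delta>)" by (cases "last \<pi>") auto
  \<comment> \<open>The program sees the cedents in the order of the last line, which agrees with
    \<open>As\<close> and \<open>Bs\<close> only up to permutation; hence the comparison of sums of
    multisets below.\<close>
  with assms have m: "mset \<Gamma> = mset (map ndt_of As)" "mset \<Delta> = mset (map ndt_of Bs)"
    unfolding proof_of_def by auto
  have "set \<Gamma> = set (map ndt_of As)" using mset_eq_setD[OF m(1)] .
  then have "lk.der (conv_l (map to_dnf \<Delta>, []) \<Gamma>) {#(mset (map to_dnf \<Gamma>), mset (map to_dnf \<Delta>))#}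
      (mset (concat (map cls \<Gamma>)), mset (map to_dnf \<Delta>))"
    using der_conv_l[of \<Gamma> "map to_dnf \<Delta>" "[]"] by (auto simp: list_all_iff)
  moreover have "lk.der (conv_r (concat (map cls \<Gamma>), []) \<Delta>)
      {#(mset (concat (map cls \<Gamma>)), mset (map to_dnf \<Delta>))#}
      (mset (concat (map cls \<Gamma>)), mset (concat (map (\<lambda>B. disjuncts (to_dnf B)) \<Delta>)))"
    using der_conv_r[of "concat (map cls \<Gamma>)" "[]" \<Delta>] depth_two_cls by (auto simp: list_all_iff)
  moreover have "mset (concat (map cls \<Gamma>)) = sum_list (map Cls As)"
  proof -
    have "mset (concat (map cls \<Gamma>)) = (\<Sum>A\<in>#mset \<Gamma>. mset (cls A))"
      by (simp add: mset_concat sum_mset_sum_list flip: mset_map) (simp add: comp_def)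
    then show ?thesis unfolding m(1)
      by (simp add: sum_mset_sum_list mset_cls comp_def flip: mset_map)
  qed
  moreover have "mset (concat (map (\<lambda>B. disjuncts (to_dnf B)) \<Delta>)) = sum_list (map Tms Bs)"
  proof -
    have "mset (concat (map (\<lambda>B. disjuncts (to_dnf B)) \<Delta>)) = (\<Sum>B\<in>#mset \<Delta>. mset (disjuncts (to_dnf B)))"
      by (simp add: mset_concat sum_mset_sum_list flip: mset_map) (simp add: comp_def)
    then show ?thesis unfolding m(2)
      by (simp add: sum_mset_sum_list mset_disjuncts_to_dnf comp_def flip: mset_map)
  qed
  ultimately show "consumes two_lk (lndt_final (last \<pi>))
      {#dnf_seq (mset (map ndt_of As), mset (map ndt_of Bs))#} {#(sum_list (map Cls As), sum_list (map Tms Bs))#}"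
    using m unfolding lndt_final_def l derives_def consumes_append dnf_seq_def by auto
qed

subsection \<open>Running time\<close>

text \<open>The recursion schemes carry a parameter; for functions without one it is filled with a
  Boolean constant.\<close>

lemma ptime_snd_app: "ptime (\<lambda>p :: bool \<times> 'a::encodable. f (snd p)) \<Longrightarrow> ptime g \<Longrightarrow> ptime (\<lambda>x. f (g x))"
  using ptime_app[OF _ ptime_pair[OF ptime_const[of True]], of "\<lambda>p. f (snd p)" g] by simp

lemma ptime_pre [ptime_intros]: "ptime f \<Longrightarrow> ptime g \<Longrightarrow> ptime (\<lambda>x. pre (f x) (g x))"
  by (rule ptime_app2, rule ptime_rec_bform[where g = "\<lambda>l p. BAnd (BLit l) (BLit p)"
        and h = "\<lambda>l A B a b. BAnd (BLit l) (BAnd A B)" and k = "\<lambda>l A B a b. BOr a b"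
        and c = "BLit (Pos 0)"]) (auto intro!: ptime_intros)

lemma ptime_disjuncts [ptime_intros]: "ptime f \<Longrightarrow> ptime (\<lambda>x. disjuncts (f x))"
  by (rule ptime_snd_app[of disjuncts], rule ptime_rec_bform[where g = "\<lambda>v p. [BLit p]"
        and h = "\<lambda>v A B a b. [BAnd A B]" and k = "\<lambda>v A B a b. a @ b"
        and c = "[]"]) (auto intro!: ptime_intros)

text \<open>Each disjunct gains a literal, of size 5, and a conjunction, of size 3.\<close>

lemma vsz_pre: "vsz (pre l F) = vsz F + 8 * length (disjuncts F)"
  by (induction F) auto

lemma disjuncts_pre [simp]: "length (disjuncts (pre l F)) = length (disjuncts F)"
  by (induction F) auto

lemma length_to_dnf: "length (disjuncts (to_dnf A)) \<le> vsz A"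
  by (induction A) auto

text \<open>A decision adds 8 for each disjunct below it, and by \<open>length_to_dnf\<close> there
  are at most as many disjuncts as the code has nodes. The growth per step is thus linear in the
  decided formula, and a list of nine copies of it is a convenient bound.\<close>

lemma ptime_to_dnf [ptime_intros]: "ptime f \<Longrightarrow> ptime (\<lambda>x. to_dnf (f x))"
proof (rule ptime_snd_app[of to_dnf], rule ptime_rec_ndt[where g = "\<lambda>v p. BLit p"
        and h = "\<lambda>v A p B a b. BOr (pre (neg p) a) (pre p b)" and k = "\<lambda>v A B a b. BOr a b"
        and e = "\<lambda>y. [snd y, snd y, snd y, snd y, snd y, snd y, snd y, snd y, snd y]"])
  fix v A p B
  show "vsz (BOr (pre (neg p) (to_dnf A)) (pre p (to_dnf B))) \<le> vsz (to_dnf A) + vsz (to_dnf B) +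
      vsz [snd (v :: bool, NDec A p B), snd (v, NDec A p B), snd (v, NDec A p B), snd (v, NDec A p B),
        snd (v, NDec A p B), snd (v, NDec A p B), snd (v, NDec A p B), snd (v, NDec A p B), snd (v, NDec A p B)]"
    using length_to_dnf[of A] length_to_dnf[of B] by (simp add: vsz_pre)
qed (auto intro!: ptime_intros)

lemma ptime_id_term [ptime_intros]: "ptime f \<Longrightarrow> ptime (\<lambda>x. id_term (f x))"
  by (rule ptime_snd_app[of id_term], rule ptime_rec_bform[where g = "\<lambda>v p. [(Init_id, BLit p, [BLit p], [BLit p])]"
        and h = "\<lambda>v A B a b. (a @ [(Weak_l, B, [A, B], [A])]) @ (b @ [(Weak_l, A, [A, B], [B])]) @
          [(And_r, BAnd A B, [A, B], [BAnd A B]), (And_l, BAnd A B, [BAnd A B], [BAnd A B])]"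
        and k = "\<lambda>v A B a b. []"
        and c = "[]"])
    (auto intro!: ptime_intros)


lemma ptime_pre_elim [ptime_intros]: "ptime f \<Longrightarrow> ptime g \<Longrightarrow> ptime (\<lambda>x. pre_elim (f x) (g x))"
proof (rule ptime_app2[of pre_elim])
  have [ptime_intros]: "ptime f \<Longrightarrow> ptime g \<Longrightarrow> ptime (\<lambda>x. pre_elim_term (f x) (g x))"
    for f :: "'c::encodable \<Rightarrow> lit" and g unfolding pre_elim_term_def by (intro ptime_intros)
  show "ptime (\<lambda>p. pre_elim (fst p) (snd p))"
    by (rule ptime_rec_bform[where g = "\<lambda>l p. pre_elim_term l (BLit p)" and
        h = "\<lambda>l A B a b. pre_elim_term l (BAnd A B)" and
        k = "\<lambda>l A B a b. ((a @ [(Weak_r, B, [pre l A], [A, B])]) @ (b @ [(Weak_r, A, [pre l B], [A, B])]) @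
          [(Or_l, BOr (pre l A) (pre l B), [BOr (pre l A) (pre l B)], [A, B])]) @
          [(Or_r, BOr A B, [BOr (pre l A) (pre l B)], [BOr A B])]" and
        c = "[]"])
      (auto intro!: ptime_intros)
qed

lemma ptime_pre_lit [ptime_intros]: "ptime f \<Longrightarrow> ptime g \<Longrightarrow> ptime (\<lambda>x. pre_lit (f x) (g x))"
proof (rule ptime_app2[of pre_lit])
  have [ptime_intros]: "ptime f \<Longrightarrow> ptime g \<Longrightarrow> ptime (\<lambda>x. pre_lit_term (f x) (g x))"
    for f :: "'c::encodable \<Rightarrow> lit" and g unfolding pre_lit_term_def by (intro ptime_intros)
  show "ptime (\<lambda>p. pre_lit (fst p) (snd p))"
    by (rule ptime_rec_bform[where g = "\<lambda>l p. pre_lit_term l (BLit p)" and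
        h = "\<lambda>l A B a b. pre_lit_term l (BAnd A B)" and
        k = "\<lambda>l A B a b. a @ b @ [(Or_l, BOr (pre l A) (pre l B), [BOr (pre l A) (pre l B)], [BLit l])]" and
        c = "[]"])
      (auto intro!: ptime_intros)
qed

lemma ptime_pre_intro [ptime_intros]: "ptime f \<Longrightarrow> ptime g \<Longrightarrow> ptime (\<lambda>x. pre_intro (f x) (g x))"
proof (rule ptime_app2[of pre_intro])
  have [ptime_intros]: "ptime f \<Longrightarrow> ptime g \<Longrightarrow> ptime (\<lambda>x. pre_intro_term (f x) (g x))"
    for f :: "'c::encodable \<Rightarrow> lit" and g unfolding pre_intro_term_def by (intro ptime_intros)
  show "ptime (\<lambda>p. pre_intro (fst p) (snd p))"
    by (rule ptime_rec_bform[where g = "\<lambda>l p. pre_intro_term l (BLit p)" and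
        h = "\<lambda>l A B a b. pre_intro_term l (BAnd A B)" and
        k = "\<lambda>l A B a b. ((a @ [(Weak_r, pre l B, [BLit l, A], [pre l A, pre l B])]) @
          (b @ [(Weak_r, pre l A, [BLit l, B], [pre l A, pre l B])]) @
          [(Or_l, BOr A B, [BLit l, BOr A B], [pre l A, pre l B])]) @
          [(Or_r, BOr (pre l A) (pre l B), [BLit l, BOr A B], [BOr (pre l A) (pre l B)])]" and
        c = "[]"])
      (auto intro!: ptime_intros)
qed

lemma ptime_split_dnf [ptime_intros]: "ptime f \<Longrightarrow> ptime (\<lambda>x. split_dnf (f x))"
  by (rule ptime_snd_app[of split_dnf], rule ptime_rec_bform[where g = "\<lambda>v p. id_term (BLit p)" and
        h = "\<lambda>v A B a b. id_term (BAnd A B)" and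
        k = "\<lambda>v A B a b. (a @ weaken [] (disjuncts B) [A] (disjuncts A)) @
          (b @ weaken [] (disjuncts A) [B] (disjuncts B)) @
          [(Or_l, BOr A B, [BOr A B], disjuncts A @ disjuncts B)]" and
        c = "[]"])
    (auto intro!: ptime_intros)

lemma length_cls: "length (cls A) \<le> vsz A"
  by (induction A) auto

lemma vsz_map_BOr: "vsz (map (BOr (BLit p)) xs) = vsz xs + 8 * length xs"
  by (induction xs) auto

lemma ptime_cls [ptime_intros]: "ptime f \<Longrightarrow> ptime (\<lambda>x. cls (f x))"
proof (rule ptime_snd_app[of cls], rule ptime_rec_ndt[where g = "\<lambda>v p. [BLit p]" and
        h = "\<lambda>v B p C b c. map (BOr (BLit p)) b @ map (BOr (BLit (neg p))) c" and
        k = "\<lambda>v B C b c. []" and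
        e = "\<lambda>y. [snd y, snd y, snd y, snd y, snd y, snd y, snd y, snd y, snd y]"])
  fix v A p B
  show "vsz (map (BOr (BLit p)) (cls A) @ map (BOr (BLit (neg p))) (cls B)) \<le> vsz (cls A) + vsz (cls B) +
      vsz [snd (v :: bool, NDec A p B), snd (v, NDec A p B), snd (v, NDec A p B), snd (v, NDec A p B),
        snd (v, NDec A p B), snd (v, NDec A p B), snd (v, NDec A p B), snd (v, NDec A p B), snd (v, NDec A p B)]"
    using length_cls[of A] length_cls[of B] by (simp add: vsz_map_BOr)
qed (auto intro!: ptime_intros)

lemma ptime_extend_clauses [ptime_intros]:
  assumes "ptime f" "ptime g"
  shows "ptime (\<lambda>x. extend_clauses (f x) (g x))"
proof (rule ptime_app2[of extend_clauses, OF _ assms], rule ptime_rec_list[where g = "\<lambda>v. []" and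
      h = "\<lambda>v D Ds r. ([(Init_id, BLit (fst v), [BLit (fst v)], [BLit (fst v)])] @
        weaken (map (BOr (BLit (fst v))) Ds @ snd (snd v)) [fst (snd v)] [BLit (fst v)] [BLit (fst v)]) @
        r @ [(Or_l, BOr (BLit (fst v)) D, BOr (BLit (fst v)) D # map (BOr (BLit (fst v))) Ds @ snd (snd v),
          [fst (snd v), BLit (fst v)])]" and
      u = "\<lambda>v D. (fst v, fst (snd v), D # snd (snd v))" and
      c = "[]"])
qed (auto intro!: ptime_intros)

text \<open>Sizes of appended proofs add up, so \<open>e\<close> is \<open>h\<close> with the two
  recursive proofs left out.\<close>

lemma ptime_cls_der [ptime_intros]: "ptime f \<Longrightarrow> ptime (\<lambda>x. cls_der (f x))"
proof (rule ptime_snd_app[of cls_der])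
  have 1: "ptime (\<lambda>p. cls_der1 (fst p) (snd p))"
    unfolding cls_der1_def pre_intro_neg_def Let_def by (intro ptime_intros)
  have 2: "ptime (\<lambda>p. cls_der2 (fst p) (snd p))"
    unfolding cls_der2_def Let_def by (intro ptime_intros)
  note [ptime_intros] = ptime_app2[OF 1] ptime_app2[OF 2]
  show "ptime (\<lambda>p :: bool \<times> ndt. cls_der (snd p))"
    by (rule ptime_rec_ndt[where g = "\<lambda>v p. [(Init_id, BLit p, [BLit p], [BLit p])]" and
        h = "\<lambda>v B p C b c. b @ cls_der1 B p @ c @ cls_der2 p C @
          mix_cut (BLit p) (map (BOr (BLit p)) (cls B)) [pre (neg p) (to_dnf B)]
            (map (BOr (BLit (neg p))) (cls C)) [pre p (to_dnf C)] @
          [(Or_r, to_dnf (NDec B p C), cls (NDec B p C), [to_dnf (NDec B p C)])]" and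
        k = "\<lambda>v B C b c. []" and e = "\<lambda>y. case snd y of NLit p \<Rightarrow> []
        | NDec B p C \<Rightarrow> cls_der1 B p @ cls_der2 p C @
            mix_cut (BLit p) (map (BOr (BLit p)) (cls B)) [pre (neg p) (to_dnf B)]
              (map (BOr (BLit (neg p))) (cls C)) [pre p (to_dnf C)] @
            [(Or_r, to_dnf (NDec B p C), cls (NDec B p C), [to_dnf (NDec B p C)])]
        | NOr B C \<Rightarrow> []"])
      (auto intro!: ptime_intros simp del: to_dnf.simps cls.simps)
qed

lemma ptime_conv_l [ptime_intros]:
  assumes "ptime f" "ptime g"
  shows "ptime (\<lambda>x. conv_l (f x) (g x))"
proof (rule ptime_app2[of conv_l, OF _ assms], rule ptime_rec_list[where g = "\<lambda>v. []" and
      h = "\<lambda>v A As r. cls_der A @ r @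
        mix_cut (to_dnf A) (cls A) [] (concat (map cls As) @ map to_dnf (snd v)) (fst v)" and
      u = "\<lambda>v A. (fst v, A # snd v)" and
      c = "[]"])
qed (auto intro!: ptime_intros)

lemma ptime_conv_r [ptime_intros]:
  assumes "ptime f" "ptime g"
  shows "ptime (\<lambda>x. conv_r (f x) (g x))"
proof (rule ptime_app2[of conv_r, OF _ assms], rule ptime_rec_list[where g = "\<lambda>v. []" and
      h = "\<lambda>v B Bs r. r @ split_dnf (to_dnf B) @ mix_cut (to_dnf B) (fst v)
        (concat (map (\<lambda>B. disjuncts (to_dnf B)) Bs) @ map to_dnf (snd v)) [] (disjuncts (to_dnf B))" and
      u = "\<lambda>v A. (fst v, A # snd v)" and
      c = "[]"])
qed (auto intro!: ptime_intros)

text \<open>\<open>last []\<close> is unspecified but fixed, so a constant program can output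
  it.\<close>

lemma ptime_last [ptime_intros]: "ptime f \<Longrightarrow> ptime (\<lambda>x. last (f x))"
  by (rule ptime_snd_app[of last], rule ptime_rec_list[where g = "\<lambda>v. last []" and
      h = "\<lambda>v x xs r. if xs = [] then x else r" and u = "\<lambda>v x. v" and c = "last []"])
    (auto intro!: ptime_intros)

lemma ptime_lndt_to_lk: "ptime lndt_to_lk"
proof -
  have [ptime_intros]: "ptime a \<Longrightarrow> ptime p \<Longrightarrow> ptime b \<Longrightarrow> ptime G \<Longrightarrow> ptime D \<Longrightarrow>
      ptime (\<lambda>x. dec_l_block (a x) (p x) (b x) (G x) (D x))"
    "ptime a \<Longrightarrow> ptime p \<Longrightarrow> ptime b \<Longrightarrow> ptime G \<Longrightarrow> ptime D \<Longrightarrow>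
      ptime (\<lambda>x. dec_r_block (a x) (p x) (b x) (G x) (D x))"
    for a :: "'c::encodable \<Rightarrow> bform" and p b G D
    unfolding dec_l_block_def dec_r_block_def pre_lit_neg_def pre_intro_neg_def Let_def
    by (intro ptime_intros; assumption)+
  have 1: "ptime lndt_block"
    unfolding lndt_block_def Let_def by (intro ptime_intros)
  have 2: "ptime lndt_final"
    unfolding lndt_final_def by (intro ptime_intros)
  show ?thesis
    unfolding lndt_to_lk_def by (intro ptime_intros ptime_app[OF 1] ptime_app[OF 2])
qed

lemma time_lndt_to_lk:
  "\<exists>P q. \<forall>\<pi> S. proof_of lndt sh \<pi> S \<longrightarrow>
     outputs_in_time P q enc_ndt ndt_size enc_bform \<pi> (lndt_to_lk \<pi>)"
proof -
  have "vsz \<pi> \<le> poly [:1, 16, 8:] (proof_size ndt_size \<pi>)" if "proof_of lndt sh \<pi> S" for \<pi> S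
  proof (rule vsz_proof[OF proof_of_uses[OF that] lndt_sound lndt_principal _ ndt_size_pos])
    show "vsz A \<le> 8 * ndt_size A" for A using vsz_ndt[of A] by simp
  qed
  then show ?thesis
    using ptime_outputs[OF ptime_lndt_to_lk, of enc_ndt enc_bform "[:1, 16, 8:]" ndt_size] by fastforce
qed

section \<open>From 2-LK to LNDT\<close>

primrec dual :: "bform \<Rightarrow> bform" where
  "dual (BLit p) = BLit (neg p)"
| "dual (BAnd A B) = BOr (dual A) (dual B)"
| "dual (BOr A B) = BAnd (dual A) (dual B)"

primrec lits :: "bform \<Rightarrow> lit list" where
  "lits (BLit p) = [p]"
| "lits (BAnd A B) = lits A @ lits B"
| "lits (BOr A B) = lits A @ lits B"

text \<open>The values at the empty list are junk.\<close>

primrec conj_ndt :: "lit list \<Rightarrow> ndt" where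
  "conj_ndt [] = NLit (Pos 0)"
| "conj_ndt (p # ps) = (if ps = [] then NLit p else NDec (NLit p) p (conj_ndt ps))"

primrec disj_ndt :: "lit list \<Rightarrow> ndt" where
  "disj_ndt [] = NLit (Pos 0)"
| "disj_ndt (p # ps) = (if ps = [] then NLit p else NDec (disj_ndt ps) p (NLit p))"

text \<open>A decision branches on a literal only, so a term is flattened to its list of literals,
  which erases its nesting and makes it an instance of \<open>Conj\<close>. The price is that the
  conjunction rules need proofs that split and join such lists.\<close>

primrec to_ndt :: "bform \<Rightarrow> ndt" where
  "to_ndt (BLit p) = NLit p"
| "to_ndt (BAnd A B) = conj_ndt (lits A @ lits B)"
| "to_ndt (BOr A B) = NOr (to_ndt A) (to_ndt B)"

lemma ndt_of_Conj: "ps \<noteq> [] \<Longrightarrow> ndt_of (Conj ps) = conj_ndt ps"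
  by (induction ps rule: Conj.induct) auto

lemma ndt_of_Disj: "ps \<noteq> [] \<Longrightarrow> ndt_of (Disj ps) = disj_ndt ps"
  by (induction ps rule: Disj.induct) auto

lemma to_ndt_term: "is_term F \<Longrightarrow> to_ndt F = conj_ndt (lits F)"
  by (cases F) auto

lemma lits_nonempty [simp]: "lits F \<noteq> []"
  by (induction F) auto

lemma neg_neg [simp]: "neg (neg p) = p"
  by (cases p) auto

lemma lits_dual [simp]: "lits (dual F) = map neg (lits F)"
  by (induction F) auto

lemma dual_dual [simp]: "dual (dual F) = F"
  by (induction F) auto

lemma is_term_dual [simp]: "is_term (dual F) = is_clause F"
  by (induction F) auto

lemma is_clause_dual [simp]: "is_clause (dual F) = is_term F"
  by (induction F) auto

lemma nested_or_lits: "nested_or As F \<Longrightarrow> lits F = concat (map lits As)"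
  by (induction rule: nested_or.induct) auto

lemma nested_and_lits: "nested_and As F \<Longrightarrow> lits F = concat (map lits As)"
  by (induction rule: nested_and.induct) auto

lemma big_or_lits: "big_or a F \<Longrightarrow> lits F = a"
  unfolding big_or_def by (drule nested_or_lits) (simp add: comp_def)

lemma big_and_lits: "big_and a F \<Longrightarrow> lits F = a"
  unfolding big_and_def by (drule nested_and_lits) (simp add: comp_def)

lemma is_dnf_cnf: "is_dnf F \<Longrightarrow> is_cnf F \<Longrightarrow> is_clause F \<or> is_term F"
  by (cases F) auto

lemma nd_init:
  "mset G = {#NLit p#} \<Longrightarrow> mset D = {#NLit p#} \<Longrightarrow>
    nd.der [(Init_id, NLit p, G, D)] {#} ({#NLit p#}, {#NLit p#})"
  "mset G = {#NLit p, NLit (neg p)#} \<Longrightarrow> D = [] \<Longrightarrow>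
    nd.der [(Init_l, NLit p, G, D)] {#} ({#NLit p, NLit (neg p)#}, {#})"
  "G = [] \<Longrightarrow> mset D = {#NLit p, NLit (neg p)#} \<Longrightarrow>
    nd.der [(Init_r, NLit p, G, D)] {#} ({#}, {#NLit p, NLit (neg p)#})"
  using nd.step0[of Init_id "NLit p" G D] nd.step0[of Init_l "NLit p" G D]
    nd.step0[of Init_r "NLit p" G D] lndt.intros(1-3)[of p]
  by simp_all

lemma nd_or_r: "nd.der L M (\<Gamma>, \<Delta>) \<Longrightarrow> \<Delta> = add_mset A (add_mset B (\<Delta>' - {#NOr A B#})) \<Longrightarrow>
    NOr A B \<in># \<Delta>' \<Longrightarrow> \<Gamma>' = \<Gamma> \<Longrightarrow> mset G = \<Gamma>' \<Longrightarrow> mset D = \<Delta>' \<Longrightarrow>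
    nd.der (L @ [(Or_r, NOr A B, G, D)]) M (\<Gamma>', \<Delta>')"
  using nd.step1[of L M "(\<Gamma>, \<Delta>)" Or_r "NOr A B" G D] lndt.intros(12)[of A B \<Gamma> "\<Delta>' - {#NOr A B#}"]
  by (auto dest!: multi_member_split)

lemma nd_or_l: "nd.der L1 M1 (\<Gamma>1, \<Delta>1) \<Longrightarrow> nd.der L2 M2 (\<Gamma>2, \<Delta>2) \<Longrightarrow> NOr A B \<in># \<Gamma>' \<Longrightarrow>
    \<Gamma>1 = add_mset A (\<Gamma>' - {#NOr A B#}) \<Longrightarrow> \<Gamma>2 = add_mset B (\<Gamma>' - {#NOr A B#}) \<Longrightarrow>
    \<Delta>' = \<Delta>1 \<Longrightarrow> \<Delta>' = \<Delta>2 \<Longrightarrow> M = M1 + M2 \<Longrightarrow> mset G = \<Gamma>' \<Longrightarrow> mset D = \<Delta>' \<Longrightarrow>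
    nd.der (L1 @ L2 @ [(Or_l, NOr A B, G, D)]) M (\<Gamma>', \<Delta>')"
  using nd.step2[of L1 M1 "(\<Gamma>1, \<Delta>1)" L2 M2 "(\<Gamma>2, \<Delta>2)" Or_l "NOr A B" G D]
    lndt.intros(11)[of A B "\<Gamma>' - {#NOr A B#}" \<Delta>']
  by (auto dest!: multi_member_split)

lemma nd_dec_l: "nd.der L1 M1 (\<Gamma>1, \<Delta>1) \<Longrightarrow> nd.der L2 M2 (\<Gamma>2, \<Delta>2) \<Longrightarrow> NDec A p B \<in># \<Gamma>' \<Longrightarrow>
    \<Gamma>1 = add_mset A (\<Gamma>' - {#NDec A p B#}) \<Longrightarrow> \<Delta>1 = add_mset (NLit p) \<Delta>' \<Longrightarrow>
    \<Gamma>2 = add_mset (NLit p) (add_mset B (\<Gamma>' - {#NDec A p B#})) \<Longrightarrow>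
    \<Delta>2 = \<Delta>' \<Longrightarrow> M = M1 + M2 \<Longrightarrow> mset G = \<Gamma>' \<Longrightarrow> mset D = \<Delta>' \<Longrightarrow>
    nd.der (L1 @ L2 @ [(Dec_l, NDec A p B, G, D)]) M (\<Gamma>', \<Delta>')"
  using nd.step2[of L1 M1 "(\<Gamma>1, \<Delta>1)" L2 M2 "(\<Gamma>2, \<Delta>2)" Dec_l "NDec A p B" G D]
    lndt.intros(9)[of A p B "\<Gamma>' - {#NDec A p B#}" \<Delta>']
  by (auto dest!: multi_member_split)

lemma nd_dec_r: "nd.der L1 M1 (\<Gamma>1, \<Delta>1) \<Longrightarrow> nd.der L2 M2 (\<Gamma>2, \<Delta>2) \<Longrightarrow> NDec A p B \<in># \<Delta>' \<Longrightarrow>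
    \<Delta>1 = add_mset A (add_mset (NLit p) (\<Delta>' - {#NDec A p B#})) \<Longrightarrow> \<Gamma>1 = \<Gamma>' \<Longrightarrow>
    \<Gamma>2 = add_mset (NLit p) \<Gamma>' \<Longrightarrow> \<Delta>2 = add_mset B (\<Delta>' - {#NDec A p B#}) \<Longrightarrow>
    M = M1 + M2 \<Longrightarrow> mset G = \<Gamma>' \<Longrightarrow> mset D = \<Delta>' \<Longrightarrow>
    nd.der (L1 @ L2 @ [(Dec_r, NDec A p B, G, D)]) M (\<Gamma>', \<Delta>')"
  using nd.step2[of L1 M1 "(\<Gamma>1, \<Delta>1)" L2 M2 "(\<Gamma>2, \<Delta>2)" Dec_r "NDec A p B" G D]
    lndt.intros(10)[of A p B \<Gamma>' "\<Delta>' - {#NDec A p B#}"]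
  by (auto dest!: multi_member_split)

subsection \<open>Terms\<close>

text \<open>In \<open>NDec (NLit q) q c\<close> the branch for a false \<open>q\<close> has the
  result \<open>q\<close> and is closed by an initial sequent; the search for \<open>p\<close> goes
  on in the other branch.\<close>

primrec conj_elim :: "lit \<Rightarrow> lit list \<Rightarrow> ndt line list" where
  "conj_elim p [] = []"
| "conj_elim p (q # a) = (if a = [] then [(Init_id, NLit p, [NLit p], [NLit p])]
     else ([(Init_id, NLit q, [NLit q], [NLit q])] @ [(Weak_r, NLit p, [NLit q], [NLit p, NLit q])]) @
       (if q = p then [(Init_id, NLit p, [NLit p], [NLit p])] @ [(Weak_l, conj_ndt a, [NLit p, conj_ndt a], [NLit p])]
        else conj_elim p a @ [(Weak_l, NLit q, [NLit q, conj_ndt a], [NLit p])]) @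
       [(Dec_l, NDec (NLit q) q (conj_ndt a), [NDec (NLit q) q (conj_ndt a)], [NLit p])])"

lemma der_conj_elim: "p \<in> set a \<Longrightarrow> nd.der (conj_elim p a) {#} ({#conj_ndt a#}, {#NLit p#})"
proof (induction a)
  case (Cons q a)
  let ?c = "conj_ndt a"
  let ?L1 = "[(Init_id, NLit q, [NLit q], [NLit q])] @ [(Weak_r, NLit p, [NLit q], [NLit p, NLit q])]"
  let ?L2 = "[(Init_id, NLit p, [NLit p], [NLit p])] @ [(Weak_l, ?c, [NLit p, ?c], [NLit p])]"
  let ?L3 = "conj_elim p a @ [(Weak_l, NLit q, [NLit q, ?c], [NLit p])]"
  have 1: "nd.der ?L1 {#} ({#NLit q#}, {#NLit p, NLit q#})"
    by (rule nd.d_weak_r[OF nd_init(1)]) simp_all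
  have 2: "nd.der ?L2 {#} ({#NLit p, ?c#}, {#NLit p#})"
    by (rule nd.d_weak_l[OF nd_init(1)]) simp_all
  have 3: "nd.der ?L3 {#} ({#NLit q, ?c#}, {#NLit p#})" if "q \<noteq> p"
    by (rule nd.d_weak_l[OF Cons.IH]) (use Cons.prems that in simp_all)
  have 4: "nd.der (if q = p then ?L2 else ?L3) {#} ({#NLit q, ?c#}, {#NLit p#})"
    using 2 3 by simp
  have "nd.der (?L1 @ (if q = p then ?L2 else ?L3) @ [(Dec_l, NDec (NLit q) q ?c, [NDec (NLit q) q ?c], [NLit p])])
      {#} ({#NDec (NLit q) q ?c#}, {#NLit p#})"
    by (rule nd_dec_l[OF 1 4]) simp_all
  with Cons.prems show ?case by (auto simp: nd_init)
qed simp

text \<open>The proofs of the single literals come from the parameter \<open>ax\<close>. Projection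
  to a sublist, joining of two lists and excluded middle are instances with different
  \<open>ax\<close>.\<close>

primrec conj_intro :: "(lit \<Rightarrow> ndt line list) \<Rightarrow> ndt list \<Rightarrow> ndt list \<Rightarrow> lit list \<Rightarrow> ndt line list" where
  "conj_intro ax G D [] = []"
| "conj_intro ax G D (q # b) = (if b = [] then ax q
     else (ax q @ [(Weak_r, NLit q, G, NLit q # NLit q # D)]) @
       (conj_intro ax G D b @ [(Weak_l, NLit q, NLit q # G, conj_ndt b # D)]) @
       [(Dec_r, NDec (NLit q) q (conj_ndt b), G, NDec (NLit q) q (conj_ndt b) # D)])"

lemma der_conj_intro:
  assumes "\<And>p. p \<in> set b \<Longrightarrow> nd.der (ax p) {#} (mset G, add_mset (NLit p) (mset D))" "b \<noteq> []"
  shows "nd.der (conj_intro ax G D b) {#} (mset G, add_mset (conj_ndt b) (mset D))"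
  using assms
proof (induction b)
  case (Cons q b)
  show ?case
  proof (cases "b = []")
    case True
    with Cons.prems show ?thesis by simp
  next
    case False
    have 1: "nd.der (ax q @ [(Weak_r, NLit q, G, NLit q # NLit q # D)]) {#} (mset G, mset (NLit q # NLit q # D))"
      by (rule nd.d_weak_r[OF Cons.prems(1)]) simp_all
    have 2: "nd.der (conj_intro ax G D b @ [(Weak_l, NLit q, NLit q # G, conj_ndt b # D)]) {#}
        (mset (NLit q # G), mset (conj_ndt b # D))"
      by (rule nd.d_weak_l[OF Cons.IH]) (use Cons.prems False in simp_all)
    show ?thesis using False nd_dec_r[OF 1 2, of "NLit q" q "conj_ndt b"
        "mset (NDec (NLit q) q (conj_ndt b) # D)" "mset G" "{#}" G "NDec (NLit q) q (conj_ndt b) # D"]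
      by simp
  qed
qed simp

definition conj_left :: "lit list \<Rightarrow> lit list \<Rightarrow> ndt line list" where
  "conj_left a b = conj_intro (\<lambda>p. conj_elim p (a @ b)) [conj_ndt (a @ b)] [] a"

definition conj_right :: "lit list \<Rightarrow> lit list \<Rightarrow> ndt line list" where
  "conj_right a b = conj_intro (\<lambda>p. conj_elim p (a @ b)) [conj_ndt (a @ b)] [] b"

definition conj_both :: "lit list \<Rightarrow> lit list \<Rightarrow> ndt line list" where
  "conj_both a b = conj_intro (\<lambda>p. if p \<in> set a
       then conj_elim p a @ [(Weak_l, conj_ndt b, [conj_ndt a, conj_ndt b], [NLit p])]
       else conj_elim p b @ [(Weak_l, conj_ndt a, [conj_ndt a, conj_ndt b], [NLit p])])
     [conj_ndt a, conj_ndt b] [] (a @ b)"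

lemma der_conj_left: "a \<noteq> [] \<Longrightarrow> nd.der (conj_left a b) {#} ({#conj_ndt (a @ b)#}, {#conj_ndt a#})"
  unfolding conj_left_def
  using der_conj_intro[of a "\<lambda>p. conj_elim p (a @ b)" "[conj_ndt (a @ b)]" "[]"]
  by (simp add: der_conj_elim)

lemma der_conj_right: "b \<noteq> [] \<Longrightarrow> nd.der (conj_right a b) {#} ({#conj_ndt (a @ b)#}, {#conj_ndt b#})"
  unfolding conj_right_def
  using der_conj_intro[of b "\<lambda>p. conj_elim p (a @ b)" "[conj_ndt (a @ b)]" "[]"]
  by (simp add: der_conj_elim)

lemma der_conj_both:
  assumes "a \<noteq> []"
  shows "nd.der (conj_both a b) {#} ({#conj_ndt a, conj_ndt b#}, {#conj_ndt (a @ b)#})"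
proof -
  let ?L1 = "\<lambda>p. conj_elim p a @ [(Weak_l, conj_ndt b, [conj_ndt a, conj_ndt b], [NLit p])]"
  let ?L2 = "\<lambda>p. conj_elim p b @ [(Weak_l, conj_ndt a, [conj_ndt a, conj_ndt b], [NLit p])]"
  have "nd.der (?L1 p) {#} ({#conj_ndt a, conj_ndt b#}, {#NLit p#})" if "p \<in> set a" for p
    by (rule nd.d_weak_l[OF der_conj_elim[OF that]]) simp_all
  moreover have "nd.der (?L2 p) {#} ({#conj_ndt a, conj_ndt b#}, {#NLit p#})" if "p \<in> set b" for p
    by (rule nd.d_weak_l[OF der_conj_elim[OF that]]) simp_all
  ultimately have "nd.der (if p \<in> set a then ?L1 p else ?L2 p) {#}
     (mset [conj_ndt a, conj_ndt b], add_mset (NLit p) (mset []))" if "p \<in> set (a @ b)" for p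
    using that by auto
  from der_conj_intro[of "a @ b", OF this] assms show ?thesis
    unfolding conj_both_def by simp
qed

subsection \<open>Clauses and complements\<close>

primrec clause_intro :: "lit \<Rightarrow> bform \<Rightarrow> ndt line list" where
  "clause_intro p (BLit q) = [(Init_id, NLit p, [NLit p], [NLit p])]"
| "clause_intro p (BAnd A B) = []"
| "clause_intro p (BOr A B) = (if p \<in> set (lits A)
       then clause_intro p A @ [(Weak_r, to_ndt B, [NLit p], [to_ndt A, to_ndt B])]
       else clause_intro p B @ [(Weak_r, to_ndt A, [NLit p], [to_ndt A, to_ndt B])]) @
     [(Or_r, NOr (to_ndt A) (to_ndt B), [NLit p], [NOr (to_ndt A) (to_ndt B)])]"

lemma der_clause_intro:
  "is_clause A \<Longrightarrow> p \<in> set (lits A) \<Longrightarrow> nd.der (clause_intro p A) {#} ({#NLit p#}, {#to_ndt A#})"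
proof (induction A)
  case (BOr A B)
  let ?L1 = "clause_intro p A @ [(Weak_r, to_ndt B, [NLit p], [to_ndt A, to_ndt B])]"
  let ?L2 = "clause_intro p B @ [(Weak_r, to_ndt A, [NLit p], [to_ndt A, to_ndt B])]"
  have "nd.der ?L1 {#} ({#NLit p#}, {#to_ndt A, to_ndt B#})" if "p \<in> set (lits A)"
    by (rule nd.d_weak_r[OF BOr.IH(1)]) (use BOr.prems that in simp_all)
  moreover have "nd.der ?L2 {#} ({#NLit p#}, {#to_ndt A, to_ndt B#})" if "p \<notin> set (lits A)"
    by (rule nd.d_weak_r[OF BOr.IH(2)]) (use BOr.prems that in simp_all)
  ultimately have "nd.der (if p \<in> set (lits A) then ?L1 else ?L2) {#} ({#NLit p#}, {#to_ndt A, to_ndt B#})"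
    by simp
  then show ?case unfolding clause_intro.simps by (rule nd_or_r) simp_all
qed (simp_all add: nd_init)

text \<open>With \<open>A\<close> kept on the right, the dual term is proved literal by literal:
  either \<open>q\<close> holds, or its complement does, and that is a literal of
  \<open>A\<close>.\<close>

definition excluded_middle_clause :: "bform \<Rightarrow> ndt line list" where
  "excluded_middle_clause A = conj_intro (\<lambda>q. [(Init_r, NLit (neg q), [], [NLit (neg q), NLit q])] @
     clause_intro (neg q) A @ mix_cut (NLit (neg q)) [] [NLit q] [] [to_ndt A]) [] [to_ndt A] (lits (dual A))"

lemma der_excluded_middle_clause:
  assumes "is_clause A"
  shows "nd.der (excluded_middle_clause A) {#} ({#}, {#to_ndt A, to_ndt (dual A)#})"
proof -
  let ?ax = "\<lambda>q. [(Init_r, NLit (neg q), [], [NLit (neg q), NLit q])] @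
     clause_intro (neg q) A @ mix_cut (NLit (neg q)) [] [NLit q] [] [to_ndt A]"
  have "nd.der (?ax q) {#} (mset [], add_mset (NLit q) (mset [to_ndt A]))"
    if "q \<in> set (lits (dual A))" for q
    by (rule nd.d_mix_cut[OF nd_init(3)[of _ _ "neg q"] der_clause_intro[OF assms]]) (use that in auto)
  from der_conj_intro[of "lits (dual A)" ?ax "[]" "[to_ndt A]", OF this lits_nonempty] assms
  show ?thesis
    unfolding excluded_middle_clause_def
    by (simp add: to_ndt_term add_mset_commute del: lits_dual)
qed

text \<open>\<open>N\<close> stays fixed while \<open>A\<close> is taken apart: the branches keep
  the term of all dual literals, and each leaf projects the literal that it contradicts.\<close>

primrec contradiction_clause :: "lit list \<Rightarrow> bform \<Rightarrow> ndt line list" where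
  "contradiction_clause N (BLit p) = conj_elim (neg p) N @ [(Init_l, NLit p, [NLit p, NLit (neg p)], [])] @
     mix_cut (NLit (neg p)) [conj_ndt N] [] [NLit p] []"
| "contradiction_clause N (BAnd A B) = []"
| "contradiction_clause N (BOr A B) = contradiction_clause N A @ contradiction_clause N B @
     [(Or_l, NOr (to_ndt A) (to_ndt B), [NOr (to_ndt A) (to_ndt B), conj_ndt N], [])]"

lemma der_contradiction_clause:
  "is_clause A \<Longrightarrow> set (lits (dual A)) \<subseteq> set N \<Longrightarrow>
   nd.der (contradiction_clause N A) {#} ({#to_ndt A, conj_ndt N#}, {#})"
proof (induction A)
  case (BLit p)
  then have "neg p \<in> set N" by simp
  from der_conj_elim[OF this] show ?case
    unfolding contradiction_clause.simps by (rule nd.d_mix_cut[OF _ nd_init(2)]) simp_all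
next
  case (BOr A B)
  then have 1: "nd.der (contradiction_clause N A) {#} ({#to_ndt A, conj_ndt N#}, {#})"
    and 2: "nd.der (contradiction_clause N B) {#} ({#to_ndt B, conj_ndt N#}, {#})" by simp_all
  show ?case unfolding contradiction_clause.simps by (rule nd_or_l[OF 1 2]) simp_all
qed simp

text \<open>By \<open>is_dnf_cnf\<close> the formulas concerned are clauses or terms. The dual of a
  term is a clause, and \<open>dual\<close> is an involution, so the clause case covers
  both.\<close>

definition excluded_middle :: "bform \<Rightarrow> ndt line list" where
  "excluded_middle A = (if is_clause A then excluded_middle_clause A else excluded_middle_clause (dual A))"

definition contradiction :: "bform \<Rightarrow> ndt line list" where
  "contradiction A = (if is_clause A then contradiction_clause (lits (dual A)) A
     else contradiction_clause (lits A) (dual A))"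

lemma der_excluded_middle:
  "is_dnf A \<Longrightarrow> is_cnf A \<Longrightarrow> nd.der (excluded_middle A) {#} ({#}, {#to_ndt A, to_ndt (dual A)#})"
  using is_dnf_cnf[of A] der_excluded_middle_clause[of A] der_excluded_middle_clause[of "dual A"]
  by (auto simp: excluded_middle_def add_mset_commute)

lemma der_contradiction:
  "is_dnf A \<Longrightarrow> is_cnf A \<Longrightarrow> nd.der (contradiction A) {#} ({#to_ndt A, to_ndt (dual A)#}, {#})"
  using is_dnf_cnf[of A] der_contradiction_clause[of A "lits (dual A)"]
    der_contradiction_clause[of "dual A" "lits A"] to_ndt_term[of A] to_ndt_term[of "dual A"]
  by (auto simp: contradiction_def add_mset_commute simp del: lits_dual)

text \<open>Trades the decision form \<open>Disj\<close> for the disjunction that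
  \<open>to_ndt\<close> makes of a clause. In the true branch \<open>p\<close> is at once the
  decision literal and the result, which is why it stands there twice.\<close>

primrec disj_elim :: "bform \<Rightarrow> lit list \<Rightarrow> ndt line list" where
  "disj_elim F [] = []"
| "disj_elim F (p # a) = (if a = [] then clause_intro p F
     else (disj_elim F a @ [(Weak_r, NLit p, [disj_ndt a], [NLit p, to_ndt F])]) @
       (clause_intro p F @ [(Weak_l, NLit p, [NLit p, NLit p], [to_ndt F])]) @
       [(Dec_l, NDec (disj_ndt a) p (NLit p), [NDec (disj_ndt a) p (NLit p)], [to_ndt F])])"

lemma der_disj_elim:
  assumes "is_clause F" "set a \<subseteq> set (lits F)" "a \<noteq> []"
  shows "nd.der (disj_elim F a) {#} ({#disj_ndt a#}, {#to_ndt F#})"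
  using assms(2,3)
proof (induction a)
  case (Cons p a)
  have p: "nd.der (clause_intro p F) {#} ({#NLit p#}, {#to_ndt F#})"
    using assms(1) Cons.prems by (intro der_clause_intro) auto
  show ?case
  proof (cases "a = []")
    case True
    with p show ?thesis by simp
  next
    case False
    have 1: "nd.der (disj_elim F a @ [(Weak_r, NLit p, [disj_ndt a], [NLit p, to_ndt F])]) {#}
        ({#disj_ndt a#}, {#NLit p, to_ndt F#})"
      by (rule nd.d_weak_r[OF Cons.IH]) (use Cons.prems False in simp_all)
    have 2: "nd.der (clause_intro p F @ [(Weak_l, NLit p, [NLit p, NLit p], [to_ndt F])]) {#}
        ({#NLit p, NLit p#}, {#to_ndt F#})"
      by (rule nd.d_weak_l[OF p]) simp_all
    show ?thesis using False nd_dec_l[OF 1 2, of "disj_ndt a" p "NLit p" "{#disj_ndt (p # a)#}"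
        "{#to_ndt F#}" "{#}" "[disj_ndt (p # a)]" "[to_ndt F]"]
      by simp
  qed
qed simp

subsection \<open>Sequents\<close>

text \<open>A conjunction of clauses that is not a term has no short nondeterministic decision tree; its
  dual does, so such formulas change sides.\<close>

definition same_side :: "bform multiset \<Rightarrow> ndt multiset" where
  "same_side M = image_mset to_ndt (filter_mset is_dnf M)"

definition other_side :: "bform multiset \<Rightarrow> ndt multiset" where
  "other_side M = image_mset (\<lambda>F. to_ndt (dual F)) (filter_mset (\<lambda>F. \<not> is_dnf F) M)"

definition ndt_seq :: "bform sequent \<Rightarrow> ndt sequent" where
  "ndt_seq S = (same_side (fst S) + other_side (snd S), same_side (snd S) + other_side (fst S))"

definition same_list :: "bform list \<Rightarrow> ndt list" where
  "same_list xs = map to_ndt (filter is_dnf xs)"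

definition other_list :: "bform list \<Rightarrow> ndt list" where
  "other_list xs = map (\<lambda>F. to_ndt (dual F)) (filter (\<lambda>F. \<not> is_dnf F) xs)"

lemma mset_same_list [simp]: "mset (same_list xs) = same_side (mset xs)"
  by (simp add: same_list_def same_side_def)

lemma mset_other_list [simp]: "mset (other_list xs) = other_side (mset xs)"
  by (simp add: other_list_def other_side_def)

lemma same_side_simps [simp]:
  "same_side {#} = {#}"
  "same_side (add_mset A M) = (if is_dnf A then {#to_ndt A#} else {#}) + same_side M"
  by (simp_all add: same_side_def)

lemma other_side_simps [simp]:
  "other_side {#} = {#}"
  "other_side (add_mset A M) = (if is_dnf A then {#} else {#to_ndt (dual A)#}) + other_side M"
  by (simp_all add: other_side_def)

section \<open>The conjunction rules\<close>

definition and_l_dnf :: "bform \<Rightarrow> bform \<Rightarrow> ndt list \<Rightarrow> ndt list \<Rightarrow> ndt line list" where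
  "and_l_dnf B C G D = (let b = lits B; c = lits C; X = conj_ndt (b @ c) in
     (conj_right b c @ (conj_left b c @ [] @ mix_cut (conj_ndt b) [X] [] (conj_ndt c # G) D) @
       mix_cut (conj_ndt c) [X] [] (X # G) D) @ [(Contr_l, X, X # G, D)])"

text \<open>The conjunction is projected to both parts, so it appears twice and is contracted; the
  premise itself is used once.\<close>

lemma der_and_l_dnf:
  "nd.der (and_l_dnf B C G D)
    {#(add_mset (conj_ndt (lits B)) (add_mset (conj_ndt (lits C)) (mset G)), mset D)#}
    (add_mset (conj_ndt (lits B @ lits C)) (mset G), mset D)"
proof -
  let ?b = "conj_ndt (lits B)" and ?c = "conj_ndt (lits C)" and ?X = "conj_ndt (lits B @ lits C)"
  let ?S = "(add_mset ?b (add_mset ?c (mset G)), mset D)"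
  have 1: "nd.der (conj_left (lits B) (lits C) @ [] @ mix_cut ?b [?X] [] (?c # G) D) {#?S#}
      (mset (?X # ?c # G), mset D)"
    by (rule nd.d_mix_cut[OF der_conj_left nd.hyp]) simp_all
  have "nd.der (conj_right (lits B) (lits C) @ (conj_left (lits B) (lits C) @ [] @
      mix_cut ?b [?X] [] (?c # G) D) @ mix_cut ?c [?X] [] (?X # G) D) {#?S#} (mset (?X # ?X # G), mset D)"
    by (rule nd.d_mix_cut[OF der_conj_right 1]) (simp_all add: add_mset_commute)
  then show ?thesis unfolding and_l_dnf_def Let_def by (rule nd.d_contr_l) simp_all
qed

definition and_r_dnf :: "bform \<Rightarrow> bform \<Rightarrow> ndt list \<Rightarrow> ndt list \<Rightarrow> ndt line list" where
  "and_r_dnf B C G D = (let b = lits B; c = lits C; X = conj_ndt (b @ c) in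
     [(Weak_r, X, G, conj_ndt c # X # D)] @
     ([] @ conj_both b c @ mix_cut (conj_ndt b) G D [conj_ndt c] [X]) @
     [(Cut, conj_ndt c, G, X # D)])"

text \<open>Cutting \<open>conj_both\<close> against the first premise leaves the second conjunct on
  the left. The second premise, weakened by the whole conjunction, then has the matching context for
  a cut.\<close>

lemma der_and_r_dnf:
  "nd.der (and_r_dnf B C G D)
    {#(mset G, add_mset (conj_ndt (lits B)) (mset D)), (mset G, add_mset (conj_ndt (lits C)) (mset D))#}
    (mset G, add_mset (conj_ndt (lits B @ lits C)) (mset D))"
proof -
  let ?b = "conj_ndt (lits B)" and ?c = "conj_ndt (lits C)" and ?X = "conj_ndt (lits B @ lits C)"
  let ?S1 = "(mset G, add_mset ?b (mset D))" and ?S2 = "(mset G, add_mset ?c (mset D))"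
  have 1: "nd.der ([] @ [(Weak_r, ?X, G, ?c # ?X # D)]) {#?S2#} (mset G, mset (?c # ?X # D))"
    by (rule nd.d_weak_r[OF nd.hyp]) (simp_all add: add_mset_commute)
  have 2: "nd.der ([] @ conj_both (lits B) (lits C) @ mix_cut ?b G D [?c] [?X]) {#?S1#}
      (mset (?c # G), mset (?X # D))"
    by (rule nd.d_mix_cut[OF nd.hyp der_conj_both]) simp_all
  from nd.d_cut[OF 1 2, of ?c "mset (?X # D)" "mset G" G "?X # D"]
  show ?thesis by (simp add: and_r_dnf_def Let_def add_mset_commute)
qed

text \<open>Concerns a conjunct \<open>B\<close> of a formula that changes sides. If
  \<open>B\<close> is also a disjunction of terms, it stood on its own side and excluded middle
  carries its dual across; otherwise its dual is already there and the sequent stays as it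
  is.\<close>

definition move_r :: "bform \<Rightarrow> ndt list \<Rightarrow> ndt list \<Rightarrow> ndt line list" where
  "move_r B G D = (if is_dnf B
     then excluded_middle B @ [] @ mix_cut (to_ndt B) [] [to_ndt (dual B)] G D else [])"

definition move_l :: "bform \<Rightarrow> ndt list \<Rightarrow> ndt list \<Rightarrow> ndt line list" where
  "move_l B G D = (if is_dnf B
     then [] @ contradiction B @ mix_cut (to_ndt B) G D [to_ndt (dual B)] [] else [])"

lemma der_move_r: "is_cnf B \<Longrightarrow> nd.der (move_r B G D)
    {#(same_side {#B#} + mset G, other_side {#B#} + mset D)#} (mset G, add_mset (to_ndt (dual B)) (mset D))"
proof (cases "is_dnf B")
  case True
  assume "is_cnf B"
  have "nd.der (excluded_middle B @ [] @ mix_cut (to_ndt B) [] [to_ndt (dual B)] G D)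
      {#(add_mset (to_ndt B) (mset G), mset D)#} (mset G, add_mset (to_ndt (dual B)) (mset D))"
    by (rule nd.d_mix_cut[OF der_excluded_middle nd.hyp]) (use True \<open>is_cnf B\<close> in simp_all)
  then show ?thesis using True by (simp add: move_r_def)
qed (simp add: move_r_def nd.hyp)

lemma der_move_l: "is_cnf B \<Longrightarrow> nd.der (move_l B G D)
    {#(other_side {#B#} + mset G, same_side {#B#} + mset D)#} (add_mset (to_ndt (dual B)) (mset G), mset D)"
proof (cases "is_dnf B")
  case True
  assume "is_cnf B"
  have "nd.der ([] @ contradiction B @ mix_cut (to_ndt B) G D [to_ndt (dual B)] [])
      {#(mset G, add_mset (to_ndt B) (mset D))#} (add_mset (to_ndt (dual B)) (mset G), mset D)"
    by (rule nd.d_mix_cut[OF nd.hyp der_contradiction]) (use True \<open>is_cnf B\<close> in simp_all)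
  then show ?thesis using True by (simp add: move_l_def)
qed (simp add: move_l_def nd.hyp)

text \<open>Under duality a conjunction on the left is a disjunction on the right, so
  \<open>And_l\<close> becomes \<open>Or_r\<close>; in the same way \<open>and_r_cnf\<close> ends in
  \<open>Or_l\<close>. While \<open>B\<close> is being moved, \<open>C\<close> is still where the
  translation of the premise put it, hence the lists for \<open>[C]\<close> in the context.\<close>

definition and_l_cnf :: "bform \<Rightarrow> bform \<Rightarrow> ndt list \<Rightarrow> ndt list \<Rightarrow> ndt line list" where
  "and_l_cnf B C G D = (let X = NOr (to_ndt (dual B)) (to_ndt (dual C)) in
     (move_r B (same_list [C] @ G) (other_list [C] @ D) @ move_r C G (to_ndt (dual B) # D)) @
     [(Or_r, X, G, X # D)])"

lemma der_and_l_cnf: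
  assumes "is_cnf B" "is_cnf C"
  shows "nd.der (and_l_cnf B C G D)
    {#(same_side {#B#} + same_side {#C#} + mset G, other_side {#B#} + other_side {#C#} + mset D)#}
    (mset G, add_mset (to_ndt (dual (BAnd B C))) (mset D))"
proof -
  have "nd.der (move_r B (same_list [C] @ G) (other_list [C] @ D))
      {#(same_side {#B#} + same_side {#C#} + mset G, other_side {#B#} + other_side {#C#} + mset D)#}
      (same_side {#C#} + mset G, other_side {#C#} + mset (to_ndt (dual B) # D))"
    using der_move_r[OF assms(1), of "same_list [C] @ G" "other_list [C] @ D"]
    unfolding mset_append mset_same_list mset_other_list by (simp add: add.assoc del: same_side_simps other_side_simps)
  from nd.d_trans[OF this der_move_r[OF assms(2)]]
  show ?thesis unfolding and_l_cnf_def Let_def by (rule nd_or_r) (simp_all add: add_mset_commute)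
qed

definition and_r_cnf :: "bform \<Rightarrow> bform \<Rightarrow> ndt list \<Rightarrow> ndt list \<Rightarrow> ndt line list" where
  "and_r_cnf B C G D = (let X = NOr (to_ndt (dual B)) (to_ndt (dual C)) in
     move_l B G D @ move_l C G D @ [(Or_l, X, X # G, D)])"

lemma der_and_r_cnf:
  assumes "is_cnf B" "is_cnf C"
  shows "nd.der (and_r_cnf B C G D)
    {#(other_side {#B#} + mset G, same_side {#B#} + mset D),
      (other_side {#C#} + mset G, same_side {#C#} + mset D)#}
    (add_mset (to_ndt (dual (BAnd B C))) (mset G), mset D)"
  unfolding and_r_cnf_def Let_def
  by (rule nd_or_l[OF der_move_l[OF assms(1)] der_move_l[OF assms(2)]]) simp_all

text \<open>When the principal formula changes sides, weakening and contraction change theirs. A cut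
  keeps its name and only exchanges its premises.\<close>

definition flip :: "rule \<Rightarrow> rule" where
  "flip r = (if r = Contr_l then Contr_r else if r = Contr_r then Contr_l
     else if r = Weak_l then Weak_r else if r = Weak_r then Weak_l else r)"

definition lk_direct :: "bform line \<Rightarrow> ndt line" where
  "lk_direct l = (let r = fst l; A = fst (snd l); \<Gamma> = fst (snd (snd l)); \<Delta> = snd (snd (snd l));
       G = same_list \<Gamma> @ other_list \<Delta>; D = same_list \<Delta> @ other_list \<Gamma> in
     if is_dnf A then (r, to_ndt A, G, D) else (flip r, to_ndt (dual A), G, D))"

text \<open>Only conjunctions need blocks. For terms the flattened lists must be split or joined;
  for proper conjunctions of clauses the principal formula moves while its parts may have kept their
  side.\<close>

definition lk_block :: "bform line \<Rightarrow> ndt line list" where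
  "lk_block l = (let r = fst l; A = fst (snd l); \<Gamma> = fst (snd (snd l)); \<Delta> = snd (snd (snd l)) in
     case A of
       BLit p \<Rightarrow> [lk_direct l]
     | BAnd B C \<Rightarrow>
         if r = And_l then
           (let G = same_list (remove1 A \<Gamma>) @ other_list \<Delta>; D = same_list \<Delta> @ other_list (remove1 A \<Gamma>) in
            if is_dnf A then and_l_dnf B C G D else and_l_cnf B C G D)
         else if r = And_r then
           (let G = same_list \<Gamma> @ other_list (remove1 A \<Delta>); D = same_list (remove1 A \<Delta>) @ other_list \<Gamma> in
            if is_dnf A then and_r_dnf B C G D else and_r_cnf B C G D)
         else [lk_direct l]
     | BOr B C \<Rightarrow> [lk_direct l])"

lemma block_nonempty: "and_l_dnf B C G D \<noteq> []" "and_r_dnf B C G D \<noteq> []"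
  "and_l_cnf B C G D \<noteq> []" "and_r_cnf B C G D \<noteq> []"
  by (simp_all add: and_l_dnf_def and_r_dnf_def and_l_cnf_def and_r_cnf_def Let_def)

lemmas lndt_intros = lndt.intros[simplified]

lemma lk_block_sim:
  assumes "two_lk (fst l) (fst (snd l)) Ss (seq_of l)"
  shows "consumes lndt (lk_block l) (image_mset ndt_seq (mset Ss)) {#ndt_seq (seq_of l)#} \<and>
    lk_block l \<noteq> []"
proof -
  obtain r A \<Gamma> \<Delta> where l: "l = (r, A, \<Gamma>, \<Delta>)" by (cases l) auto
  \<comment> \<open>\<open>Ss'\<close> is a permutation of the translated premises because a cut on
    a formula that changes sides exchanges its two premises; the order of pending sequents is
    irrelevant to \<open>consumes\<close>.\<close>
  have direct: ?thesis if "lndt (fst (lk_direct l)) (fst (snd (lk_direct l))) Ss' (ndt_seq (mset \<Gamma>, mset \<Delta>))"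
    "mset Ss' = image_mset ndt_seq (mset Ss)" "lk_block l = [lk_direct l]" for Ss'
    using that by (auto simp: l lk_direct_def ndt_seq_def Let_def intro!: exI[of _ Ss'])
  from assms have lk: "lk r A Ss (mset \<Gamma>, mset \<Delta>)"
    and dt: "\<And>F. F \<in> set \<Gamma> \<union> set \<Delta> \<Longrightarrow> depth_two F"
    by (auto simp: l two_lk_iff seq_all_def)
  have nonAnd: "lk_block l = [lk_direct l]" if "r \<noteq> And_l" "r \<noteq> And_r"
    using that by (simp add: lk_block_def l split: bform.split)
  note defs = lk_direct_def l ndt_seq_def flip_def Let_def
  from lk show ?thesis
  proof cases
    case (8)
    show ?thesis
    proof (cases "is_dnf A")
      case True
      show ?thesis by (rule direct[of "map ndt_seq Ss", OF _ _ nonAnd])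
        (use 8 True in \<open>auto simp: defs intro!: lndt_intros\<close>)
    next
      case False
      show ?thesis by (rule direct[of "rev (map ndt_seq Ss)", OF _ _ nonAnd])
        (use 8 False in \<open>auto simp: defs intro!: lndt_intros\<close>)
    qed
  next
    case (9 B C \<Gamma>')
    let ?G = "same_list (remove1 A \<Gamma>) @ other_list \<Delta>"
      and ?D = "same_list \<Delta> @ other_list (remove1 A \<Gamma>)"
    from 9 have "A \<in># mset \<Gamma>" by simp
    then have A: "depth_two A" using dt by simp
    have G: "mset (remove1 A \<Gamma>) = \<Gamma>'" using 9 by simp
    show ?thesis
    proof (cases "is_dnf A")
      case True
      then have "lk_block l = and_l_dnf B C ?G ?D" using 9 by (simp add: lk_block_def l Let_def)
      then show ?thesis using True 9 G der_and_l_dnf[of B C ?G ?D] block_nonempty(1)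
        by (simp add: derives_def ndt_seq_def l is_dnf_term to_ndt_term add_mset_commute)
    next
      case False
      with A 9 have cnf: "is_cnf B" "is_cnf C" by (auto simp: depth_two_iff)
      from False have "lk_block l = and_l_cnf B C ?G ?D" using 9 by (auto simp: lk_block_def l Let_def)
      moreover have "ndt_seq (seq_of l) = (mset ?G, add_mset (to_ndt (dual (BAnd B C))) (mset ?D))"
        using False 9 G by (simp add: ndt_seq_def l del: is_dnf.simps dual.simps)
      moreover have "image_mset ndt_seq (mset Ss) = {#(same_side {#B#} + same_side {#C#} + mset ?G,
          other_side {#B#} + other_side {#C#} + mset ?D)#}"
        using 9 G by (auto simp: ndt_seq_def add_mset_commute)
      ultimately show ?thesis using der_and_l_cnf[OF cnf, of ?G ?D] block_nonempty(3)
        unfolding derives_def by metis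
    qed
  next
    case (10 B C \<Delta>')
    let ?G = "same_list \<Gamma> @ other_list (remove1 A \<Delta>)"
      and ?D = "same_list (remove1 A \<Delta>) @ other_list \<Gamma>"
    from 10 have "A \<in># mset \<Delta>" by simp
    then have A: "depth_two A" using dt by simp
    have D: "mset (remove1 A \<Delta>) = \<Delta>'" using 10 by simp
    show ?thesis
    proof (cases "is_dnf A")
      case True
      then have "lk_block l = and_r_dnf B C ?G ?D" using 10 by (simp add: lk_block_def l Let_def)
      then show ?thesis using True 10 D der_and_r_dnf[of B C ?G ?D] block_nonempty(2)
        by (simp add: derives_def ndt_seq_def l is_dnf_term to_ndt_term add_mset_commute)
    next
      case False
      with A 10 have cnf: "is_cnf B" "is_cnf C" by (auto simp: depth_two_iff)
      from False have "lk_block l = and_r_cnf B C ?G ?D" using 10 by (auto simp: lk_block_def l Let_def)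
      moreover have "ndt_seq (seq_of l) = (add_mset (to_ndt (dual (BAnd B C))) (mset ?G), mset ?D)"
        using False 10 D by (simp add: ndt_seq_def l del: is_dnf.simps dual.simps)
      moreover have "image_mset ndt_seq (mset Ss) = {#(other_side {#B#} + mset ?G, same_side {#B#} + mset ?D),
          (other_side {#C#} + mset ?G, same_side {#C#} + mset ?D)#}"
        using 10 D by (auto simp: ndt_seq_def)
      ultimately show ?thesis using der_and_r_cnf[OF cnf, of ?G ?D] block_nonempty(4)
        unfolding derives_def by metis
    qed
  next
    case 1
    show ?thesis by (rule direct[of "map ndt_seq Ss", OF _ _ nonAnd])
      (use 1 in \<open>auto simp: defs intro!: lndt_intros\<close>)
  next
    case (2 p)
    show ?thesis by (rule direct[of "map ndt_seq Ss", OF _ _ nonAnd])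
      (use 2 lndt.intros(2)[of p] in \<open>auto simp: defs add_mset_commute\<close>)
  next
    case (3 p)
    show ?thesis by (rule direct[of "map ndt_seq Ss", OF _ _ nonAnd])
      (use 3 lndt.intros(3)[of p] in \<open>auto simp: defs add_mset_commute\<close>)
  next
    case 4
    show ?thesis by (rule direct[of "map ndt_seq Ss", OF _ _ nonAnd])
      (use 4 in \<open>cases "is_dnf A"; auto simp: defs intro!: lndt_intros\<close>)+
  next
    case 5
    show ?thesis by (rule direct[of "map ndt_seq Ss", OF _ _ nonAnd])
      (use 5 in \<open>cases "is_dnf A"; auto simp: defs intro!: lndt_intros\<close>)+
  next
    case 6
    show ?thesis by (rule direct[of "map ndt_seq Ss", OF _ _ nonAnd])
      (use 6 in \<open>cases "is_dnf A"; auto simp: defs intro!: lndt_intros\<close>)+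
  next
    case 7
    show ?thesis by (rule direct[of "map ndt_seq Ss", OF _ _ nonAnd])
      (use 7 in \<open>cases "is_dnf A"; auto simp: defs intro!: lndt_intros\<close>)+
  next
    case (11 B C \<Gamma>')
    then have "A \<in># mset \<Gamma>" by simp
    then have "depth_two A" using dt by simp
    \<comment> \<open>A disjunction that counts as a conjunction of clauses is a single clause, and
      clauses are disjunctions of terms, so the principal formula of a disjunction rule never
      moves.\<close>
    then have "is_dnf A" using 11 by (auto simp: depth_two_iff is_dnf_clause)
    then have BC: "is_dnf B" "is_dnf C" using 11 by simp_all
    show ?thesis by (rule direct[of "map ndt_seq Ss", OF _ _ nonAnd])
      (use 11 BC in \<open>auto simp: defs intro!: lndt_intros\<close>)
  next
    case (12 B C \<Delta>')
    then have "A \<in># mset \<Delta>" by simp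
    then have "depth_two A" using dt by simp
    then have "is_dnf A" using 12 by (auto simp: depth_two_iff is_dnf_clause)
    then have BC: "is_dnf B" "is_dnf C" using 12 by simp_all
    show ?thesis by (rule direct[of "map ndt_seq Ss", OF _ _ nonAnd])
      (use 12 BC lndt.intros(12)[of "to_ndt B" "to_ndt C" "same_side (mset \<Gamma>) + other_side \<Delta>'"
          "same_side \<Delta>' + other_side (mset \<Gamma>)"]
        in \<open>auto simp: defs add_mset_commute\<close>)
  qed
qed

section \<open>The end sequent in LNDT\<close>

fun conv_clauses :: "ndt list \<times> bform list \<Rightarrow> bform list \<Rightarrow> ndt line list" where
  "conv_clauses (D, Ctx) [] = []"
| "conv_clauses (D, Ctx) (F # Fs) = disj_elim F (lits F) @ conv_clauses (D, F # Ctx) Fs @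
     mix_cut (to_ndt F) [disj_ndt (lits F)] [] (map (\<lambda>F. disj_ndt (lits F)) Fs @ map to_ndt Ctx) D"

text \<open>Only antecedents require conversion: \<open>to_ndt\<close> maps a term to the decision
  form \<open>Conj\<close> itself, but a clause to nested disjunctions instead of
  \<open>Disj\<close>. \<open>Ctx\<close> holds the clauses still waiting for their cut.\<close>

lemma der_conv_clauses:
  assumes "\<forall>F\<in>set Fs. is_clause F"
  shows "nd.der (conv_clauses (D, Ctx) Fs) {#(mset (map to_ndt (Fs @ Ctx)), mset D)#}
    (mset (map (\<lambda>F. disj_ndt (lits F)) Fs @ map to_ndt Ctx), mset D)"
  using assms
proof (induction Fs arbitrary: Ctx)
  case Nil
  then show ?case unfolding conv_clauses.simps by (simp add: nd.hyp)
next
  case (Cons F Fs)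
  have IH: "nd.der (conv_clauses (D, F # Ctx) Fs) {#(mset (map to_ndt (Fs @ F # Ctx)), mset D)#}
    (mset (map (\<lambda>F. disj_ndt (lits F)) Fs @ map to_ndt (F # Ctx)), mset D)"
    by (rule Cons.IH) (use Cons.prems in auto)
  have "nd.der (disj_elim F (lits F)) {#} ({#disj_ndt (lits F)#}, {#to_ndt F#})"
    by (rule der_disj_elim) (use Cons.prems in auto)
  from nd.d_mix_cut[OF this IH] show ?case
    unfolding conv_clauses.simps by simp
qed

definition lk_to_lndt :: "bform line list \<Rightarrow> ndt line list" where
  "lk_to_lndt \<pi> = concat (map lk_block \<pi>) @
     conv_clauses (map to_ndt (snd (snd (snd (last \<pi>)))), []) (fst (snd (snd (last \<pi>))))"

lemma lk_to_lndt_correct: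
  assumes "proof_of two_lk sh \<pi> (mset Fs, mset Gs)"
    "list_all2 big_or as Fs" "list_all2 big_and bs Gs" "\<forall>a\<in>set as. a \<noteq> []" "\<forall>b\<in>set bs. b \<noteq> []"
  shows "proof_of lndt sh (lk_to_lndt \<pi>)
    (mset (map (ndt_of \<circ> Disj) as), mset (map (ndt_of \<circ> Conj) bs))"
  unfolding lk_to_lndt_def
proof (rule proof_of_transform[OF assms(1) lk_block_sim])
  obtain r A \<Gamma> \<Delta> where l: "last \<pi> = (r, A, \<Gamma>, \<Delta>)" by (cases "last \<pi>") auto
  with assms(1) have m: "mset \<Gamma> = mset Fs" "mset \<Delta> = mset Gs"
    unfolding proof_of_def by auto
  have Fs: "\<forall>F\<in>set Fs. is_clause F"
    using assms(2) by (induction rule: list_all2_induct) (auto simp: clause_def simp flip: clause_iff)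
  have Gs: "\<forall>G\<in>set Gs. is_term G"
    using assms(3) by (induction rule: list_all2_induct) (auto simp: dnf_term_def simp flip: dnf_term_iff)
  have as: "map lits Fs = as" using assms(2)
    by (induction rule: list_all2_induct) (auto simp: big_or_lits)
  have bs: "map lits Gs = bs" using assms(3)
    by (induction rule: list_all2_induct) (auto simp: big_and_lits)
  have "set \<Gamma> = set Fs" using mset_eq_setD[OF m(1)] .
  then have *: "nd.der (conv_clauses (map to_ndt \<Delta>, []) \<Gamma>) {#(mset (map to_ndt \<Gamma>), mset (map to_ndt \<Delta>))#}
      (mset (map (\<lambda>F. disj_ndt (lits F)) \<Gamma>), mset (map to_ndt \<Delta>))"
    using der_conv_clauses[of \<Gamma> "map to_ndt \<Delta>" "[]"] Fs by simp
  \<comment> \<open>Clauses and terms are disjunctions of terms, so no formula of the end sequent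
    has changed sides.\<close>
  have "ndt_seq (mset Fs, mset Gs) = (mset (map to_ndt \<Gamma>), mset (map to_ndt \<Delta>))"
  proof -
    have "filter is_dnf Fs = Fs" "filter is_dnf Gs = Gs"
      "filter (\<lambda>F. \<not> is_dnf F) Fs = []" "filter (\<lambda>F. \<not> is_dnf F) Gs = []"
      using Fs Gs by (auto simp: filter_empty_conv is_dnf_clause is_dnf_term intro!: filter_True)
    then show ?thesis
      unfolding ndt_seq_def using m
      by (simp flip: mset_same_list mset_other_list) (simp add: same_list_def other_list_def)
  qed
  moreover have "mset (map (\<lambda>F. disj_ndt (lits F)) \<Gamma>) = mset (map (ndt_of \<circ> Disj) as)"
  proof -
    have "map (\<lambda>F. disj_ndt (lits F)) Fs = map (ndt_of \<circ> Disj) as"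
      using assms(4) unfolding as[symmetric] by (simp add: ndt_of_Disj)
    then show ?thesis using m(1) by (metis mset_map)
  qed
  moreover have "mset (map to_ndt \<Delta>) = mset (map (ndt_of \<circ> Conj) bs)"
  proof -
    have "map to_ndt Gs = map (ndt_of \<circ> Conj) bs"
      using Gs unfolding bs[symmetric] by (simp add: ndt_of_Conj to_ndt_term)
    then show ?thesis using m(2) by (metis mset_map)
  qed
  ultimately show "consumes lndt (conv_clauses (map to_ndt (snd (snd (snd (last \<pi>)))), [])
      (fst (snd (snd (last \<pi>))))) {#ndt_seq (mset Fs, mset Gs)#}
      {#(mset (map (ndt_of \<circ> Disj) as), mset (map (ndt_of \<circ> Conj) bs))#}"
    using * by (simp add: derives_def l)
qed

subsection \<open>Running time\<close>

lemma ptime_dual [ptime_intros]: "ptime f \<Longrightarrow> ptime (\<lambda>x. dual (f x))"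
  by (rule ptime_snd_app[of dual], rule ptime_rec_bform[where g = "\<lambda>v p. BLit (neg p)"
        and h = "\<lambda>v A B a b. BOr a b" and k = "\<lambda>v A B a b. BAnd a b" and c = "BLit (Pos 0)"])
    (auto intro!: ptime_intros)

lemma ptime_lits [ptime_intros]: "ptime f \<Longrightarrow> ptime (\<lambda>x. lits (f x))"
  by (rule ptime_snd_app[of lits], rule ptime_rec_bform[where g = "\<lambda>v p. [p]"
        and h = "\<lambda>v A B a b. a @ b" and k = "\<lambda>v A B a b. a @ b" and c = "[]"])
    (auto intro!: ptime_intros)

lemma ptime_is_clause [ptime_intros]: "ptime f \<Longrightarrow> ptime (\<lambda>x. is_clause (f x))"
  by (rule ptime_snd_app[of is_clause], rule ptime_rec_bform[where g = "\<lambda>v p. True"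
        and h = "\<lambda>v A B a b. False" and k = "\<lambda>v A B a b. a \<and> b" and c = "True"])
    (auto intro!: ptime_intros)

lemma ptime_is_term [ptime_intros]: "ptime f \<Longrightarrow> ptime (\<lambda>x. is_term (f x))"
  by (rule ptime_snd_app[of is_term], rule ptime_rec_bform[where g = "\<lambda>v p. True"
        and h = "\<lambda>v A B a b. a \<and> b" and k = "\<lambda>v A B a b. False" and c = "True"])
    (auto intro!: ptime_intros)

lemma ptime_is_dnf [ptime_intros]: "ptime f \<Longrightarrow> ptime (\<lambda>x. is_dnf (f x))"
  by (rule ptime_snd_app[of is_dnf], rule ptime_rec_bform[where g = "\<lambda>v p. True"
        and h = "\<lambda>v A B a b. is_term A \<and> is_term B" and k = "\<lambda>v A B a b. a \<and> b" and c = "True"])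
    (auto intro!: ptime_intros)

lemma ptime_conj_ndt [ptime_intros]: "ptime f \<Longrightarrow> ptime (\<lambda>x. conj_ndt (f x))"
  by (rule ptime_snd_app[of conj_ndt], rule ptime_rec_list[where g = "\<lambda>v. NLit (Pos 0)" and
      h = "\<lambda>v p ps r. if ps = [] then NLit p else NDec (NLit p) p r" and u = "\<lambda>v x. v" and
      c = "NLit (Pos 0)"])
    (auto intro!: ptime_intros)

lemma ptime_disj_ndt [ptime_intros]: "ptime f \<Longrightarrow> ptime (\<lambda>x. disj_ndt (f x))"
  by (rule ptime_snd_app[of disj_ndt], rule ptime_rec_list[where g = "\<lambda>v. NLit (Pos 0)" and
      h = "\<lambda>v p ps r. if ps = [] then NLit p else NDec r p (NLit p)" and u = "\<lambda>v x. v" and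
      c = "NLit (Pos 0)"])
    (auto intro!: ptime_intros)

lemma ptime_to_ndt [ptime_intros]: "ptime f \<Longrightarrow> ptime (\<lambda>x. to_ndt (f x))"
  by (rule ptime_snd_app[of to_ndt], rule ptime_rec_bform[where g = "\<lambda>v p. NLit p"
        and h = "\<lambda>v A B a b. conj_ndt (lits A @ lits B)" and k = "\<lambda>v A B a b. NOr a b"
        and c = "NLit (Pos 0)"])
    (auto intro!: ptime_intros)

lemma ptime_conj_elim [ptime_intros]:
  assumes "ptime f" "ptime g"
  shows "ptime (\<lambda>x. conj_elim (f x) (g x))"
proof (rule ptime_app2[of conj_elim, OF _ assms], rule ptime_rec_list[where g = "\<lambda>v. []" and u = "\<lambda>v x. v" and
      h = "\<lambda>p q a r. if a = [] then [(Init_id, NLit p, [NLit p], [NLit p])]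
        else ([(Init_id, NLit q, [NLit q], [NLit q])] @ [(Weak_r, NLit p, [NLit q], [NLit p, NLit q])]) @
          (if q = p then [(Init_id, NLit p, [NLit p], [NLit p])] @ [(Weak_l, conj_ndt a, [NLit p, conj_ndt a], [NLit p])]
           else r @ [(Weak_l, NLit q, [NLit q, conj_ndt a], [NLit p])]) @
          [(Dec_l, NDec (NLit q) q (conj_ndt a), [NDec (NLit q) q (conj_ndt a)], [NLit p])]" and
      c = "[]"])
qed (auto intro!: ptime_intros)

text \<open>The recursion parameter is the whole input, from which \<open>ax\<close>,
  \<open>G\<close> and \<open>D\<close> are recomputed at every step; in this way a function
  argument is handled by programs that know only trees.\<close>

lemma ptime_conj_intro [ptime_intros]:
  assumes "ptime (\<lambda>p. ax (fst p) (snd p))" "ptime G" "ptime D" "ptime b"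
  shows "ptime (\<lambda>x. conj_intro (ax x) (G x) (D x) (b x))"
proof (rule ptime_app2[of "\<lambda>x. conj_intro (ax x) (G x) (D x)", OF _ ptime_id assms(4)],
    rule ptime_rec_list[where g = "\<lambda>v. []" and u = "\<lambda>v x. v" and
      h = "\<lambda>v q b r. if b = [] then ax v q else (ax v q @ [(Weak_r, NLit q, G v, NLit q # NLit q # D v)]) @
        (r @ [(Weak_l, NLit q, NLit q # G v, conj_ndt b # D v)]) @
        [(Dec_r, NDec (NLit q) q (conj_ndt b), G v, NDec (NLit q) q (conj_ndt b) # D v)]" and
      c = "[]"])
qed (auto intro!: ptime_intros ptime_app2[OF assms(1)] ptime_app[OF assms(2)] ptime_app[OF assms(3)])

lemma ptime_clause_intro [ptime_intros]:
  "ptime f \<Longrightarrow> ptime g \<Longrightarrow> ptime (\<lambda>x. clause_intro (f x) (g x))"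
  by (rule ptime_app2[of clause_intro], rule ptime_rec_bform[where
        g = "\<lambda>p q. [(Init_id, NLit p, [NLit p], [NLit p])]" and h = "\<lambda>p A B a b. []" and
        k = "\<lambda>p A B a b. (if p \<in> set (lits A)
          then a @ [(Weak_r, to_ndt B, [NLit p], [to_ndt A, to_ndt B])]
          else b @ [(Weak_r, to_ndt A, [NLit p], [to_ndt A, to_ndt B])]) @
          [(Or_r, NOr (to_ndt A) (to_ndt B), [NLit p], [NOr (to_ndt A) (to_ndt B)])]" and
        c = "[]"])
    (auto intro!: ptime_intros)

lemma ptime_contradiction_clause [ptime_intros]:
  "ptime f \<Longrightarrow> ptime g \<Longrightarrow> ptime (\<lambda>x. contradiction_clause (f x) (g x))"
  by (rule ptime_app2[of contradiction_clause], rule ptime_rec_bform[where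
        g = "\<lambda>N p. conj_elim (neg p) N @ [(Init_l, NLit p, [NLit p, NLit (neg p)], [])] @
          mix_cut (NLit (neg p)) [conj_ndt N] [] [NLit p] []" and
        h = "\<lambda>N A B a b. []" and
        k = "\<lambda>N A B a b. a @ b @ [(Or_l, NOr (to_ndt A) (to_ndt B), [NOr (to_ndt A) (to_ndt B), conj_ndt N], [])]" and
        c = "[]"])
    (auto intro!: ptime_intros)

lemma ptime_disj_elim [ptime_intros]:
  assumes "ptime f" "ptime g"
  shows "ptime (\<lambda>x. disj_elim (f x) (g x))"
proof (rule ptime_app2[of disj_elim, OF _ assms], rule ptime_rec_list[where g = "\<lambda>v. []" and u = "\<lambda>v x. v" and
      h = "\<lambda>F p a r. if a = [] then clause_intro p F
        else (r @ [(Weak_r, NLit p, [disj_ndt a], [NLit p, to_ndt F])]) @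
          (clause_intro p F @ [(Weak_l, NLit p, [NLit p, NLit p], [to_ndt F])]) @
          [(Dec_l, NDec (disj_ndt a) p (NLit p), [NDec (disj_ndt a) p (NLit p)], [to_ndt F])]" and
      c = "[]"])
qed (auto intro!: ptime_intros)

lemma ptime_conv_clauses [ptime_intros]:
  assumes "ptime f" "ptime g"
  shows "ptime (\<lambda>x. conv_clauses (f x) (g x))"
proof (rule ptime_app2[of conv_clauses, OF _ assms], rule ptime_rec_list[where g = "\<lambda>v. []" and
      h = "\<lambda>v F Fs r. disj_elim F (lits F) @ r @ mix_cut (to_ndt F) [disj_ndt (lits F)] []
        (map (\<lambda>F. disj_ndt (lits F)) Fs @ map to_ndt (snd v)) (fst v)" and
      u = "\<lambda>v F. (fst v, F # snd v)" and
      c = "[]"])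
qed (auto intro!: ptime_intros)

lemma ptime_lk_to_lndt: "ptime lk_to_lndt"
proof -
  have "ptime (\<lambda>p. conj_left (fst p) (snd p))" "ptime (\<lambda>p. conj_right (fst p) (snd p))"
    "ptime (\<lambda>p. conj_both (fst p) (snd p))"
    unfolding conj_left_def conj_right_def conj_both_def by (intro ptime_intros)+
  note [ptime_intros] = this[THEN ptime_app2]
  have "ptime same_list" "ptime other_list" "ptime excluded_middle" "ptime contradiction" "ptime flip"
    unfolding same_list_def other_list_def excluded_middle_def excluded_middle_clause_def
      contradiction_def flip_def
    by (intro ptime_intros)+
  note [ptime_intros] = this[THEN ptime_app]
  have "ptime (\<lambda>p. move_r (fst p) (fst (snd p)) (snd (snd p)))"
    "ptime (\<lambda>p. move_l (fst p) (fst (snd p)) (snd (snd p)))"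
    unfolding move_r_def move_l_def by (intro ptime_intros)+
  note [ptime_intros] = this[THEN ptime_app3]
  have "ptime (\<lambda>p. and_l_dnf (fst p) (fst (snd p)) (fst (snd (snd p))) (snd (snd (snd p))))"
    "ptime (\<lambda>p. and_r_dnf (fst p) (fst (snd p)) (fst (snd (snd p))) (snd (snd (snd p))))"
    "ptime (\<lambda>p. and_l_cnf (fst p) (fst (snd p)) (fst (snd (snd p))) (snd (snd (snd p))))"
    "ptime (\<lambda>p. and_r_cnf (fst p) (fst (snd p)) (fst (snd (snd p))) (snd (snd (snd p))))"
    unfolding and_l_dnf_def and_r_dnf_def and_l_cnf_def and_r_cnf_def Let_def by (intro ptime_intros)+
  note [ptime_intros] = this[THEN ptime_app4]
  have "ptime lk_direct" unfolding lk_direct_def Let_def by (intro ptime_intros)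
  note [ptime_intros] = ptime_app[OF this]
  have "ptime lk_block" unfolding lk_block_def Let_def by (intro ptime_intros)
  note [ptime_intros] = ptime_app[OF this]
  show ?thesis unfolding lk_to_lndt_def by (intro ptime_intros)
qed

lemma time_lk_to_lndt:
  "\<exists>P q. \<forall>\<pi> S. proof_of two_lk sh \<pi> S \<longrightarrow>
     outputs_in_time P q enc_bform bform_size enc_ndt \<pi> (lk_to_lndt \<pi>)"
proof -
  have "vsz \<pi> \<le> poly [:1, 16, 8:] (proof_size bform_size \<pi>)" if "proof_of two_lk sh \<pi> S" for \<pi> S
  proof (rule vsz_proof[OF proof_of_uses[OF that] _ _ _ bform_size_pos])
    show "vsz A \<le> 8 * bform_size A" for A using vsz_bform[of A] by simp
    show "holds false_bform S" if "two_lk r A Ss S" "\<forall>S\<in>set Ss. holds false_bform S" for r A Ss S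
      using lk_sound[of r A Ss S] that unfolding two_lk_def by blast
    show "\<exists>T\<in>set (S # Ss). principal_in A T" if "two_lk r A Ss S" for r A Ss S
      using lk_principal[of r A Ss S] that unfolding two_lk_def by blast
  qed
  then show ?thesis
    using ptime_outputs[OF ptime_lk_to_lndt, of enc_bform enc_ndt "[:1, 16, 8:]" bform_size] by fastforce
qed

theorem theorem4p8:
  fixes sh :: shape
  shows "(\<exists>(P :: prog) (q :: nat poly). \<forall>(As :: dt list) (Bs :: dt list) (\<pi> :: ndt line list).
            proof_of lndt sh \<pi> (mset (map ndt_of As), mset (map ndt_of Bs)) \<longrightarrow>
            (\<exists>\<pi>' :: bform line list.
               outputs_in_time P q enc_ndt ndt_size enc_bform \<pi> \<pi>' \<and>
               proof_of two_lk sh \<pi>' (sum_list (map Cls As), sum_list (map Tms Bs))))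
       \<and> (\<exists>(P :: prog) (q :: nat poly).
            \<forall>(as :: lit list list) (bs :: lit list list) (Fs :: bform list) (Gs :: bform list)
               (\<pi> :: bform line list).
            (\<forall>a \<in> set as. a \<noteq> []) \<and> (\<forall>b \<in> set bs. b \<noteq> []) \<and>
            list_all2 big_or as Fs \<and> list_all2 big_and bs Gs \<and>
            proof_of two_lk sh \<pi> (mset Fs, mset Gs) \<longrightarrow>
            (\<exists>\<pi>' :: ndt line list.
               outputs_in_time P q enc_bform bform_size enc_ndt \<pi> \<pi>' \<and>
               proof_of lndt sh \<pi>'
                 (mset (map (ndt_of \<circ> Disj) as), mset (map (ndt_of \<circ> Conj) bs))))"
  (is "?A \<and> ?B")
proof
  obtain P q where "\<forall>\<pi> S. proof_of lndt sh \<pi> S \<longrightarrow>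
      outputs_in_time P q enc_ndt ndt_size enc_bform \<pi> (lndt_to_lk \<pi>)"
    using time_lndt_to_lk by blast
  then show ?A
    by (intro exI[of _ P] exI[of _ q] allI impI) (blast intro: lndt_to_lk_correct)
  obtain P q where "\<forall>\<pi> S. proof_of two_lk sh \<pi> S \<longrightarrow>
      outputs_in_time P q enc_bform bform_size enc_ndt \<pi> (lk_to_lndt \<pi>)"
    using time_lk_to_lndt by blast
  then show ?B
    by (intro exI[of _ P] exI[of _ q] allI impI, elim conjE) (blast intro: lk_to_lndt_correct)
qed

end
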